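(* Let $\mathcal P$ be an operad in $\mathbb F_2$-vector spaces, let $\star\in\mathcal P(2)^{\mathfrak S_2}$ be a $\mathcal P$-central operation, and let $M$ be a connected reduced unstable module over the mod 2 Steenrod algebra. Then there exists an isomorphism of graded $\mathcal P$-algebras between the free $\star$-unstable $\mathcal P$-algebra $K_{\mathcal P}^\star(M)$ generated by $M$ and the free $\mathcal P$-algebra $S(\mathcal P,\Sigma\Omega M)$ generated by $\Sigma\Omega M$.
   Context: Base field $\mathbb F=\mathbb F_2$. $\mathcal A$ is the mod 2 Steenrod algebra, generated by $Sq^i$ ($i>0$) with $Sq^0=1$. $\mathcal U$ is the category of unstable modules: graded left $\mathcal A$-modules $M$ with $Sq^ix=0$ whenever $i>|x|$. For homogeneous $x$, $Sq_0x:=Sq^{|x|}x$, extended additively. Tensor products in $\mathcal U$ carry the action $Sq^i(x\otimes y)=\sum_{k+l=i}Sq^kx\otimes Sq^ly$. Operads are symmetric operads in $\mathbb F$-vector spaces ($\mathfrak S_n$ acts on $\mathcal P(n)$ on the right). $S(\mathcal P,V)=\bigoplus_{n\ge0}\mathcal P(n)\otimes_{\mathfrak S_n}V^{\otimes n}$ is the free $\mathcal P$-algebra on $V$. Regarding $\mathcal P$ as concentrated in degree $0$, one has the notion of a $\mathcal P$-algebra in $\mathcal U$ (algebra over the monad $S(\mathcal P,-)$ on $\mathcal U$). For $\star\in\mathcal P(2)^{\mathfrak S_2}$, a $\star$-unstable $\mathcal P$-algebra is a $\mathcal P$-algebra $N$ in $\mathcal U$ such that $Sq_0x=\star(x,x)$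 for all $x\in N$. $K_{\mathcal P}^\star(M)$ is the free $\star$-unstable $\mathcal P$-algebra generated by $M$, i.e. the value at $M$ of the left adjoint of the forgetful functor from $\star$-unstable $\mathcal P$-algebras to $\mathcal U$; explicitly, it is the quotient of $S(\mathcal P,M)$ by the smallest $\mathcal P$-ideal stable under $\mathcal A$ containing all $Sq_0\mathfrak t+\star(\mathfrak t,\mathfrak t)$, $\mathfrak t\in S(\mathcal P,M)$. (A $\mathcal P$-ideal $I$ of a $\mathcal P$-algebra $A$ is a subspace with $\mu(a_1,\dots,a_n)\in I$ whenever $\mu\in\mathcal P(n)$, $a_1,\dots,a_n\in A$ and $a_n\in I$.) $\star\in\mathcal P(2)^{\mathfrak S_2}$ is $\mathcal P$-central if for all $n$ and all $\mu\in\mathcal P(n)$, $\star(\mu,\mu)=\big(\mu(\star,\dots,\star)\big)\sigma_{2n}$ in $\mathcal P(2n)$, where $\sigma_{2n}\in\mathfrak S_{2n}$ maps $2i\mapsto n+i$ and $2i-1\mapsto i$ for $1\le i\le n$; in terms of inputs: $\star(\mu(x_1,\dots,x_n),\mu(x_{n+1},\dots,x_{2n}))=\mu(\star(x_1,x_{n+1}),\dots,\star(x_n,x_{2n}))$. $M$ is reduced if $Sq_0:M\to M$ is injective, and connected if $M^0=0$. $\Sigma:\mathcal U\to\mathcal U$ is the suspension, $(\Sigma M)^d=M^{d-1}$, $Sq^i(\sigma x)=\sigma(Sq^ix)$; $\Omega$ is its left adjoint, and $\Sigma\Omega M\cong M/\operatorname{Im}(Sq_0)$. *)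

theory Defs
  imports
    "HOL-Library.Z2"
    "HOL-Library.Poly_Mapping"
    "HOL-Combinatorics.Permutations"
    "HOL-Algebra.Module"
    "HOL-Algebra.AbelCoset"
    "HOL-Algebra.Algebraic_Closure_Type"
begin

section \<open>Graded vector spaces over the field with two elements\<close>

abbreviation F2 :: "bit ring" where
  "F2 \<equiv> ring_of_type_algebra"

definition linear_map :: "(bit, 'a, 'c) module_scheme \<Rightarrow> (bit, 'b, 'd) module_scheme \<Rightarrow> ('a \<Rightarrow> 'b) \<Rightarrow> bool"
  where "linear_map V W f \<longleftrightarrow>
    f \<in> carrier V \<rightarrow> carrier W \<and>
    (\<forall>x\<in>carrier V. \<forall>y\<in>carrier V. f (x \<oplus>\<^bsub>V\<^esub> y) = f x \<oplus>\<^bsub>W\<^esub> f y) \<and>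
    (\<forall>c. \<forall>x\<in>carrier V. f (c \<odot>\<^bsub>V\<^esub> x) = c \<odot>\<^bsub>W\<^esub> f x)"

definition lin_span :: "(bit, 'a, 'c) module_scheme \<Rightarrow> 'a set \<Rightarrow> 'a set"
  where "lin_span V T = \<Inter>{W. submodule W F2 V \<and> T \<subseteq> W}"

text \<open>
  A graded vector space is a vector space together with subspaces \<open>hpart V d\<close>, for \<open>d \<ge> 0\<close>,
  of which it is the internal direct sum. The fields \<open>mult\<close> and \<open>one\<close> that the record inherits
  from rings play no role.
\<close>

record 'a gvs = "(bit, 'a) module" +
  hpart :: "nat \<Rightarrow> 'a set"

definition homog_decomp :: "('a, 'c) gvs_scheme \<Rightarrow> 'a \<Rightarrow> (nat \<Rightarrow> 'a) \<Rightarrow> bool"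
  where "homog_decomp V x f \<longleftrightarrow>
    (\<forall>d. f d \<in> hpart V d) \<and> finite {d. f d \<noteq> \<zero>\<^bsub>V\<^esub>} \<and>
    x = (\<Oplus>\<^bsub>V\<^esub>d\<in>{d. f d \<noteq> \<zero>\<^bsub>V\<^esub>}. f d)"

locale graded_space = module F2 V for V :: "('a, 'c) gvs_scheme" (structure) +
  assumes hpart_submodule: "submodule (hpart V d) F2 V"
    and decomp_unique: "x \<in> carrier V \<Longrightarrow> \<exists>!f. homog_decomp V x f"

definition hcomp :: "('a, 'c) gvs_scheme \<Rightarrow> 'a \<Rightarrow> nat \<Rightarrow> 'a"
  where "hcomp V x = (THE f. homog_decomp V x f)"

text \<open>
  Maps on quotients are defined by uniting the cosets of the images of all representatives; this
  union is a single coset whenever the map passes to the quotient.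
\<close>

definition quot_gvs :: "('a, 'c) gvs_scheme \<Rightarrow> 'a set \<Rightarrow> 'a set gvs"
  where "quot_gvs V W =
    \<lparr> carrier = a_rcosets\<^bsub>V\<^esub> W, monoid.mult = undefined, monoid.one = undefined,
      zero = W, add = set_add V,
      module.smult = (\<lambda>c T. \<Union>x\<in>T. W +>\<^bsub>V\<^esub> (c \<odot>\<^bsub>V\<^esub> x)),
      hpart = (\<lambda>d. (\<lambda>x. W +>\<^bsub>V\<^esub> x) ` hpart V d) \<rparr>"

definition quot_map :: "('a, 'c) gvs_scheme \<Rightarrow> 'a set \<Rightarrow> ('a \<Rightarrow> 'a) \<Rightarrow> 'a set \<Rightarrow> 'a set"
  where "quot_map V W f T = (\<Union>x\<in>T. W +>\<^bsub>V\<^esub> f x)"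


section \<open>Unstable modules over the mod 2 Steenrod algebra\<close>

text \<open>
  The Steenrod algebra is presented by the generators \<open>Sq\<^sup>i\<close>, \<open>i > 0\<close>, subject to the Adem
  relations, with \<open>Sq\<^sup>0 = 1\<close>. So a graded module over it is a graded vector space with
  operators \<open>Sq i\<close> of degree \<open>i\<close> that satisfy these relations. In an unstable module the
  elements of negative degree vanish, being killed by \<open>Sq\<^sup>0\<close>, so degrees are natural numbers.
\<close>

record 'a umod = "'a gvs" +
  Sq :: "nat \<Rightarrow> 'a \<Rightarrow> 'a"

locale unstable_module = graded_space M for M :: "'a umod" (structure) +
  assumes Sq_linear: "linear_map M M (Sq M i)"
    and Sq_degree: "x \<in> hpart M d \<Longrightarrow> Sq M i x \<in> hpart M (d + i)"
    and Sq_zero: "x \<in> carrier M \<Longrightarrow> Sq M 0 x = x"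
    and Adem: "\<lbrakk>0 < a; a < 2 * b; x \<in> carrier M\<rbrakk> \<Longrightarrow>
      Sq M a (Sq M b x) =
        (\<Oplus>\<^bsub>M\<^esub>c\<in>{0..a div 2}.
          of_nat ((b - c - 1) choose (a - 2 * c)) \<odot>\<^bsub>M\<^esub> Sq M (a + b - c) (Sq M c x))"
    and unstable: "\<lbrakk>x \<in> hpart M d; d < i\<rbrakk> \<Longrightarrow> Sq M i x = \<zero>\<^bsub>M\<^esub>"

definition Sq0 :: "('a, 'c) gvs_scheme \<Rightarrow> (nat \<Rightarrow> 'a \<Rightarrow> 'a) \<Rightarrow> 'a \<Rightarrow> 'a"
  where "Sq0 V sq x = (\<Oplus>\<^bsub>V\<^esub>d\<in>{d. hcomp V x d \<noteq> \<zero>\<^bsub>V\<^esub>}. sq d (hcomp V x d))"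

definition reduced :: "('a, 'c) umod_scheme \<Rightarrow> bool"
  where "reduced M \<longleftrightarrow> inj_on (Sq0 M (Sq M)) (carrier M)"

definition connected_module :: "('a, 'c) umod_scheme \<Rightarrow> bool"
  where "connected_module M \<longleftrightarrow> hpart M 0 = {\<zero>\<^bsub>M\<^esub>}"

definition suspension :: "'a umod \<Rightarrow> 'a umod"
  where "suspension N = N\<lparr> hpart := (\<lambda>d. if d = 0 then {\<zero>\<^bsub>N\<^esub>} else hpart N (d - 1)) \<rparr>"

text \<open>
  \<open>Sq\<^sub>0\<close> is the identity in degree 0, so the cokernel of \<open>Sq\<^sub>0\<close> vanishes there and is the
  suspension of the module obtained by shifting it down by one degree; that module is \<open>\<Omega> M\<close>.
\<close>

definition loop_module :: "'a umod \<Rightarrow> 'a set umod"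
  where "loop_module M =
    (let W = Sq0 M (Sq M) ` carrier M; Q = quot_gvs M W in
      gvs.extend (Q\<lparr> hpart := (\<lambda>d. hpart Q (Suc d)) \<rparr>)
        (umod.fields (\<lambda>i. quot_map M W (Sq M i))))"


section \<open>Symmetric operads\<close>

text \<open>
  A list \<open>[(k\<^sub>1, \<nu>\<^sub>1), \<dots>, (k\<^sub>n, \<nu>\<^sub>n)]\<close> stands for operations \<open>\<nu>\<^sub>i\<close> of arity \<open>k\<^sub>i\<close>, and
  \<open>ocomp P \<mu> [(k\<^sub>1, \<nu>\<^sub>1), \<dots>, (k\<^sub>n, \<nu>\<^sub>n)]\<close> is \<open>\<mu>(\<nu>\<^sub>1, \<dots>, \<nu>\<^sub>n)\<close>. The spaces of operations of
  different arities need not be disjoint, which is why arities are recorded.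

  Inputs are numbered from 0. A permutation acts by
  \<open>(\<mu> \<sigma>)(x\<^sub>0, \<dots>, x\<^sub>n\<^sub>-\<^sub>1) = \<mu>(x\<^sub>\<sigma>\<^sub>(\<^sub>0\<^sub>), \<dots>, x\<^sub>\<sigma>\<^sub>(\<^sub>n\<^sub>-\<^sub>1\<^sub>))\<close>, where the right hand side is
  \<open>\<mu>\<close> applied to \<open>permute_list \<sigma> [x\<^sub>0, \<dots>, x\<^sub>n\<^sub>-\<^sub>1]\<close>. This is a right action for the product
  of permutations written from left to right, i.e. \<open>(\<mu> \<sigma>) \<tau> = \<mu> (\<tau> \<circ> \<sigma>)\<close>; passing to
  inverses gives the convention with the other order of multiplication.
\<close>

record 'p operad =
  ops :: "nat \<Rightarrow> (bit, 'p) module"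
  ounit :: 'p
  osym :: "nat \<Rightarrow> 'p \<Rightarrow> (nat \<Rightarrow> nat) \<Rightarrow> 'p"
  ocomp :: "'p \<Rightarrow> (nat \<times> 'p) list \<Rightarrow> 'p"

definition inputs :: "('p, 'c) operad_scheme \<Rightarrow> (nat \<times> 'p) list set"
  where "inputs P = {\<nu>s. \<forall>(k, \<nu>)\<in>set \<nu>s. \<nu> \<in> carrier (ops P k)}"

abbreviation arity :: "(nat \<times> 'p) list \<Rightarrow> nat"
  where "arity \<nu>s \<equiv> sum_list (map fst \<nu>s)"

text \<open>The permutation with one-line notation \<open>js\<close>.\<close>

definition one_line :: "nat list \<Rightarrow> nat \<Rightarrow> nat"
  where "one_line js i = (if i < length js then js ! i else i)"

text \<open>
  The consecutive blocks of lengths \<open>ks\<close> into which the inputs of a composite operation are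
  divided, e.g. \<open>blocks [2, 3] = [[0, 1], [2, 3, 4]]\<close>.
\<close>

definition blocks :: "nat list \<Rightarrow> nat list list"
  where "blocks ks =
    map (\<lambda>i. [sum_list (take i ks)..<sum_list (take (Suc i) ks)]) [0..<length ks]"

locale symmetric_operad =
  fixes P :: "'p operad"
  assumes ops_space: "module F2 (ops P n)"
    and unit_closed: "ounit P \<in> carrier (ops P 1)"
    and sym_linear: "\<sigma> permutes {..<n} \<Longrightarrow> linear_map (ops P n) (ops P n) (\<lambda>\<mu>. osym P n \<mu> \<sigma>)"
    and sym_id: "\<mu> \<in> carrier (ops P n) \<Longrightarrow> osym P n \<mu> id = \<mu>"
    and sym_sym: "\<lbrakk>\<mu> \<in> carrier (ops P n); \<sigma> permutes {..<n}; \<tau> permutes {..<n}\<rbrakk> \<Longrightarrow>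
      osym P n (osym P n \<mu> \<sigma>) \<tau> = osym P n \<mu> (\<tau> \<circ> \<sigma>)"
    and comp_linear: "\<nu>s \<in> inputs P \<Longrightarrow>
      linear_map (ops P (length \<nu>s)) (ops P (arity \<nu>s)) (\<lambda>\<mu>. ocomp P \<mu> \<nu>s)"
    and comp_multilinear: "\<lbrakk>\<alpha>s \<in> inputs P; \<beta>s \<in> inputs P;
        \<mu> \<in> carrier (ops P (length \<alpha>s + 1 + length \<beta>s))\<rbrakk> \<Longrightarrow>
      linear_map (ops P k) (ops P (arity \<alpha>s + k + arity \<beta>s))
        (\<lambda>\<nu>. ocomp P \<mu> (\<alpha>s @ (k, \<nu>) # \<beta>s))"
    and comp_unit_left: "\<mu> \<in> carrier (ops P n) \<Longrightarrow> ocomp P (ounit P) [(n, \<mu>)] = \<mu>"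
    and comp_unit_right: "\<mu> \<in> carrier (ops P n) \<Longrightarrow>
      ocomp P \<mu> (replicate n (1, ounit P)) = \<mu>"
    and comp_assoc: "\<lbrakk>\<nu>s \<in> inputs P; \<mu> \<in> carrier (ops P (length \<nu>s));
        set \<rho>ss \<subseteq> inputs P; map length \<rho>ss = map fst \<nu>s\<rbrakk> \<Longrightarrow>
      ocomp P (ocomp P \<mu> \<nu>s) (concat \<rho>ss) =
        ocomp P \<mu> (map2 (\<lambda>(k, \<nu>) \<rho>s. (arity \<rho>s, ocomp P \<nu> \<rho>s)) \<nu>s \<rho>ss)"
    and comp_sym_outer: "\<lbrakk>\<nu>s \<in> inputs P; \<mu> \<in> carrier (ops P (length \<nu>s));
        \<sigma> permutes {..<length \<nu>s}\<rbrakk> \<Longrightarrow>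
      ocomp P (osym P (length \<nu>s) \<mu> \<sigma>) \<nu>s =
        osym P (arity \<nu>s) (ocomp P \<mu> (permute_list \<sigma> \<nu>s))
          (one_line (concat (permute_list \<sigma> (blocks (map fst \<nu>s)))))"
    and comp_sym_inner: "\<lbrakk>\<nu>s \<in> inputs P; \<mu> \<in> carrier (ops P (length \<nu>s));
        list_all2 (\<lambda>(k, \<nu>) \<tau>. \<tau> permutes {..<k}) \<nu>s \<tau>s\<rbrakk> \<Longrightarrow>
      ocomp P \<mu> (map2 (\<lambda>(k, \<nu>) \<tau>. (k, osym P k \<nu> \<tau>)) \<nu>s \<tau>s) =
        osym P (arity \<nu>s) (ocomp P \<mu> \<nu>s)
          (one_line (concat (map2 permute_list \<tau>s (blocks (map fst \<nu>s)))))"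

definition invariant_ops :: "'p operad \<Rightarrow> nat \<Rightarrow> 'p set"
  where "invariant_ops P n =
    {\<mu> \<in> carrier (ops P n). \<forall>\<sigma>. \<sigma> permutes {..<n} \<longrightarrow> osym P n \<mu> \<sigma> = \<mu>}"

text \<open>
  With inputs numbered from 1 this is \<open>2i \<mapsto> n + i\<close> and \<open>2i - 1 \<mapsto> i\<close>, for \<open>1 \<le> i \<le> n\<close>.
\<close>

definition unshuffle :: "nat \<Rightarrow> nat \<Rightarrow> nat"
  where "unshuffle n j =
    (if j < 2 * n then if even j then j div 2 else n + j div 2 else j)"

definition central_op :: "'p operad \<Rightarrow> 'p \<Rightarrow> bool"
  where "central_op P s \<longleftrightarrow>
    (\<forall>n. \<forall>\<mu>\<in>carrier (ops P n).
      ocomp P s [(n, \<mu>), (n, \<mu>)] =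
        osym P (2 * n) (ocomp P \<mu> (replicate n (2, s))) (unshuffle n))"


section \<open>Graded algebras over an operad\<close>

text \<open>
  \<open>opr A \<mu> [a\<^sub>1, \<dots>, a\<^sub>n]\<close> is \<open>\<mu>(a\<^sub>1, \<dots>, a\<^sub>n)\<close>, for \<open>\<mu>\<close> of arity \<open>n\<close>.
\<close>

record ('p, 'a) palg = "'a gvs" +
  opr :: "'p \<Rightarrow> 'a list \<Rightarrow> 'a"

definition palg_ideal :: "'p operad \<Rightarrow> ('p, 'a) palg \<Rightarrow> 'a set \<Rightarrow> bool"
  where "palg_ideal P A I \<longleftrightarrow>
    submodule I F2 A \<and>
    (\<forall>as a. \<forall>\<mu>\<in>carrier (ops P (Suc (length as))).
      set as \<subseteq> carrier A \<longrightarrow> a \<in> I \<longrightarrow> opr A \<mu> (as @ [a]) \<in> I)"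

definition palg_quot :: "('p, 'a) palg \<Rightarrow> 'a set \<Rightarrow> ('p, 'a set) palg"
  where "palg_quot A I =
    gvs.extend (quot_gvs A I)
      (palg.fields (\<lambda>\<mu> Ts. \<Union>as\<in>listset Ts. I +>\<^bsub>A\<^esub> opr A \<mu> as))"

definition graded_palg_iso ::
    "'p operad \<Rightarrow> ('p, 'a) palg \<Rightarrow> ('p, 'b) palg \<Rightarrow> ('a \<Rightarrow> 'b) \<Rightarrow> bool"
  where "graded_palg_iso P A B \<phi> \<longleftrightarrow>
    linear_map A B \<phi> \<and> bij_betw \<phi> (carrier A) (carrier B) \<and>
    (\<forall>d. \<phi> ` hpart A d = hpart B d) \<and>
    (\<forall>as. \<forall>\<mu>\<in>carrier (ops P (length as)).
      set as \<subseteq> carrier A \<longrightarrow> \<phi> (opr A \<mu> as) = opr B \<mu> (map \<phi> as))"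


section \<open>The free algebra over an operad\<close>

text \<open>
  The free algebra on \<open>V\<close> is the sum over \<open>n\<close> of the coinvariants of \<open>P(n) \<otimes> V\<^sup>\<otimes>\<^sup>n\<close>. It
  is obtained from the vector space with basis the words \<open>(\<mu>, [x\<^sub>1, \<dots>, x\<^sub>n])\<close>, which stand
  for \<open>\<mu> \<otimes> x\<^sub>1 \<otimes> \<dots> \<otimes> x\<^sub>n\<close>, by imposing multilinearity and
  \<open>\<mu> \<sigma> \<otimes> x\<^sub>1 \<otimes> \<dots> \<otimes> x\<^sub>n = \<mu> \<otimes> x\<^sub>\<sigma>\<^sub>(\<^sub>1\<^sub>) \<otimes> \<dots> \<otimes> x\<^sub>\<sigma>\<^sub>(\<^sub>n\<^sub>)\<close>. Degrees add up, the
  operad being concentrated in degree 0.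
\<close>

type_synonym ('p, 'a) word = "'p \<times> 'a list"

definition words :: "'p operad \<Rightarrow> ('a, 'c) gvs_scheme \<Rightarrow> ('p, 'a) word set"
  where "words P V = {(\<mu>, xs). \<mu> \<in> carrier (ops P (length xs)) \<and> set xs \<subseteq> carrier V}"

definition homog_words :: "'p operad \<Rightarrow> ('a, 'c) gvs_scheme \<Rightarrow> nat \<Rightarrow> ('p, 'a) word set"
  where "homog_words P V d =
    {(\<mu>, xs). \<mu> \<in> carrier (ops P (length xs)) \<and>
      (\<exists>ds. list_all2 (\<lambda>x e. x \<in> hpart V e) xs ds \<and> sum_list ds = d)}"

definition word_opr :: "'p operad \<Rightarrow> 'p \<Rightarrow> ('p, 'a) word list \<Rightarrow> ('p, 'a) word"
  where "word_opr P \<mu> ws =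
    (ocomp P \<mu> (map (\<lambda>(\<nu>, xs). (length xs, \<nu>)) ws), concat (map snd ws))"

definition word_alg ::
    "'p operad \<Rightarrow> ('a, 'c) gvs_scheme \<Rightarrow> ('p, ('p, 'a) word \<Rightarrow>\<^sub>0 bit) palg"
  where "word_alg P V =
    \<lparr> carrier = {f. Poly_Mapping.keys f \<subseteq> words P V}, monoid.mult = undefined, monoid.one = undefined,
      zero = 0, add = (+),
      module.smult = (\<lambda>c. Poly_Mapping.map ((*) c)),
      hpart = (\<lambda>d. {f. Poly_Mapping.keys f \<subseteq> homog_words P V d}),
      opr = (\<lambda>\<mu> fs. \<Sum>ws\<in>listset (map Poly_Mapping.keys fs).
        Poly_Mapping.single (word_opr P \<mu> ws)
          (\<Prod>i<length fs. Poly_Mapping.lookup (fs ! i) (ws ! i))) \<rparr>"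

abbreviation wd :: "'p \<Rightarrow> 'a list \<Rightarrow> ('p, 'a) word \<Rightarrow>\<^sub>0 bit"
  where "wd \<mu> xs \<equiv> Poly_Mapping.single (\<mu>, xs) 1"

inductive_set word_rels :: "'p operad \<Rightarrow> ('a, 'c) gvs_scheme \<Rightarrow> (('p, 'a) word \<Rightarrow>\<^sub>0 bit) set"
  for P :: "'p operad" and V :: "('a, 'c) gvs_scheme"
  where
    op_add: "\<lbrakk>\<mu> \<in> carrier (ops P (length xs)); \<nu> \<in> carrier (ops P (length xs));
        set xs \<subseteq> carrier V\<rbrakk> \<Longrightarrow>
      wd (\<mu> \<oplus>\<^bsub>ops P (length xs)\<^esub> \<nu>) xs - (wd \<mu> xs + wd \<nu> xs) \<in> word_rels P V"
  | op_smult: "\<lbrakk>\<mu> \<in> carrier (ops P (length xs)); set xs \<subseteq> carrier V\<rbrakk> \<Longrightarrow>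
      wd (c \<odot>\<^bsub>ops P (length xs)\<^esub> \<mu>) xs - Poly_Mapping.map ((*) c) (wd \<mu> xs) \<in> word_rels P V"
  | arg_add: "\<lbrakk>\<mu> \<in> carrier (ops P (length xs + 1 + length ys)); set xs \<subseteq> carrier V;
        set ys \<subseteq> carrier V; x \<in> carrier V; y \<in> carrier V\<rbrakk> \<Longrightarrow>
      wd \<mu> (xs @ (x \<oplus>\<^bsub>V\<^esub> y) # ys) - (wd \<mu> (xs @ x # ys) + wd \<mu> (xs @ y # ys))
        \<in> word_rels P V"
  | arg_smult: "\<lbrakk>\<mu> \<in> carrier (ops P (length xs + 1 + length ys)); set xs \<subseteq> carrier V;
        set ys \<subseteq> carrier V; x \<in> carrier V\<rbrakk> \<Longrightarrow>
      wd \<mu> (xs @ (c \<odot>\<^bsub>V\<^esub> x) # ys) - Poly_Mapping.map ((*) c) (wd \<mu> (xs @ x # ys))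
        \<in> word_rels P V"
  | sym: "\<lbrakk>\<mu> \<in> carrier (ops P (length xs)); set xs \<subseteq> carrier V;
        \<sigma> permutes {..<length xs}\<rbrakk> \<Longrightarrow>
      wd (osym P (length xs) \<mu> \<sigma>) xs - wd \<mu> (permute_list \<sigma> xs) \<in> word_rels P V"

definition word_rel_space ::
    "'p operad \<Rightarrow> ('a, 'c) gvs_scheme \<Rightarrow> (('p, 'a) word \<Rightarrow>\<^sub>0 bit) set"
  where "word_rel_space P V = lin_span (word_alg P V) (word_rels P V)"

definition free_palg ::
    "'p operad \<Rightarrow> ('a, 'c) gvs_scheme \<Rightarrow> ('p, (('p, 'a) word \<Rightarrow>\<^sub>0 bit) set) palg"
  where "free_palg P V = palg_quot (word_alg P V) (word_rel_space P V)"

text \<open>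
  The Steenrod operations on the free algebra generated by an unstable module, given by
  \<open>Sq\<^sup>i(\<mu> \<otimes> x\<^sub>1 \<otimes> \<dots> \<otimes> x\<^sub>n) = \<Sum> \<mu> \<otimes> Sq\<^sup>i\<^sup>1 x\<^sub>1 \<otimes> \<dots> \<otimes> Sq\<^sup>i\<^sup>n x\<^sub>n\<close> over \<open>i1 + \<dots> + in = i\<close>,
  the iterated Cartan formula.
\<close>

definition word_Sq ::
    "('a, 'c) umod_scheme \<Rightarrow> nat \<Rightarrow> (('p, 'a) word \<Rightarrow>\<^sub>0 bit) \<Rightarrow> ('p, 'a) word \<Rightarrow>\<^sub>0 bit"
  where "word_Sq M i f =
    (\<Sum>(\<mu>, xs)\<in>Poly_Mapping.keys f.
      \<Sum>js\<in>{js. length js = length xs \<and> sum_list js = i}.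
        Poly_Mapping.single (\<mu>, map2 (Sq M) js xs) (Poly_Mapping.lookup f (\<mu>, xs)))"

definition free_Sq ::
    "'p operad \<Rightarrow> ('a, 'c) umod_scheme \<Rightarrow> nat \<Rightarrow>
      (('p, 'a) word \<Rightarrow>\<^sub>0 bit) set \<Rightarrow> (('p, 'a) word \<Rightarrow>\<^sub>0 bit) set"
  where "free_Sq P M i = quot_map (word_alg P M) (word_rel_space P M) (word_Sq M i)"


section \<open>The free unstable algebra for a binary operation\<close>

definition K_ideal ::
    "'p operad \<Rightarrow> 'p \<Rightarrow> ('a, 'c) umod_scheme \<Rightarrow> (('p, 'a) word \<Rightarrow>\<^sub>0 bit) set set"
  where "K_ideal P s M =
    (let S = free_palg P M in
      \<Inter>{I. palg_ideal P S I \<and>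
        (\<forall>i. \<forall>t\<in>I. free_Sq P M i t \<in> I) \<and>
        (\<forall>t\<in>carrier S. Sq0 S (free_Sq P M) t \<oplus>\<^bsub>S\<^esub> opr S s [t, t] \<in> I)})"

definition K_alg ::
    "'p operad \<Rightarrow> 'p \<Rightarrow> ('a, 'c) umod_scheme \<Rightarrow> ('p, (('p, 'a) word \<Rightarrow>\<^sub>0 bit) set set) palg"
  where "K_alg P s M = palg_quot (free_palg P M) (K_ideal P s M)"

end

theory Submission
  imports Defs
begin

text \<open>
  Because \<open>M\<close> is reduced, \<open>Sq\<^sub>0\<close> has a graded linear left inverse \<open>\<delta>\<close>, and because \<open>M\<close> is connected,
  \<open>\<delta>\<close> is locally nilpotent: \<open>M\<close> is the sum of the subspaces \<open>Sq\<^sub>0\<^sup>k C\<close>, where \<open>C = ker \<delta>\<close> is isomorphic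
  to \<open>M / Im Sq\<^sub>0\<close>. Sending \<open>Sq\<^sub>0\<^sup>k c\<close> to the \<open>k\<close>-fold iterate of \<open>a \<mapsto> \<star>(a, a)\<close> at the class of \<open>c\<close>
  extends to an algebra map \<open>S(P, M) \<rightarrow> S(P, M / Im Sq\<^sub>0)\<close>. By centrality it identifies \<open>Sq\<^sub>0 t\<close> with
  \<open>\<star>(t, t)\<close>. Since \<open>Sq\<^sup>i\<close> maps \<open>Sq\<^sub>0 t + \<star>(t, t)\<close> to the element of the same form for \<open>Sq\<^sup>i\<^sup>/\<^sup>2 t\<close>, or to 0 when
  \<open>i\<close> is odd, the whole ideal defining \<open>K\<close> is killed. The map induced by the inclusion of \<open>C\<close> in \<open>M\<close>
  is a section of it and an inverse modulo that ideal.
\<close>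

section \<open>Vector spaces over the field with two elements\<close>

text \<open>On the free algebra both \<open>Sq_0\<close> and
  \<open>a \<mapsto> \<star>(a, a)\<close> are additive and commute with all operations: the former
  by the Cartan formula, of which instability leaves one term in the top degree, the latter by the
  symmetry of \<open>\<star>\<close> in characteristic 2 together with centrality. Maps of this kind
  need to be compared on generators only. The obstacle is that the ideal defining \<open>K\<close>
  has to be stable under the Steenrod algebra, whereas \<open>\<delta>\<close> and \<open>C\<close>
  are chosen by linear algebra alone, so that nothing makes the comparison map commute with the
  squares. The squares are therefore never transported to the target. Instead one considers the
  elements of \<open>S(P, M)\<close> all of whose iterated squares die in the target; they form a
  stable ideal, and it contains the generators. Computations take place on formal sums of words, up
  to congruence modulo the relations or modulo the ideal of \<open>K\<close>. There every map has an
  explicit formula, and quotients enter only at the end.\<close>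

lemma F2_simps [simp]:
  "carrier F2 = UNIV" "zero F2 = 0" "monoid.one F2 = 1"
  "add F2 a b = a + b" "monoid.mult F2 a b = a * b"
  by (simp_all add: ring_of_type_algebra_def)

text \<open>The only scalars are 0 and 1, so an action is determined by what these two do, and
  distributivity over \<open>1 + 1 = 0\<close> is the statement that every element is its own
  negative.\<close>

lemma F2_moduleI:
  fixes V (structure)
  assumes "abelian_group V"
    and self: "\<And>x. x \<in> carrier V \<Longrightarrow> x \<oplus> x = \<zero>"
    and zero: "\<And>x. x \<in> carrier V \<Longrightarrow> (0::bit) \<odot> x = \<zero>"
    and one: "\<And>x. x \<in> carrier V \<Longrightarrow> (1::bit) \<odot> x = x"
  shows "module F2 V"
proof -
  interpret abelian_group V by fact
  show ?thesis
  proof (rule moduleI)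
    show "cring F2" by (rule cring_from_type_algebra)
    show "abelian_group V" by fact
  next
    fix a :: bit and x
    assume "x \<in> carrier V"
    then show "a \<odot> x \<in> carrier V" by (cases a) (auto simp: zero one)
  next
    fix a b :: bit and x
    assume "x \<in> carrier V"
    then show "(a \<oplus>\<^bsub>F2\<^esub> b) \<odot> x = a \<odot> x \<oplus> b \<odot> x"
      and "(a \<otimes>\<^bsub>F2\<^esub> b) \<odot> x = a \<odot> (b \<odot> x)"
      by (cases a; cases b; auto simp: zero one self)+
  next
    fix a :: bit and x y
    assume "x \<in> carrier V" "y \<in> carrier V"
    then show "a \<odot> (x \<oplus> y) = a \<odot> x \<oplus> a \<odot> y"
      by (cases a) (auto simp: zero one)
  qed (auto simp: one)
qed

locale f2_space = module F2 V for V (structure)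
begin

lemma smult_bit:
  "x \<in> carrier V \<Longrightarrow> (0::bit) \<odot> x = \<zero>" "x \<in> carrier V \<Longrightarrow> (1::bit) \<odot> x = x"
  using smult_l_null[of x] smult_one[of x] by simp_all

lemma add_self [simp]: "x \<in> carrier V \<Longrightarrow> x \<oplus> x = \<zero>"
  using smult_l_distr[of 1 1 x] by (simp add: smult_bit)

lemma add_self_left [simp]: "\<lbrakk>x \<in> carrier V; y \<in> carrier V\<rbrakk> \<Longrightarrow> x \<oplus> (x \<oplus> y) = y"
  by (simp flip: a_assoc)

lemma add_eq_zero_iff: "\<lbrakk>x \<in> carrier V; y \<in> carrier V\<rbrakk> \<Longrightarrow> x \<oplus> y = \<zero> \<longleftrightarrow> x = y"
  by (metis add_self add_self_left r_zero)

lemma minus_self [simp]: "x \<in> carrier V \<Longrightarrow> \<ominus> x = x"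
  by (meson add_self minus_equality)

lemma f2_submoduleI:
  assumes "W \<subseteq> carrier V" "\<zero> \<in> W" "\<And>x y. \<lbrakk>x \<in> W; y \<in> W\<rbrakk> \<Longrightarrow> x \<oplus> y \<in> W"
  shows "submodule W F2 V"
proof (rule submoduleI)
  fix a :: bit and x assume "x \<in> W"
  then show "a \<odot> x \<in> W" using assms by (cases a) (auto simp: smult_bit)
next
  fix x assume "x \<in> W"
  then show "\<ominus> x \<in> W" using assms by auto
qed (use assms in auto)

lemma submoduleD:
  assumes "submodule W F2 V"
  shows "x \<in> W \<Longrightarrow> x \<in> carrier V" "\<zero> \<in> W" "\<lbrakk>x \<in> W; y \<in> W\<rbrakk> \<Longrightarrow> x \<oplus> y \<in> W"
proof -
  note W = submoduleE[OF assms]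
  show "x \<in> W \<Longrightarrow> x \<in> carrier V" "\<lbrakk>x \<in> W; y \<in> W\<rbrakk> \<Longrightarrow> x \<oplus> y \<in> W"
    using W by auto
  obtain w where "w \<in> W" using W(2) by blast
  then show "\<zero> \<in> W" using W(1) W(5)[of w w] by auto
qed

lemma submodule_finsum:
  assumes "submodule W F2 V" "\<And>i. i \<in> I \<Longrightarrow> f i \<in> W"
  shows "(\<Oplus>i\<in>I. f i) \<in> W"
  using assms(2)
proof (induction I rule: infinite_finite_induct)
  case (insert i I)
  then show ?case
    using submoduleD[OF assms(1)] by (subst finsum_insert) (auto simp: Pi_def)
qed (auto simp: submoduleD[OF assms(1)])

lemma linear_mapI:
  assumes "module F2 W"
    and "\<And>x. x \<in> carrier V \<Longrightarrow> f x \<in> carrier W"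
    and "\<And>x y. \<lbrakk>x \<in> carrier V; y \<in> carrier V\<rbrakk> \<Longrightarrow> f (x \<oplus> y) = f x \<oplus>\<^bsub>W\<^esub> f y"
  shows "linear_map V W f"
proof -
  interpret W: f2_space W using assms(1) by (simp add: f2_space_def)
  have "f \<zero> = \<zero>\<^bsub>W\<^esub>"
    by (metis assms(2,3) W.add_self add_self zero_closed)
  moreover have "f (c \<odot> x) = c \<odot>\<^bsub>W\<^esub> f x" if "x \<in> carrier V" for c x
    using that assms calculation by (cases c) (auto simp: smult_bit W.smult_bit)
  ultimately show ?thesis using assms by (auto simp: linear_map_def)
qed

end

lemma linear_map_zero:
  assumes "module F2 V" "module F2 W" "linear_map V W f"
  shows "f \<zero>\<^bsub>V\<^esub> = \<zero>\<^bsub>W\<^esub>"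
proof -
  interpret V: f2_space V using assms(1) by (simp add: f2_space_def)
  interpret W: f2_space W using assms(2) by (simp add: f2_space_def)
  show ?thesis
    using assms(3) by (metis V.add_self V.zero_closed W.add_self linear_map_def PiE)
qed

lemma linear_mapD:
  assumes "linear_map V W f"
  shows "x \<in> carrier V \<Longrightarrow> f x \<in> carrier W"
    "\<lbrakk>x \<in> carrier V; y \<in> carrier V\<rbrakk> \<Longrightarrow> f (x \<oplus>\<^bsub>V\<^esub> y) = f x \<oplus>\<^bsub>W\<^esub> f y"
  using assms by (auto simp: linear_map_def)


subsection \<open>Cosets\<close>

context f2_space
begin

context
  fixes W assumes W: "submodule W F2 V"
begin

lemma coset_mem_iff: "x \<in> carrier V \<Longrightarrow> y \<in> W +> x \<longleftrightarrow> y \<in> carrier V \<and> x \<oplus> y \<in> W"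
proof
  assume x: "x \<in> carrier V" and y: "y \<in> W +> x"
  then obtain w where "w \<in> W" "y = w \<oplus> x" by (auto simp: a_r_coset_def')
  with x submoduleD[OF W] show "y \<in> carrier V \<and> x \<oplus> y \<in> W"
    by (metis a_comm add.m_closed add_self_left)
next
  assume x: "x \<in> carrier V" and y: "y \<in> carrier V \<and> x \<oplus> y \<in> W"
  then have "y = (x \<oplus> y) \<oplus> x"
    by (metis a_comm add.m_closed add_self_left)
  with y show "y \<in> W +> x" unfolding a_r_coset_def' by blast
qed

lemma coset_eq_iff:
  assumes "x \<in> carrier V" "y \<in> carrier V"
  shows "W +> x = W +> y \<longleftrightarrow> x \<oplus> y \<in> W"
proof
  assume "W +> x = W +> y"
  moreover have "y \<in> W +> y"
    using assms by (simp add: coset_mem_iff submoduleD[OF W])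
  ultimately show "x \<oplus> y \<in> W" using assms by (metis coset_mem_iff)
next
  assume xy: "x \<oplus> y \<in> W"
  have "x \<oplus> z \<in> W \<longleftrightarrow> y \<oplus> z \<in> W" if "z \<in> carrier V" for z
  proof -
    have "y \<oplus> z = (x \<oplus> y) \<oplus> (x \<oplus> z)" "x \<oplus> z = (x \<oplus> y) \<oplus> (y \<oplus> z)"
      using assms that by (simp_all add: a_ac)
    then show ?thesis using xy submoduleD[OF W] by metis
  qed
  then show "W +> x = W +> y"
    using assms by (auto simp: coset_mem_iff)
qed

lemma coset_zero: "W +> \<zero> = W"
  using submoduleD[OF W] by (auto simp: coset_mem_iff)

lemma coset_self: "x \<in> carrier V \<Longrightarrow> x \<in> W +> x"
  by (simp add: coset_mem_iff submoduleD[OF W])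

lemma coset_add:
  assumes "x \<in> carrier V" "y \<in> carrier V"
  shows "set_add V (W +> x) (W +> y) = W +> (x \<oplus> y)"
proof safe
  fix z assume "z \<in> set_add V (W +> x) (W +> y)"
  then obtain a b where "a \<in> W +> x" "b \<in> W +> y" "z = a \<oplus> b"
    by (auto simp: set_add_def')
  moreover have "x \<oplus> y \<oplus> (a \<oplus> b) = (x \<oplus> a) \<oplus> (y \<oplus> b)"
    if "a \<in> carrier V" "b \<in> carrier V"
    using assms that by (simp add: a_ac)
  ultimately show "z \<in> W +> (x \<oplus> y)"
    using assms submoduleD[OF W] by (auto simp: coset_mem_iff)
next
  fix z assume z: "z \<in> W +> (x \<oplus> y)"
  with assms have zc: "z \<in> carrier V" by (simp add: coset_mem_iff)
  have "x \<oplus> z \<in> W +> y"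
    using z zc assms by (simp add: coset_mem_iff flip: a_assoc) (simp add: a_ac)
  moreover have "z = x \<oplus> (x \<oplus> z)" using assms zc by simp
  ultimately show "z \<in> set_add V (W +> x) (W +> y)"
    using coset_self[OF assms(1)] unfolding set_add_def' by blast
qed

text \<open>Evaluates the unions by which maps on quotients are defined: when the map respects the
  submodule, all representatives contribute the same coset.\<close>

lemma coset_union:
  assumes x: "x \<in> carrier V"
    and f: "\<And>y. y \<in> carrier V \<Longrightarrow> f y \<in> carrier V"
    and "\<And>y. \<lbrakk>y \<in> carrier V; x \<oplus> y \<in> W\<rbrakk> \<Longrightarrow> f x \<oplus> f y \<in> W"
  shows "(\<Union>y\<in>W +> x. W +> f y) = W +> f x"
proof -
  have "W +> f y = W +> f x" if "y \<in> W +> x" for y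
    using that assms coset_eq_iff[of "f x" "f y"] by (auto simp: coset_mem_iff)
  then show ?thesis using coset_self[OF x] by blast
qed

lemma rcosets_iff: "T \<in> a_rcosets W \<longleftrightarrow> (\<exists>x\<in>carrier V. T = W +> x)"
  by (auto simp: A_RCOSETS_def')

text \<open>Formulated for any record with these four fields, so that it applies both to
  \<open>palg_quot\<close> and to the suspended loop module, which are records of different
  types.\<close>

lemma quot_module:
  fixes Q :: "(bit, 'a set, 'c) module_scheme"
  assumes "carrier Q = a_rcosets W" "zero Q = W" "add Q = set_add V"
    and "module.smult Q = (\<lambda>c T. \<Union>x\<in>T. W +> (c \<odot> x))"
  shows "module F2 Q"
proof (rule F2_moduleI)
  have closed: "W +> x \<in> a_rcosets W" if "x \<in> carrier V" for x
    using that by (auto simp: rcosets_iff)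
  show "abelian_group Q"
  proof (rule abelian_groupI)
    fix S T U assume "S \<in> carrier Q" "T \<in> carrier Q" "U \<in> carrier Q"
    then obtain x y z where "x \<in> carrier V" "y \<in> carrier V" "z \<in> carrier V"
      "S = W +> x" "T = W +> y" "U = W +> z"
      unfolding assms rcosets_iff by blast
    then show "S \<oplus>\<^bsub>Q\<^esub> T \<oplus>\<^bsub>Q\<^esub> U = S \<oplus>\<^bsub>Q\<^esub> (T \<oplus>\<^bsub>Q\<^esub> U)"
      "S \<oplus>\<^bsub>Q\<^esub> T \<in> carrier Q" "S \<oplus>\<^bsub>Q\<^esub> T = T \<oplus>\<^bsub>Q\<^esub> S"
      by (simp_all add: assms coset_add a_ac closed)
  next
    fix S assume "S \<in> carrier Q"
    then obtain x where x: "x \<in> carrier V" "S = W +> x"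
      unfolding assms rcosets_iff by blast
    have "W \<in> a_rcosets W" using closed[of \<zero>] by (simp add: coset_zero)
    moreover have "set_add V W (W +> x) = W +> x"
      using coset_add[of \<zero> x] x by (simp add: coset_zero)
    ultimately show "\<zero>\<^bsub>Q\<^esub> \<oplus>\<^bsub>Q\<^esub> S = S" "\<exists>T\<in>carrier Q. T \<oplus>\<^bsub>Q\<^esub> S = \<zero>\<^bsub>Q\<^esub>"
      using x closed[of x] by (auto simp: assms coset_add coset_zero intro!: bexI[of _ S])
  qed (use closed[of \<zero>] in \<open>simp add: assms coset_zero\<close>)
next
  fix T assume "T \<in> carrier Q"
  then obtain x where x: "x \<in> carrier V" "T = W +> x"
    unfolding assms rcosets_iff by blast
  show "T \<oplus>\<^bsub>Q\<^esub> T = \<zero>\<^bsub>Q\<^esub>"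
    using x by (simp add: assms coset_add coset_zero)
  have "(\<Union>y\<in>W +> x. W +> ((c::bit) \<odot> y)) = W +> (c \<odot> x)" for c
    using x by (intro coset_union) (auto simp: submoduleD[OF W] submoduleE[OF W] simp flip: smult_r_distr)
  then show "(0::bit) \<odot>\<^bsub>Q\<^esub> T = \<zero>\<^bsub>Q\<^esub>" "(1::bit) \<odot>\<^bsub>Q\<^esub> T = T"
    using x by (simp_all add: assms coset_zero smult_bit)
qed

end

end


lemma palg_quot_simps:
  "carrier (palg_quot A I) = a_rcosets\<^bsub>A\<^esub> I"
  "zero (palg_quot A I) = I"
  "add (palg_quot A I) = set_add A"
  "module.smult (palg_quot A I) = (\<lambda>c T. \<Union>x\<in>T. I +>\<^bsub>A\<^esub> (c \<odot>\<^bsub>A\<^esub> x))"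
  "hpart (palg_quot A I) d = (\<lambda>x. I +>\<^bsub>A\<^esub> x) ` hpart A d"
  "opr (palg_quot A I) \<mu> Ts = (\<Union>as\<in>listset Ts. I +>\<^bsub>A\<^esub> opr A \<mu> as)"
  by (simp_all add: palg_quot_def quot_gvs_def gvs.defs palg.defs)

lemma listset_iff: "xs \<in> listset As \<longleftrightarrow> list_all2 (\<in>) xs As"
  by (induction As arbitrary: xs) (auto simp: set_Cons_def list_all2_Cons2)

lemma palg_quot_opr:
  fixes A (structure)
  assumes "module F2 A" "submodule I F2 A" "set as \<subseteq> carrier A"
    and closed: "\<And>bs. \<lbrakk>set bs \<subseteq> carrier A; length bs = length as\<rbrakk> \<Longrightarrow> opr A \<mu> bs \<in> carrier A"
    and cong: "\<And>bs. \<lbrakk>set bs \<subseteq> carrier A; list_all2 (\<lambda>a b. a \<oplus> b \<in> I) as bs\<rbrakk> \<Longrightarrow>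
      opr A \<mu> as \<oplus> opr A \<mu> bs \<in> I"
  shows "opr (palg_quot A I) \<mu> (map (\<lambda>a. I +> a) as) = I +> opr A \<mu> as"
proof -
  interpret f2_space A using assms(1) by (simp add: f2_space_def)
  note I = assms(2)
  have const: "I +> opr A \<mu> bs = I +> opr A \<mu> as" if "bs \<in> listset (map (\<lambda>a. I +> a) as)" for bs
  proof -
    have *: "list_all2 (\<lambda>b a. b \<in> I +> a) bs as"
      using that by (simp add: listset_iff list_all2_map2)
    have mem: "b \<in> carrier A \<and> a \<oplus> b \<in> I" if "(b, a) \<in> set (zip bs as)" for a b
      using * that assms(3) coset_mem_iff[OF I, of a b] by (auto simp: list_all2_iff dest: set_zip_rightD)
    have "set bs \<subseteq> carrier A"
      using list_all2_lengthD[OF *] mem by (auto simp: in_set_impl_in_set_zip1 elim: in_set_impl_in_set_zip1)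
    moreover have "list_all2 (\<lambda>a b. a \<oplus> b \<in> I) as bs"
      using list_all2_lengthD[OF *] mem by (fastforce simp: list_all2_conv_all_nth in_set_zip)
    ultimately show ?thesis
      using coset_eq_iff[OF I, of "opr A \<mu> as" "opr A \<mu> bs"] closed[of bs] closed[of as] cong assms(3) *
      by (auto dest: list_all2_lengthD)
  qed
  have "as \<in> listset (map (\<lambda>a. I +> a) as)"
    unfolding listset_iff list_all2_map2
    using assms(3) coset_self[OF I] by (intro list.rel_refl_strong) auto
  then have "listset (map (\<lambda>a. I +> a) as) \<noteq> {}" by blast
  then show ?thesis unfolding palg_quot_simps by (rule SUP_eq_const) (rule const)
qed

text \<open>The first isomorphism theorem for graded algebras over \<open>P\<close>. As
  \<open>I\<close> is the kernel of \<open>h\<close>, congruent arguments have equal images, and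
  this makes the operations on cosets well defined as well as \<open>\<phi>\<close>
  injective.\<close>

lemma palg_quot_iso:
  fixes A :: "('p, 'a) palg" (structure) and B :: "('p, 'b) palg"
  assumes A: "module F2 A" and B: "module F2 B"
    and lin: "linear_map A B h" and surj: "h ` carrier A = carrier B"
    and gr: "\<And>d. hpart A d \<subseteq> carrier A" "\<And>d. h ` hpart A d = hpart B d"
    and opr: "\<And>\<mu> as. \<lbrakk>\<mu> \<in> carrier (ops P (length as)); set as \<subseteq> carrier A\<rbrakk> \<Longrightarrow>
      opr A \<mu> as \<in> carrier A \<and> h (opr A \<mu> as) = opr B \<mu> (map h as)"
    and I: "I = {a \<in> carrier A. h a = \<zero>\<^bsub>B\<^esub>}"
  shows "\<exists>\<phi>. graded_palg_iso P (palg_quot A I) B \<phi>"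
proof -
  interpret A: f2_space A using A by (simp add: f2_space_def)
  interpret B: f2_space B using B by (simp add: f2_space_def)
  note hD = linear_mapD[OF lin]
  have sub: "submodule I F2 A"
    using hD linear_map_zero[OF A B lin] by (intro A.f2_submoduleI) (auto simp: I)
  interpret Q: f2_space "palg_quot A I"
    unfolding f2_space_def by (rule A.quot_module[OF sub]) (simp_all add: palg_quot_simps)
  have hI: "a \<oplus> b \<in> I \<longleftrightarrow> h a = h b" if "a \<in> carrier A" "b \<in> carrier A" for a b
    using that by (simp add: I hD B.add_eq_zero_iff)
  define \<phi> where "\<phi> T = h (SOME a. a \<in> T)" for T
  have \<phi>: "\<phi> (I +> a) = h a" if "a \<in> carrier A" for a
  proof -
    have "(SOME b. b \<in> I +> a) \<in> I +> a"
      using A.coset_self[OF sub that] by (rule someI)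
    then show ?thesis using that hI unfolding \<phi>_def by (metis A.coset_mem_iff[OF sub])
  qed
  have carr: "carrier (palg_quot A I) = (\<lambda>a. I +> a) ` carrier A"
    by (auto simp: palg_quot_simps A.rcosets_iff[OF sub])
  have "linear_map (palg_quot A I) B \<phi>"
    using B
  proof (rule Q.linear_mapI)
    fix T U assume "T \<in> carrier (palg_quot A I)" "U \<in> carrier (palg_quot A I)"
    then show "\<phi> T \<in> carrier B" "\<phi> (T \<oplus>\<^bsub>palg_quot A I\<^esub> U) = \<phi> T \<oplus>\<^bsub>B\<^esub> \<phi> U"
      unfolding carr by (auto simp: palg_quot_simps(3) A.coset_add[OF sub] \<phi> hD)
  qed
  moreover have "bij_betw \<phi> (carrier (palg_quot A I)) (carrier B)"
    unfolding bij_betw_def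
  proof
    show "inj_on \<phi> (carrier (palg_quot A I))"
      by (auto simp: carr inj_on_def \<phi> A.coset_eq_iff[OF sub] hI)
    show "\<phi> ` carrier (palg_quot A I) = carrier B"
      unfolding carr image_image surj[symmetric] by (intro image_cong) (auto simp: \<phi>)
  qed
  moreover have "\<phi> ` hpart (palg_quot A I) d = hpart B d" for d
    unfolding palg_quot_simps image_image gr(2)[symmetric] using gr(1)[of d]
    by (intro image_cong) (auto simp: \<phi>)
  moreover have "\<phi> (opr (palg_quot A I) \<mu> Ts) = opr B \<mu> (map \<phi> Ts)"
    if "\<mu> \<in> carrier (ops P (length Ts))" "set Ts \<subseteq> carrier (palg_quot A I)" for \<mu> Ts
  proof -
    have "\<exists>as. set as \<subseteq> carrier A \<and> Ts = map (\<lambda>a. I +> a) as"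
    proof -
      have "Ts \<in> lists ((\<lambda>a. I +> a) ` carrier A)"
        using that(2) unfolding carr by auto
      then show ?thesis unfolding lists_image by (auto simp: lists_eq_set)
    qed
    then obtain as where as: "set as \<subseteq> carrier A" "Ts = map (\<lambda>a. I +> a) as" by blast
    have "opr (palg_quot A I) \<mu> Ts = I +> opr A \<mu> as"
      unfolding as(2)
    proof (rule palg_quot_opr[OF A sub as(1)])
      fix bs assume bs: "set bs \<subseteq> carrier A" "list_all2 (\<lambda>a b. a \<oplus> b \<in> I) as bs"
      then have "map h as = map h bs"
        using as(1) by (auto simp: list_all2_conv_all_nth hI subset_iff intro!: nth_equalityI)
      then show "opr A \<mu> as \<oplus> opr A \<mu> bs \<in> I"
        using opr[of \<mu> as] opr[of \<mu> bs] that as bs by (auto simp: hI dest: list_all2_lengthD)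
    qed (use opr that as in auto)
    moreover have "map \<phi> Ts = map h as" using as by (auto simp: \<phi>)
    moreover have "length Ts = length as" by (simp add: as(2))
    ultimately show ?thesis using opr[of \<mu> as] as(1) that(1) \<phi> by metis
  qed
  ultimately show ?thesis unfolding graded_palg_iso_def by blast
qed


subsection \<open>Graded spaces\<close>

lemma homog_decompI:
  fixes V (structure)
  assumes "module F2 V" "finite D" "\<And>d. f d \<in> hpart V d" "\<And>d. hpart V d \<subseteq> carrier V"
    "\<And>d. d \<notin> D \<Longrightarrow> f d = \<zero>" and "x = (\<Oplus>d\<in>D. f d)"
  shows "homog_decomp V x f"
proof -
  interpret f2_space V using assms(1) by (simp add: f2_space_def)
  have "{d. f d \<noteq> \<zero>} \<subseteq> D" using assms(5) by blast
  moreover have "(\<Oplus>d\<in>D. f d) = (\<Oplus>d\<in>{d. f d \<noteq> \<zero>}. f d)"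
    using assms(2,5) calculation subsetD[OF assms(4) assms(3)]
    by (intro add.finprod_mono_neutral_cong_right) auto
  ultimately show ?thesis
    using assms finite_subset by (auto simp: homog_decomp_def)
qed

sublocale graded_space \<subseteq> f2_space V
  by (simp add: f2_space_def module_axioms)

context graded_space
begin

lemma hpart_carrier: "x \<in> hpart V d \<Longrightarrow> x \<in> carrier V"
  using hpart_submodule submoduleD(1) by blast

lemma hpart_zero: "\<zero> \<in> hpart V d" and hpart_add: "\<lbrakk>x \<in> hpart V d; y \<in> hpart V d\<rbrakk> \<Longrightarrow> x \<oplus> y \<in> hpart V d"
  using hpart_submodule submoduleD by blast+

lemma homog_decomp_finsumI:
  assumes "finite D" "\<And>d. f d \<in> hpart V d" "\<And>d. d \<notin> D \<Longrightarrow> f d = \<zero>"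
    and "x = (\<Oplus>d\<in>D. f d)"
  shows "homog_decomp V x f"
  using assms hpart_carrier by (intro homog_decompI[OF module_axioms]) auto

lemma hcomp_homog_decomp: "x \<in> carrier V \<Longrightarrow> homog_decomp V x (hcomp V x)"
  unfolding hcomp_def by (rule theI'[OF decomp_unique])

lemma hcomp_eqI: "\<lbrakk>x \<in> carrier V; homog_decomp V x f\<rbrakk> \<Longrightarrow> hcomp V x = f"
  using decomp_unique hcomp_homog_decomp by blast

lemma hcomp_in_hpart: "x \<in> carrier V \<Longrightarrow> hcomp V x d \<in> hpart V d"
  and finite_hcomp: "x \<in> carrier V \<Longrightarrow> finite {d. hcomp V x d \<noteq> \<zero>}"
  using hcomp_homog_decomp by (auto simp: homog_decomp_def)

lemma hcomp_closed [simp]: "x \<in> carrier V \<Longrightarrow> hcomp V x d \<in> carrier V"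
  using hcomp_in_hpart hpart_carrier by blast

lemma finsum_hcomp:
  assumes "x \<in> carrier V" "finite D" "{d. hcomp V x d \<noteq> \<zero>} \<subseteq> D"
  shows "(\<Oplus>d\<in>D. hcomp V x d) = x"
proof -
  have "(\<Oplus>d\<in>D. hcomp V x d) = (\<Oplus>d\<in>{d. hcomp V x d \<noteq> \<zero>}. hcomp V x d)"
    using assms
    by (intro add.finprod_mono_neutral_cong_right) auto
  then show ?thesis using hcomp_homog_decomp[OF assms(1)] by (simp add: homog_decomp_def)
qed

lemma hcomp_hpart:
  assumes "x \<in> hpart V d"
  shows "hcomp V x = (\<lambda>e. if e = d then x else \<zero>)"
  using assms hpart_carrier[OF assms]
  by (intro hcomp_eqI homog_decomp_finsumI[of "{d}"]) (auto simp: hpart_zero finsum_singleton)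

lemma hcomp_add:
  assumes "x \<in> carrier V" "y \<in> carrier V"
  shows "hcomp V (x \<oplus> y) = (\<lambda>d. hcomp V x d \<oplus> hcomp V y d)"
proof (intro hcomp_eqI homog_decomp_finsumI)
  let ?D = "{d. hcomp V x d \<noteq> \<zero>} \<union> {d. hcomp V y d \<noteq> \<zero>}"
  show "finite ?D" using assms by (simp add: finite_hcomp)
  have "x = (\<Oplus>d\<in>?D. hcomp V x d)" "y = (\<Oplus>d\<in>?D. hcomp V y d)"
    using assms finite_hcomp by (auto intro!: finsum_hcomp[symmetric])
  then show "x \<oplus> y = (\<Oplus>d\<in>?D. hcomp V x d \<oplus> hcomp V y d)"
    using assms by (subst finsum_addf) auto
qed (use assms in \<open>auto simp: hcomp_in_hpart hpart_add\<close>)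

lemma graded_induct [consumes 1, case_names zero homog add]:
  assumes "x \<in> carrier V" and "P \<zero>" and "\<And>d x. x \<in> hpart V d \<Longrightarrow> P x"
    and "\<And>x y. \<lbrakk>x \<in> carrier V; y \<in> carrier V; P x; P y\<rbrakk> \<Longrightarrow> P (x \<oplus> y)"
  shows "P x"
proof -
  have "submodule {x \<in> carrier V. P x} F2 V"
    using assms by (intro f2_submoduleI) auto
  then have "(\<Oplus>d\<in>{d. hcomp V x d \<noteq> \<zero>}. hcomp V x d) \<in> {x \<in> carrier V. P x}"
    using assms(1,3) hcomp_in_hpart hpart_carrier by (intro submodule_finsum) auto
  then show ?thesis using finsum_hcomp[OF assms(1) finite_hcomp[OF assms(1)]] by simp
qed

context
  fixes sq :: "nat \<Rightarrow> 'a \<Rightarrow> 'a"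
  assumes sq_closed: "\<And>d x. x \<in> hpart V d \<Longrightarrow> sq d x \<in> carrier V"
    and sq_add: "\<And>d x y. \<lbrakk>x \<in> hpart V d; y \<in> hpart V d\<rbrakk> \<Longrightarrow> sq d (x \<oplus> y) = sq d x \<oplus> sq d y"
begin

lemma sq_zero: "sq d \<zero> = \<zero>"
  using sq_add[of \<zero> d \<zero>] sq_closed[of \<zero> d] by (simp add: hpart_zero)

text \<open>The family \<open>sq\<close> is arbitrary as long as it is additive in each degree,
  because \<open>Sq0\<close> is needed for three families: the squares of the module, the squares of
  the free algebra, and the family in \<open>exists_retraction\<close> from which
  \<open>\<delta>\<close> is assembled.\<close>

lemma Sq0_finsum:
  assumes "x \<in> carrier V" "finite D" "{d. hcomp V x d \<noteq> \<zero>} \<subseteq> D"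
  shows "Sq0 V sq x = (\<Oplus>d\<in>D. sq d (hcomp V x d))"
  unfolding Sq0_def using assms
  by (intro add.finprod_mono_neutral_cong_left) (auto simp: sq_zero sq_closed hcomp_in_hpart)

lemma Sq0_closed: "x \<in> carrier V \<Longrightarrow> Sq0 V sq x \<in> carrier V"
  unfolding Sq0_def by (auto intro!: finsum_closed simp: sq_closed hcomp_in_hpart)

lemma Sq0_hpart:
  assumes "x \<in> hpart V d"
  shows "Sq0 V sq x = sq d x"
  using assms
  by (subst Sq0_finsum[of x "{d}"]) (auto simp: hpart_carrier hcomp_hpart finsum_singleton sq_closed)

lemma Sq0_add:
  assumes "x \<in> carrier V" "y \<in> carrier V"
  shows "Sq0 V sq (x \<oplus> y) = Sq0 V sq x \<oplus> Sq0 V sq y"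
proof -
  let ?D = "{d. hcomp V x d \<noteq> \<zero>} \<union> {d. hcomp V y d \<noteq> \<zero>}"
  have D: "finite ?D" using assms by (simp add: finite_hcomp)
  have "Sq0 V sq (x \<oplus> y) = (\<Oplus>d\<in>?D. sq d (hcomp V (x \<oplus> y) d))"
    using assms D by (intro Sq0_finsum) (auto simp: hcomp_add)
  also have "\<dots> = (\<Oplus>d\<in>?D. sq d (hcomp V x d) \<oplus> sq d (hcomp V y d))"
    using assms by (auto simp: hcomp_add sq_add hcomp_in_hpart)
  also have "\<dots> = (\<Oplus>d\<in>?D. sq d (hcomp V x d)) \<oplus> (\<Oplus>d\<in>?D. sq d (hcomp V y d))"
    using assms by (intro finsum_addf) (auto simp: sq_closed hcomp_in_hpart)
  also have "\<dots> = Sq0 V sq x \<oplus> Sq0 V sq y"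
    using assms D by (subst (1 2) Sq0_finsum[where D = ?D]) auto
  finally show ?thesis .
qed

end

end


section \<open>Multilinear extension\<close>

lemma bit_add_self: "(b::bit) + b = 0"
  by (cases b) simp_all

lemma poly_bit_add_self [simp]: "f + f = (0 :: 'w \<Rightarrow>\<^sub>0 bit)"
  by (rule poly_mapping_eqI) (simp add: lookup_add bit_add_self)

lemma poly_bit_uminus [simp]: "- f = (f :: 'w \<Rightarrow>\<^sub>0 bit)"
  by (metis poly_bit_add_self add.inverse_unique)

lemma poly_bit_minus [simp]: "f - g = f + (g :: 'w \<Rightarrow>\<^sub>0 bit)"
  by (metis diff_conv_add_uminus poly_bit_uminus)

lemma poly_bit_add_self_left [simp]: "f + (f + g) = (g :: 'w \<Rightarrow>\<^sub>0 bit)"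
  by (simp flip: add.assoc)

lemma lookup_bit: "w \<in> Poly_Mapping.keys f \<Longrightarrow> Poly_Mapping.lookup f w = (1::bit)"
  by (simp add: in_keys_iff)

lemma poly_map_bit [simp]:
  "Poly_Mapping.map ((*) (0::bit)) f = 0" "Poly_Mapping.map ((*) (1::bit)) f = f"
  by (rule poly_mapping_eqI; simp add: Poly_Mapping.map.rep_eq when_def)+

text \<open>The simplifier turns multiplication by a constant bit into \<open>and\<close>.\<close>

lemma poly_map_and [simp]:
  "Poly_Mapping.map (and (0::bit)) f = 0" "Poly_Mapping.map (and (1::bit)) f = f"
  by (rule poly_mapping_eqI; simp add: Poly_Mapping.map.rep_eq when_def)+

abbreviation sgl :: "'w \<Rightarrow> 'w \<Rightarrow>\<^sub>0 bit"
  where "sgl w \<equiv> Poly_Mapping.single w 1"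

lemma keys_add_bit:
  "Poly_Mapping.keys (f + g) =
    (Poly_Mapping.keys f - Poly_Mapping.keys g) \<union> (Poly_Mapping.keys g - Poly_Mapping.keys (f :: 'w \<Rightarrow>\<^sub>0 bit))"
proof (rule Set.set_eqI)
  fix w
  show "w \<in> Poly_Mapping.keys (f + g) \<longleftrightarrow> w \<in>
      (Poly_Mapping.keys f - Poly_Mapping.keys g) \<union> (Poly_Mapping.keys g - Poly_Mapping.keys f)"
    by (cases "Poly_Mapping.lookup f w"; cases "Poly_Mapping.lookup g w")
      (simp_all add: in_keys_iff lookup_add)
qed

text \<open>The linear extension of \<open>H\<close> from basis elements to formal sums. No
  coefficients appear because they are all 1 on the support.\<close>

definition pbind :: "('v \<Rightarrow>\<^sub>0 bit) \<Rightarrow> ('v \<Rightarrow> 'w \<Rightarrow>\<^sub>0 bit) \<Rightarrow> 'w \<Rightarrow>\<^sub>0 bit"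
  where "pbind f H = (\<Sum>v\<in>Poly_Mapping.keys f. H v)"

lemma pbind_single [simp]: "pbind (sgl v) H = H v"
  by (simp add: pbind_def)

lemma pbind_zero [simp]: "pbind 0 H = 0" "pbind f (\<lambda>v. 0) = 0"
  by (simp_all add: pbind_def)

text \<open>The support of \<open>f + g\<close> is the symmetric difference of the supports, and the
  terms over the common part occur twice on the right and cancel.\<close>

lemma pbind_add: "pbind (f + g) H = pbind f H + pbind g H"
proof -
  let ?A = "Poly_Mapping.keys f" and ?B = "Poly_Mapping.keys g"
  have f: "pbind f H = sum H (?A - ?B) + sum H (?A \<inter> ?B)"
    unfolding pbind_def by (subst sum.union_disjoint[symmetric]) (auto intro: arg_cong[where f = "sum H"])
  have g: "pbind g H = sum H (?B - ?A) + sum H (?A \<inter> ?B)"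
    unfolding pbind_def by (subst sum.union_disjoint[symmetric]) (auto intro: arg_cong[where f = "sum H"])
  have fg: "pbind (f + g) H = sum H (?A - ?B) + sum H (?B - ?A)"
    unfolding pbind_def keys_add_bit by (rule sum.union_disjoint) auto
  show ?thesis unfolding f g fg by (simp add: algebra_simps)
qed

lemma pbind_sum: "pbind (\<Sum>i\<in>I. f i) H = (\<Sum>i\<in>I. pbind (f i) H)"
  by (induction I rule: infinite_finite_induct) (simp_all add: pbind_add)

lemma pbind_add_fun: "pbind f (\<lambda>v. G v + H v) = pbind f G + pbind f H"
  by (simp add: pbind_def sum.distrib)

lemma pbind_pbind: "pbind (pbind f G) H = pbind f (\<lambda>v. pbind (G v) H)"
  by (simp add: pbind_def[of f] pbind_sum)

lemma pbind_sgl [simp]: "pbind f sgl = f"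
proof (rule poly_mapping_eqI)
  fix w
  have "Poly_Mapping.lookup (pbind f sgl) w = (\<Sum>v\<in>Poly_Mapping.keys f. 1 when v = w)"
    by (simp add: pbind_def lookup_sum lookup_single)
  also have "\<dots> = Poly_Mapping.lookup f w"
    by (cases "w \<in> Poly_Mapping.keys f") (auto simp: when_def lookup_bit in_keys_iff)
  finally show "Poly_Mapping.lookup (pbind f sgl) w = Poly_Mapping.lookup f w" .
qed

lemma pbind_cong: "(\<And>v. v \<in> Poly_Mapping.keys f \<Longrightarrow> G v = H v) \<Longrightarrow> pbind f G = pbind f H"
  by (simp add: pbind_def)

text \<open>The induction step remembers that \<open>w\<close> lies in the support of the fixed
  \<open>g\<close>, so that any property shared by the words of \<open>g\<close> remains
  available.\<close>

lemma poly_bit_induct [case_names zero sgl]: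
  assumes "P 0" "\<And>f w. \<lbrakk>w \<in> Poly_Mapping.keys g; P f\<rbrakk> \<Longrightarrow> P (sgl w + f)"
  shows "P g"
proof -
  have "A \<subseteq> Poly_Mapping.keys g \<Longrightarrow> P (\<Sum>w\<in>A. sgl w)" if "finite A" for A
    using that by (induction A) (use assms in auto)
  from this[OF finite_keys order_refl] show ?thesis
    using pbind_sgl[of g] unfolding pbind_def by metis
qed

text \<open>Multilinear extension from lists of basis elements to lists of formal sums. The
  recursion reduces additivity in one argument to \<open>pbind\<close>; the sum over all choices of
  basis elements, as in the definition of \<open>word_alg\<close>, is recovered in
  \<open>mext_conv_sum\<close>.\<close>

fun mext :: "('v list \<Rightarrow> 'w \<Rightarrow>\<^sub>0 bit) \<Rightarrow> ('v \<Rightarrow>\<^sub>0 bit) list \<Rightarrow> 'w \<Rightarrow>\<^sub>0 bit"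
  where
    "mext G [] = G []"
  | "mext G (f # fs) = pbind f (\<lambda>v. mext (\<lambda>vs. G (v # vs)) fs)"

text \<open>Extension in the entries of a list of lists, as it arises when the arguments of an
  operation are themselves values of operations.\<close>

fun mext2 :: "('v list list \<Rightarrow> 'w \<Rightarrow>\<^sub>0 bit) \<Rightarrow> ('v \<Rightarrow>\<^sub>0 bit) list list \<Rightarrow> 'w \<Rightarrow>\<^sub>0 bit"
  where
    "mext2 G [] = G []"
  | "mext2 G (fs # fss) = mext (\<lambda>vs. mext2 (\<lambda>vss. G (vs # vss)) fss) fs"

abbreviation choice :: "'v list \<Rightarrow> ('v \<Rightarrow>\<^sub>0 bit) list \<Rightarrow> bool"
  where "choice \<equiv> list_all2 (\<lambda>v f. v \<in> Poly_Mapping.keys f)"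

lemma mext_cong: "(\<And>vs. choice vs fs \<Longrightarrow> G vs = H vs) \<Longrightarrow> mext G fs = mext H fs"
proof (induction fs arbitrary: G H)
  case (Cons f fs)
  have "mext (\<lambda>vs. G (v # vs)) fs = mext (\<lambda>vs. H (v # vs)) fs" if "v \<in> Poly_Mapping.keys f" for v
    using that by (intro Cons.IH Cons.prems) simp
  then show ?case by (auto intro: pbind_cong)
qed simp

lemma mext2_cong: "(\<And>vss. list_all2 choice vss fss \<Longrightarrow> G vss = H vss) \<Longrightarrow> mext2 G fss = mext2 H fss"
proof (induction fss arbitrary: G H)
  case (Cons fs fss)
  have "mext2 (\<lambda>vss. G (vs # vss)) fss = mext2 (\<lambda>vss. H (vs # vss)) fss" if "choice vs fs" for vs
    using that by (intro Cons.IH Cons.prems) simp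
  then show ?case by (auto intro: mext_cong)
qed simp

lemma sum_set_Cons: "(\<Sum>vs\<in>set_Cons A B. G vs) = (\<Sum>v\<in>A. \<Sum>vs\<in>B. G (v # vs))"
proof -
  have "set_Cons A B = (\<lambda>(v, vs). v # vs) ` (A \<times> B)" by (auto simp: set_Cons_def)
  moreover have "inj_on (\<lambda>(v, vs). v # vs) (A \<times> B)" by (auto simp: inj_on_def)
  ultimately show ?thesis by (simp add: sum.reindex sum.cartesian_product case_prod_unfold)
qed

lemma mext_conv_sum: "mext G fs = (\<Sum>vs\<in>listset (map Poly_Mapping.keys fs). G vs)"
  by (induction fs arbitrary: G) (simp_all add: sum_set_Cons pbind_def)

lemma mext_append: "mext G (fs @ gs) = mext (\<lambda>us. mext (\<lambda>vs. G (us @ vs)) gs) fs"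
  by (induction fs arbitrary: G) simp_all

lemma mext_add_fun: "mext (\<lambda>vs. G vs + H vs) fs = mext G fs + mext H fs"
  by (simp add: mext_conv_sum sum.distrib)

lemma mext_zero_fun [simp]: "mext (\<lambda>vs. 0) fs = 0"
  by (simp add: mext_conv_sum)

lemma mext_sum_fun: "mext (\<lambda>vs. \<Sum>i\<in>I. G i vs) fs = (\<Sum>i\<in>I. mext (G i) fs)"
  unfolding mext_conv_sum by (rule sum.swap)

lemma mext_add: "mext G (fs @ (f + g) # gs) = mext G (fs @ f # gs) + mext G (fs @ g # gs)"
  by (simp add: mext_append pbind_add mext_add_fun)

lemma mext_sgl [simp]: "mext G (map sgl vs) = G vs"
  by (induction vs arbitrary: G) simp_all

lemma pbind_mext: "pbind (mext G fs) H = mext (\<lambda>vs. pbind (G vs) H) fs"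
  by (simp add: mext_conv_sum pbind_sum)

lemma pbind_mext_swap: "pbind f (\<lambda>v. mext (G v) fs) = mext (\<lambda>vs. pbind f (\<lambda>v. G v vs)) fs"
  unfolding pbind_def mext_conv_sum by (rule sum.swap)

lemma mext_pbind: "mext G (map (\<lambda>f. pbind f H) fs) = mext (\<lambda>vs. mext G (map H vs)) fs"
  by (induction fs arbitrary: G) (simp_all add: pbind_pbind pbind_mext_swap)

lemma mext2_concat: "mext2 (\<lambda>vss. G (concat vss)) fss = mext G (concat fss)"
proof (induction fss arbitrary: G)
  case (Cons fs fss)
  show ?case using Cons[of "\<lambda>vs. G (_ @ vs)"] by (simp add: mext_append)
qed simp

text \<open>A composite of multilinear maps is multilinear in all the inner arguments jointly. The
  tag \<open>a\<close> stands for the inner operation, which varies from argument to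
  argument.\<close>

lemma mext_mext:
  "mext G (map (\<lambda>(a, fs). mext (H a) fs) zs) =
    mext2 (\<lambda>vss. mext G (map (\<lambda>(a, vs). H a vs) (zip (map fst zs) vss))) (map snd zs)"
proof (induction zs arbitrary: G)
  case (Cons z zs)
  obtain a fs where z: "z = (a, fs)" by (cases z)
  have pbind_mext2: "mext2 (\<lambda>vss. pbind f (K vss)) gss = pbind f (\<lambda>v. mext2 (\<lambda>vss. K vss v) gss)" for f K gss
  proof (induction gss arbitrary: K)
    case (Cons gs gss)
    then show ?case by (simp add: pbind_mext_swap)
  qed simp
  then show ?case by (simp add: z Cons.IH pbind_mext pbind_mext2)
qed simp

lemma permute_list_inv:
  assumes "\<sigma> permutes {..<length xs}"
  shows "permute_list (inv_into UNIV \<sigma>) (permute_list \<sigma> xs) = xs"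
    "permute_list \<sigma> (permute_list (inv_into UNIV \<sigma>) xs) = xs"
  using assms permutes_inv[OF assms] permutes_inv_o[OF assms]
  by (simp_all flip: permute_list_compose)

lemma listset_permute:
  assumes "\<sigma> permutes {..<length As}"
  shows "bij_betw (permute_list \<sigma>) (listset As) (listset (permute_list \<sigma> As))"
proof (rule bij_betw_byWitness[where f' = "permute_list (inv_into UNIV \<sigma>)"])
  have inv: "inv_into UNIV \<sigma> permutes {..<length As}" using assms by (rule permutes_inv)
  show "\<forall>vs\<in>listset As. permute_list (inv_into UNIV \<sigma>) (permute_list \<sigma> vs) = vs"
    "\<forall>vs\<in>listset (permute_list \<sigma> As). permute_list \<sigma> (permute_list (inv_into UNIV \<sigma>) vs) = vs"
    using assms permute_list_inv[of \<sigma>] by (metis list_all2_lengthD listset_iff length_permute_list)+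
  show "permute_list \<sigma> ` listset As \<subseteq> listset (permute_list \<sigma> As)"
  proof safe
    fix vs assume "vs \<in> listset As"
    then have vs: "list_all2 (\<in>) vs As" by (simp add: listset_iff)
    then have "\<sigma> permutes {..<length vs}" using assms by (simp add: list_all2_lengthD)
    with vs show "permute_list \<sigma> vs \<in> listset (permute_list \<sigma> As)"
      by (simp add: listset_iff list_all2_permute_list_iff)
  qed
  show "permute_list (inv_into UNIV \<sigma>) ` listset (permute_list \<sigma> As) \<subseteq> listset As"
  proof
    fix vs assume "vs \<in> permute_list (inv_into UNIV \<sigma>) ` listset (permute_list \<sigma> As)"
    then obtain us where us: "list_all2 (\<in>) us (permute_list \<sigma> As)" "vs = permute_list (inv_into UNIV \<sigma>) us"
      by (auto simp: listset_iff)
    then have "length us = length As" by (auto dest: list_all2_lengthD)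
    with us(1) inv have "list_all2 (\<in>) (permute_list (inv_into UNIV \<sigma>) us) (permute_list (inv_into UNIV \<sigma>) (permute_list \<sigma> As))"
      by (subst list_all2_permute_list_iff) auto
    then show "vs \<in> listset As" by (simp add: us(2) listset_iff permute_list_inv[OF assms])
  qed
qed

lemma mext_permute:
  assumes "\<sigma> permutes {..<length fs}"
  shows "mext G (permute_list \<sigma> fs) = mext (\<lambda>vs. G (permute_list \<sigma> vs)) fs"
  unfolding mext_conv_sum
  using sum.reindex_bij_betw[OF listset_permute[of \<sigma> "map Poly_Mapping.keys fs"], of G] assms
  by (simp add: permute_list_map)


section \<open>Block permutations\<close>

lemma blocks_Nil [simp]: "blocks [] = []"
  by (simp add: blocks_def)

lemma map_plus_upt: "map ((+) k) [a..<b] = [k + a..<k + b]" for k :: nat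
  by (rule nth_equalityI) auto

lemma blocks_Cons [simp]: "blocks (k # ks) = [0..<k] # map (map ((+) k)) (blocks ks)"
  unfolding blocks_def by (simp add: map_upt_Suc map_plus_upt del: upt_Suc)

lemma length_blocks [simp]: "length (blocks ks) = length ks"
  by (simp add: blocks_def)

lemma map_length_blocks [simp]: "map length (blocks ks) = ks"
  by (induction ks) (simp_all add: comp_def)

lemma concat_blocks: "concat (blocks ks) = [0..<sum_list ks]"
proof (induction ks)
  case (Cons k ks)
  have "concat (map (map ((+) k)) (blocks ks)) = [k..<k + sum_list ks]"
    using map_plus_upt[of k 0 "sum_list ks"] by (simp add: Cons flip: map_concat)
  then show ?case by (simp add: upt_add_eq_append[of 0 k "sum_list ks"])
qed simp

lemma map_nth_blocks: "map (map ((!) (concat xss))) (blocks (map length xss)) = xss"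
proof (induction xss)
  case (Cons xs xss)
  have "map ((!) (xs @ concat xss)) [0..<length xs] = xs"
    by (rule nth_equalityI) (auto simp: nth_append)
  moreover have "(!) (xs @ concat xss) \<circ> (+) (length xs) = (!) (concat xss)"
    by (auto simp: nth_append)
  ultimately show ?case using Cons by simp
qed simp

lemma permute_list_one_line:
  assumes "length js = length zs"
  shows "permute_list (one_line js) zs = map ((!) zs) js"
  using assms by (auto simp: permute_list_def one_line_def intro!: nth_equalityI)

lemma one_line_permutes:
  assumes "mset js = mset [0..<n]"
  shows "one_line js permutes {..<n}"
proof (rule bij_imp_permutes)
  have js: "distinct js" "set js = {..<n}" "length js = n"
    using mset_eq_imp_distinct_iff[OF assms] mset_eq_setD[OF assms] mset_eq_length[OF assms]
    by (simp_all add: atLeast0LessThan)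
  have "bij_betw ((!) js) {..<n} {..<n}"
    by (rule bij_betw_nth) (simp_all only: js)
  moreover have "bij_betw (one_line js) {..<n} {..<n} \<longleftrightarrow> bij_betw ((!) js) {..<n} {..<n}"
    by (rule bij_betw_cong) (simp add: one_line_def js(3))
  ultimately show "bij_betw (one_line js) {..<n} {..<n}" by blast
  show "one_line js x = x" if "x \<notin> {..<n}" for x using that by (simp add: one_line_def js)
qed

lemma mset_concat_permute:
  "\<sigma> permutes {..<length xss} \<Longrightarrow> mset (concat (permute_list \<sigma> xss)) = mset (concat xss)"
  unfolding mset_concat by (metis mset_map mset_permute_list sum_mset_sum_list)

lemma mset_concat_permutes:
  "list_all2 (\<lambda>xs \<tau>. \<tau> permutes {..<length xs}) xss \<tau>s \<Longrightarrow>
    mset (concat (map2 permute_list \<tau>s xss)) = mset (concat xss)"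
  by (induction rule: list_all2_induct) simp_all

context
  fixes xss :: "'a list list"
begin

lemma outer_block_permutes:
  assumes "\<sigma> permutes {..<length xss}"
  shows "one_line (concat (permute_list \<sigma> (blocks (map length xss)))) permutes {..<length (concat xss)}"
  using assms
  by (intro one_line_permutes) (simp add: mset_concat_permute concat_blocks length_concat)

text \<open>Reading off the entries of \<open>concat xss\<close> at the indices in the blocks
  recovers the lists of \<open>xss\<close>, so permuting blocks of indices becomes permuting these
  lists.\<close>

lemma permute_list_outer_block:
  assumes "\<sigma> permutes {..<length xss}"
  shows "permute_list (one_line (concat (permute_list \<sigma> (blocks (map length xss))))) (concat xss) =
    concat (permute_list \<sigma> xss)"
proof -
  let ?B = "blocks (map length xss)"
  have "length (concat (permute_list \<sigma> ?B)) = length (concat xss)"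
    using mset_concat_permute[of \<sigma> ?B, THEN mset_eq_length] assms
    by (simp add: concat_blocks length_concat)
  then have "permute_list (one_line (concat (permute_list \<sigma> ?B))) (concat xss) =
      concat (map (map ((!) (concat xss))) (permute_list \<sigma> ?B))"
    by (simp add: permute_list_one_line map_concat)
  also have "map (map ((!) (concat xss))) (permute_list \<sigma> ?B) = permute_list \<sigma> xss"
    using assms by (simp add: map_nth_blocks flip: permute_list_map)
  finally show ?thesis .
qed

context
  fixes \<tau>s assumes \<tau>s: "list_all2 (\<lambda>xs \<tau>. \<tau> permutes {..<length xs}) xss \<tau>s"
begin

lemma \<tau>s_blocks: "list_all2 (\<lambda>js \<tau>. \<tau> permutes {..<length js}) (blocks (map length xss)) \<tau>s"
proof -
  have "list_all2 (\<lambda>k \<tau>. \<tau> permutes {..<k}) (map length (blocks (map length xss))) \<tau>s"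
    using \<tau>s by (simp add: list_all2_map1)
  then show ?thesis unfolding list_all2_map1 .
qed

lemma inner_block_permutes:
  "one_line (concat (map2 permute_list \<tau>s (blocks (map length xss)))) permutes {..<length (concat xss)}"
  by (intro one_line_permutes)
    (simp add: mset_concat_permutes[OF \<tau>s_blocks] concat_blocks length_concat)

lemma permute_list_inner_block:
  "permute_list (one_line (concat (map2 permute_list \<tau>s (blocks (map length xss))))) (concat xss) =
    concat (map2 permute_list \<tau>s xss)"
proof -
  let ?B = "blocks (map length xss)"
  have "length (concat (map2 permute_list \<tau>s ?B)) = length (concat xss)"
    using mset_concat_permutes[OF \<tau>s_blocks, THEN mset_eq_length]
    by (simp add: concat_blocks length_concat)
  then have "permute_list (one_line (concat (map2 permute_list \<tau>s ?B))) (concat xss) =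
      concat (map (map ((!) (concat xss))) (map2 permute_list \<tau>s ?B))"
    by (simp add: permute_list_one_line map_concat)
  also have "map (map g) (map2 permute_list \<tau>s B) = map2 permute_list \<tau>s (map (map g) B)"
    if "list_all2 (\<lambda>js \<tau>. \<tau> permutes {..<length js}) B \<tau>s" for B and g :: "nat \<Rightarrow> 'a"
    using that by (induction rule: list_all2_induct) (simp_all add: permute_list_map)
  from this[OF \<tau>s_blocks] have "map (map ((!) (concat xss))) (map2 permute_list \<tau>s ?B) = map2 permute_list \<tau>s xss"
    by (simp add: map_nth_blocks)
  finally show ?thesis .
qed

end

end


section \<open>Operadic composition of formal sums of words\<close>

lemma keys_add_subset:
  "\<lbrakk>Poly_Mapping.keys f \<subseteq> A; Poly_Mapping.keys g \<subseteq> A\<rbrakk> \<Longrightarrow> Poly_Mapping.keys (f + g) \<subseteq> A"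
  using keys_add[of f g] by blast

text \<open>The operation of \<open>word_alg\<close>, freed from the product of coefficients, which
  is 1 for every choice of words from the supports, and from the space \<open>V\<close>, which does
  not affect it.\<close>

definition wop :: "'p operad \<Rightarrow> 'p \<Rightarrow> (('p, 'a) word \<Rightarrow>\<^sub>0 bit) list \<Rightarrow> ('p, 'a) word \<Rightarrow>\<^sub>0 bit"
  where "wop P \<mu> fs = mext (\<lambda>ws. sgl (word_opr P \<mu> ws)) fs"

abbreviation sig :: "('p \<times> 'b list) list \<Rightarrow> (nat \<times> 'p) list"
  where "sig zs \<equiv> map (\<lambda>(\<nu>, xs). (length xs, \<nu>)) zs"

abbreviation eta :: "'p operad \<Rightarrow> 'a \<Rightarrow> ('p, 'a) word \<Rightarrow>\<^sub>0 bit"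
  where "eta P x \<equiv> wd (ounit P) [x]"

abbreviation wcarrier :: "'p operad \<Rightarrow> ('a, 'c) gvs_scheme \<Rightarrow> (('p, 'a) word \<Rightarrow>\<^sub>0 bit) set"
  where "wcarrier P V \<equiv> {f. Poly_Mapping.keys f \<subseteq> words P V}"

text \<open>Congruence modulo \<open>J\<close>, with a sum in place of a difference. It is used for
  the relations of the free algebra and for the larger subspace \<open>K_words\<close>.\<close>

definition eqm :: "('w \<Rightarrow>\<^sub>0 bit) set \<Rightarrow> ('w \<Rightarrow>\<^sub>0 bit) \<Rightarrow> ('w \<Rightarrow>\<^sub>0 bit) \<Rightarrow> bool"
  where "eqm J f g \<longleftrightarrow> f + g \<in> J"

lemma eqm_sym: "eqm J f g \<Longrightarrow> eqm J g f"
  by (simp add: eqm_def add.commute)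

lemma word_alg_opr: "opr (word_alg P V) \<mu> fs = wop P \<mu> fs"
proof -
  have "(\<Prod>i<length fs. Poly_Mapping.lookup (fs ! i) (ws ! i)) = 1"
    if "ws \<in> listset (map Poly_Mapping.keys fs)" for ws
    using that by (auto intro!: prod.neutral lookup_bit simp: listset_iff list_all2_conv_all_nth)
  then show ?thesis by (simp add: word_alg_def wop_def mext_conv_sum)
qed

lemma word_alg_simps [simp]:
  "carrier (word_alg P V) = wcarrier P V"
  "zero (word_alg P V) = 0"
  "add (word_alg P V) f g = f + g"
  "hpart (word_alg P V) d = {f. Poly_Mapping.keys f \<subseteq> homog_words P V d}"
  "opr (word_alg P V) \<mu> fs = wop P \<mu> fs"
  by (simp_all add: word_alg_opr) (simp_all add: word_alg_def)

lemma wcarrier_add: "\<lbrakk>f \<in> wcarrier P V; g \<in> wcarrier P V\<rbrakk> \<Longrightarrow> f + g \<in> wcarrier P V"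
  using keys_add[of f g] by blast

lemma word_alg_module: "module F2 (word_alg P V)"
proof (rule F2_moduleI)
  show "abelian_group (word_alg P V)"
  proof (rule abelian_groupI)
    fix f assume "f \<in> carrier (word_alg P V)"
    then show "\<exists>g\<in>carrier (word_alg P V). g \<oplus>\<^bsub>word_alg P V\<^esub> f = \<zero>\<^bsub>word_alg P V\<^esub>"
      by (auto intro: bexI[of _ f])
  next
    fix f g assume "f \<in> carrier (word_alg P V)" "g \<in> carrier (word_alg P V)"
    then show "f \<oplus>\<^bsub>word_alg P V\<^esub> g \<in> carrier (word_alg P V)"
      by (auto dest!: subsetD[OF keys_add])
  qed (simp_all add: algebra_simps)
  show "(0::bit) \<odot>\<^bsub>word_alg P V\<^esub> f = \<zero>\<^bsub>word_alg P V\<^esub>" "(1::bit) \<odot>\<^bsub>word_alg P V\<^esub> f = f" for f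
    by (simp_all add: word_alg_def)
qed simp

interpretation word_alg: f2_space "word_alg P V"
  by (simp add: f2_space_def word_alg_module)

lemma mext_mem:
  assumes "0 \<in> J" "\<And>f g. \<lbrakk>f \<in> J; g \<in> J\<rbrakk> \<Longrightarrow> f + g \<in> J" "\<And>vs. choice vs fs \<Longrightarrow> G vs \<in> J"
  shows "mext G fs \<in> J"
proof -
  have "(\<Sum>vs\<in>A. G vs) \<in> J" if "\<And>vs. vs \<in> A \<Longrightarrow> G vs \<in> J" for A
    using that by (induction A rule: infinite_finite_induct) (use assms in auto)
  moreover have "G vs \<in> J" if "vs \<in> listset (map Poly_Mapping.keys fs)" for vs
    using that assms(3) by (simp add: listset_iff list_all2_map2)
  ultimately show ?thesis by (simp only: mext_conv_sum)
qed

lemma pbind_mem: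
  assumes "0 \<in> J" "\<And>f g. \<lbrakk>f \<in> J; g \<in> J\<rbrakk> \<Longrightarrow> f + g \<in> J" "\<And>v. v \<in> Poly_Mapping.keys f \<Longrightarrow> G v \<in> J"
  shows "pbind f G \<in> J"
  using mext_mem[of J "[f]" "\<lambda>vs. G (hd vs)"] assms by (fastforce simp: list_all2_Cons2)

context symmetric_operad
begin

lemma inputs_sig:
  "(\<And>\<nu> xs. (\<nu>, xs) \<in> set zs \<Longrightarrow> \<nu> \<in> carrier (ops P (length xs))) \<Longrightarrow> sig zs \<in> inputs P"
  by (auto simp: inputs_def)

lemma ocomp_closed:
  "\<lbrakk>\<nu>s \<in> inputs P; \<mu> \<in> carrier (ops P (length \<nu>s))\<rbrakk> \<Longrightarrow> ocomp P \<mu> \<nu>s \<in> carrier (ops P (arity \<nu>s))"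
  using linear_mapD(1)[OF comp_linear] by blast

lemma osym_closed:
  "\<lbrakk>\<mu> \<in> carrier (ops P n); \<pi> permutes {..<n}\<rbrakk> \<Longrightarrow> osym P n \<mu> \<pi> \<in> carrier (ops P n)"
  using linear_mapD(1)[OF sym_linear] by blast

lemma ops_f2: "f2_space (ops P n)"
  by (simp add: f2_space_def ops_space)

lemma arity_sig: "arity (sig zs) = length (concat (map snd zs))"
  by (induction zs) auto

lemma word_opr_closed:
  assumes "\<mu> \<in> carrier (ops P (length ws))" "set ws \<subseteq> words P V"
  shows "word_opr P \<mu> ws \<in> words P V"
proof -
  have "sig ws \<in> inputs P" using assms(2) by (intro inputs_sig) (auto simp: words_def)
  then have "ocomp P \<mu> (sig ws) \<in> carrier (ops P (length (concat (map snd ws))))"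
    using ocomp_closed[of "sig ws" \<mu>] assms(1) by (simp only: arity_sig length_map)
  then show ?thesis using assms(2) by (fastforce simp: word_opr_def words_def)
qed

lemma wop_closed:
  assumes "\<mu> \<in> carrier (ops P (length fs))" "set fs \<subseteq> wcarrier P V"
  shows "wop P \<mu> fs \<in> wcarrier P V"
  unfolding wop_def
proof (rule mext_mem)
  fix ws assume ws: "choice ws fs"
  then have "set ws \<subseteq> words P V"
    using assms(2) by (induction rule: list_all2_induct) auto
  then show "sgl (word_opr P \<mu> ws) \<in> wcarrier P V"
    using assms(1) list_all2_lengthD[OF ws] by (simp add: word_opr_closed)
qed (auto dest!: subsetD[OF keys_add])

lemma word_opr_assoc:
  assumes "\<mu> \<in> carrier (ops P (length zs))"
    and "\<And>\<nu> ws. (\<nu>, ws) \<in> set zs \<Longrightarrow> \<nu> \<in> carrier (ops P (length ws)) \<and> set ws \<subseteq> words P V"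
  shows "word_opr P \<mu> (map (\<lambda>(\<nu>, ws). word_opr P \<nu> ws) zs) =
    word_opr P (ocomp P \<mu> (sig zs)) (concat (map snd zs))"
proof -
  have "sig (snd z) \<in> inputs P" if "z \<in> set zs" for z
    using that assms(2)[of "fst z" "snd z"] by (intro inputs_sig) (auto simp: words_def)
  then have "ocomp P (ocomp P \<mu> (sig zs)) (concat (map (\<lambda>z. sig (snd z)) zs)) =
      ocomp P \<mu> (map2 (\<lambda>(k, \<nu>) \<rho>s. (arity \<rho>s, ocomp P \<nu> \<rho>s)) (sig zs) (map (\<lambda>z. sig (snd z)) zs))"
    using assms by (intro comp_assoc inputs_sig) auto
  also have "map2 (\<lambda>(k, \<nu>) \<rho>s. (arity \<rho>s, ocomp P \<nu> \<rho>s)) (sig zs) (map (\<lambda>z. sig (snd z)) zs) =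
      sig (map (\<lambda>(\<nu>, ws). word_opr P \<nu> ws) zs)"
    by (simp add: zip_map_map zip_same_conv_map word_opr_def arity_sig case_prod_unfold comp_def
        length_concat)
  finally have "ocomp P (ocomp P \<mu> (sig zs)) (concat (map (\<lambda>z. sig (snd z)) zs)) =
      ocomp P \<mu> (sig (map (\<lambda>(\<nu>, ws). word_opr P \<nu> ws) zs))" .
  moreover have "concat (map (\<lambda>z. sig (snd z)) zs) = sig (concat (map snd zs))"
    by (simp add: map_concat comp_def)
  moreover have "concat (map snd (map (\<lambda>(\<nu>, ws). word_opr P \<nu> ws) zs)) = concat (map snd (concat (map snd zs)))"
    by (induction zs) (auto simp: word_opr_def)
  ultimately show ?thesis unfolding word_opr_def by metis
qed

text \<open>Operadic associativity holds for words; \<open>mext_mext\<close> expands the inner sums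
  into words, and \<open>mext2_concat\<close> collects the result as one multilinear extension in
  the concatenated arguments.\<close>

lemma wop_assoc:
  assumes "\<mu> \<in> carrier (ops P (length zs))"
    and "\<And>\<nu> fs. (\<nu>, fs) \<in> set zs \<Longrightarrow> \<nu> \<in> carrier (ops P (length fs)) \<and> set fs \<subseteq> wcarrier P V"
  shows "wop P \<mu> (map (\<lambda>(\<nu>, fs). wop P \<nu> fs) zs) =
    wop P (ocomp P \<mu> (sig zs)) (concat (map snd zs))"
proof -
  have "mext (\<lambda>ws. sgl (word_opr P \<mu> ws)) (map (\<lambda>(\<nu>, ws). sgl (word_opr P \<nu> ws)) (zip (map fst zs) vss)) =
      sgl (word_opr P (ocomp P \<mu> (sig zs)) (concat vss))"
    if "list_all2 choice vss (map snd zs)" for vss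
  proof -
    let ?zs = "zip (map fst zs) vss"
    have len: "length vss = length zs" using list_all2_lengthD[OF that] by simp
    have *: "length (vss ! i) = length (snd (zs ! i))" "choice (vss ! i) (snd (zs ! i))"
      if "i < length zs" for i
      using that \<open>list_all2 choice vss (map snd zs)\<close> by (auto simp: list_all2_conv_all_nth)
    have snd: "map snd ?zs = vss" using len by simp
    have sig: "sig ?zs = sig zs"
      using len * by (auto simp: case_prod_unfold intro!: nth_equalityI)
    have "\<nu> \<in> carrier (ops P (length ws)) \<and> set ws \<subseteq> words P V" if zw: "(\<nu>, ws) \<in> set ?zs" for \<nu> ws
    proof -
      obtain i where i: "i < length zs" "\<nu> = fst (zs ! i)" "ws = vss ! i"
        using zw len by (auto simp: in_set_zip)
      have "(fst (zs ! i), snd (zs ! i)) \<in> set zs" using i by simp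
      note a = assms(2)[OF this]
      have "set ws \<subseteq> words P V"
      proof
        fix w assume "w \<in> set ws"
        then obtain j where "j < length ws" "w = ws ! j" by (auto simp: in_set_conv_nth)
        then show "w \<in> words P V"
          using *[OF i(1)] i(3) subsetD[OF conjunct2[OF a] nth_mem[of j]]
          by (auto simp: list_all2_conv_all_nth)
      qed
      then show ?thesis using a i *[OF i(1)] by simp
    qed
    then have "word_opr P \<mu> (map (\<lambda>(\<nu>, ws). word_opr P \<nu> ws) ?zs) =
        word_opr P (ocomp P \<mu> (sig ?zs)) (concat (map snd ?zs))"
      using assms(1) len by (intro word_opr_assoc) auto
    then have "word_opr P \<mu> (map (\<lambda>(\<nu>, ws). word_opr P \<nu> ws) ?zs) =
        word_opr P (ocomp P \<mu> (sig zs)) (concat vss)"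
      by (simp only: snd sig)
    moreover have "map (\<lambda>(\<nu>, ws). sgl (word_opr P \<nu> ws)) ?zs = map sgl (map (\<lambda>(\<nu>, ws). word_opr P \<nu> ws) ?zs)"
      by (simp add: case_prod_unfold)
    ultimately show ?thesis by (simp only: mext_sgl)
  qed
  then have "mext2 (\<lambda>vss. mext (\<lambda>ws. sgl (word_opr P \<mu> ws))
        (map (\<lambda>(\<nu>, ws). sgl (word_opr P \<nu> ws)) (zip (map fst zs) vss))) (map snd zs) =
      mext2 (\<lambda>vss. sgl (word_opr P (ocomp P \<mu> (sig zs)) (concat vss))) (map snd zs)"
    by (rule mext2_cong)
  also have "\<dots> = mext (\<lambda>ws. sgl (word_opr P (ocomp P \<mu> (sig zs)) ws)) (concat (map snd zs))"
    by (rule mext2_concat)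
  finally show ?thesis unfolding wop_def mext_mext .
qed

lemma eta_in_wcarrier: "x \<in> carrier V \<Longrightarrow> eta P x \<in> wcarrier P V"
  using unit_closed by (simp add: words_def)

text \<open>The right unit law. Through it the words \<open>eta P x\<close> generate everything, and
  a map that commutes with the operations is determined by its values on them.\<close>

lemma word_eq_wop:
  assumes "(\<mu>, xs) \<in> words P V"
  shows "wd \<mu> xs = wop P \<mu> (map (eta P) xs)"
proof -
  have "word_opr P \<mu> (map (\<lambda>x. (ounit P, [x])) xs) = (ocomp P \<mu> (replicate (length xs) (1, ounit P)), xs)"
    by (simp add: word_opr_def comp_def map_replicate_const)
  also have "\<dots> = (\<mu>, xs)" using assms comp_unit_right by (simp add: words_def)
  finally show ?thesis
    using mext_sgl[of "\<lambda>ws. sgl (word_opr P \<mu> ws)" "map (\<lambda>x. (ounit P, [x])) xs"]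
    by (simp add: wop_def comp_def)
qed

lemma wop_unit:
  assumes "f \<in> wcarrier P V"
  shows "wop P (ounit P) [f] = f"
proof -
  have "word_opr P (ounit P) [w] = w" if "w \<in> Poly_Mapping.keys f" for w
    using that assms comp_unit_left by (cases w) (auto simp: word_opr_def words_def)
  then have "pbind f (\<lambda>w. sgl (word_opr P (ounit P) [w])) = pbind f sgl"
    by (intro pbind_cong) simp
  then show ?thesis by (simp add: wop_def)
qed

end

section \<open>Compatibility of the operations with the relations of the free algebra\<close>

locale operad_space = symmetric_operad P + f2_space V
  for P :: "'p operad" and V :: "('a, 'c) gvs_scheme" (structure)
begin

abbreviation "W \<equiv> wcarrier P V"
abbreviation "R \<equiv> word_rel_space P V"

lemma word_rels_subset: "word_rels P V \<subseteq> W"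
proof
  fix r assume "r \<in> word_rels P V"
  then show "r \<in> W"
  proof cases
    case (op_add \<mu> xs \<nu>)
    interpret O: f2_space "ops P (length xs)" by (rule ops_f2)
    show ?thesis unfolding op_add(1) poly_bit_minus mem_Collect_eq
      using op_add(2-) by (intro keys_add_subset) (auto simp: words_def)
  next
    case (op_smult \<mu> xs c)
    interpret O: f2_space "ops P (length xs)" by (rule ops_f2)
    show ?thesis unfolding op_smult(1) poly_bit_minus mem_Collect_eq
      using op_smult(2-) by (cases c; intro keys_add_subset) (auto simp: words_def O.smult_bit)
  next
    case (arg_add \<mu> xs ys x y)
    show ?thesis unfolding arg_add(1) poly_bit_minus mem_Collect_eq
      using arg_add(2-) by (intro keys_add_subset) (auto simp: words_def)
  next
    case (arg_smult \<mu> xs ys x c)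
    show ?thesis unfolding arg_smult(1) poly_bit_minus mem_Collect_eq
      using arg_smult(2-) by (cases c; intro keys_add_subset) (auto simp: words_def smult_bit)
  next
    case (sym \<mu> xs \<pi>)
    show ?thesis unfolding sym(1) poly_bit_minus mem_Collect_eq
      using sym(2-) by (intro keys_add_subset) (auto simp: words_def osym_closed)
  qed
qed

lemma R_submodule: "submodule R F2 (word_alg P V)"
proof -
  have "f \<in> wcarrier P V" if "f \<in> R" for f
  proof -
    have "submodule W F2 (word_alg P V)" using word_alg.carrier_is_submodule[of P V] by simp
    then show ?thesis using that word_rels_subset unfolding word_rel_space_def lin_span_def by blast
  qed
  then show ?thesis
  proof (intro word_alg.f2_submoduleI)
    show "\<zero>\<^bsub>word_alg P V\<^esub> \<in> R"
      using word_alg.submoduleD(2)[where P = P and V = V] unfolding word_rel_space_def lin_span_def by blast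
    show "f \<oplus>\<^bsub>word_alg P V\<^esub> g \<in> R" if "f \<in> R" "g \<in> R" for f g
      using that word_alg.submoduleD(3)[where P = P and V = V] unfolding word_rel_space_def lin_span_def by blast
  qed auto
qed

lemma R_subset: "R \<subseteq> W" and R_zero [simp]: "0 \<in> R" and R_add: "\<lbrakk>f \<in> R; g \<in> R\<rbrakk> \<Longrightarrow> f + g \<in> R"
  using word_alg.submoduleD[OF R_submodule] by auto

lemma rels_R: "r \<in> word_rels P V \<Longrightarrow> r \<in> R"
  unfolding word_rel_space_def lin_span_def by blast

lemma R_op_add:
  assumes "\<mu> \<in> carrier (ops P (length xs))" "\<nu> \<in> carrier (ops P (length xs))" "set xs \<subseteq> carrier V"
  shows "wd (\<mu> \<oplus>\<^bsub>ops P (length xs)\<^esub> \<nu>) xs + (wd \<mu> xs + wd \<nu> xs) \<in> R"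
  using rels_R[OF word_rels.op_add[OF assms]] by simp

lemma R_arg_add:
  assumes "\<mu> \<in> carrier (ops P (length xs + 1 + length ys))" "set xs \<subseteq> carrier V"
    "set ys \<subseteq> carrier V" "x \<in> carrier V" "y \<in> carrier V"
  shows "wd \<mu> (xs @ (x \<oplus> y) # ys) + (wd \<mu> (xs @ x # ys) + wd \<mu> (xs @ y # ys)) \<in> R"
  using rels_R[OF word_rels.arg_add[OF assms]] by simp

lemma R_sym:
  assumes "\<mu> \<in> carrier (ops P (length xs))" "set xs \<subseteq> carrier V" "\<pi> permutes {..<length xs}"
  shows "wd (osym P (length xs) \<mu> \<pi>) xs + wd \<mu> (permute_list \<pi> xs) \<in> R"
  using rels_R[OF word_rels.sym[OF assms]] by simp

text \<open>Additivity for the sum of zero with itself is the relation \<open>w + (w + w)\<close>,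
  which is \<open>w\<close> in characteristic 2.\<close>

lemma R_zero_arg:
  assumes "\<mu> \<in> carrier (ops P (length xs))" "set xs \<subseteq> carrier V" "\<zero> \<in> set xs"
  shows "wd \<mu> xs \<in> R"
proof -
  obtain us vs where "xs = us @ \<zero> # vs" using assms(3) by (meson split_list)
  then show ?thesis using R_arg_add[of \<mu> us vs \<zero> \<zero>] assms by simp
qed

text \<open>Over the field with two elements the relations of scalar multiplication follow from additivity.\<close>

lemma R_induct [consumes 1, case_names zero add op_add arg_add sym]:
  assumes "r \<in> R"
    and zero: "Q 0" and add: "\<And>r s. \<lbrakk>r \<in> R; s \<in> R; Q r; Q s\<rbrakk> \<Longrightarrow> Q (r + s)"
    and op: "\<And>\<mu> \<nu> xs. \<lbrakk>\<mu> \<in> carrier (ops P (length xs)); \<nu> \<in> carrier (ops P (length xs));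
      set xs \<subseteq> carrier V\<rbrakk> \<Longrightarrow> Q (wd (\<mu> \<oplus>\<^bsub>ops P (length xs)\<^esub> \<nu>) xs + (wd \<mu> xs + wd \<nu> xs))"
    and arg: "\<And>\<mu> xs ys x y. \<lbrakk>\<mu> \<in> carrier (ops P (length xs + 1 + length ys)); set xs \<subseteq> carrier V;
        set ys \<subseteq> carrier V; x \<in> carrier V; y \<in> carrier V\<rbrakk> \<Longrightarrow>
      Q (wd \<mu> (xs @ (x \<oplus> y) # ys) + (wd \<mu> (xs @ x # ys) + wd \<mu> (xs @ y # ys)))"
    and sym: "\<And>\<mu> xs \<pi>. \<lbrakk>\<mu> \<in> carrier (ops P (length xs)); set xs \<subseteq> carrier V;
        \<pi> permutes {..<length xs}\<rbrakk> \<Longrightarrow>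
      Q (wd (osym P (length xs) \<mu> \<pi>) xs + wd \<mu> (permute_list \<pi> xs))"
  shows "Q r"
proof -
  let ?S = "{r \<in> R. Q r}"
  have "submodule ?S F2 (word_alg P V)"
    using R_subset R_add zero add by (intro word_alg.f2_submoduleI) auto
  moreover have "word_rels P V \<subseteq> ?S"
  proof
    fix r assume r: "r \<in> word_rels P V"
    then have "Q r"
    proof cases
      case (op_smult \<mu> xs c)
      interpret O: f2_space "ops P (length xs)" by (rule ops_f2)
      show ?thesis
        using op_smult op[of "\<zero>\<^bsub>ops P (length xs)\<^esub>" xs "\<zero>\<^bsub>ops P (length xs)\<^esub>"] zero
        by (cases c) (auto simp: O.smult_bit)
    next
      case (arg_smult \<mu> xs ys x c)
      then show ?thesis using arg[of \<mu> xs ys \<zero> \<zero>] zero by (cases c) (auto simp: smult_bit)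
    qed (use op arg sym in auto)
    then show "r \<in> ?S" using rels_R[OF r] by simp
  qed
  ultimately have "lin_span (word_alg P V) (word_rels P V) \<subseteq> ?S"
    unfolding lin_span_def by blast
  then show ?thesis using assms(1) by (auto simp: word_rel_space_def)
qed

lemma choice_words:
  assumes "choice ws fs" "set fs \<subseteq> W"
  shows "set ws \<subseteq> words P V" "length ws = length fs" "sig ws \<in> inputs P"
    "set (concat (map snd ws)) \<subseteq> carrier V"
proof -
  show w: "set ws \<subseteq> words P V"
    using assms by (induction rule: list_all2_induct) auto
  show "length ws = length fs" using assms(1) by (rule list_all2_lengthD)
  show "sig ws \<in> inputs P" using w by (intro inputs_sig) (auto simp: words_def)
  show "set (concat (map snd ws)) \<subseteq> carrier V" using w by (fastforce simp: words_def)
qed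

lemma wop_op_add:
  assumes "\<mu> \<in> carrier (ops P (length fs))" "\<nu> \<in> carrier (ops P (length fs))" "set fs \<subseteq> W"
  shows "eqm R (wop P (\<mu> \<oplus>\<^bsub>ops P (length fs)\<^esub> \<nu>) fs) (wop P \<mu> fs + wop P \<nu> fs)"
  unfolding eqm_def wop_def mext_add_fun[symmetric]
proof (rule mext_mem)
  fix ws assume "choice ws fs"
  note ws = choice_words[OF this assms(3)]
  have "ocomp P (\<mu> \<oplus>\<^bsub>ops P (length fs)\<^esub> \<nu>) (sig ws) =
      ocomp P \<mu> (sig ws) \<oplus>\<^bsub>ops P (length (concat (map snd ws)))\<^esub> ocomp P \<nu> (sig ws)"
    using linear_mapD(2)[OF comp_linear[OF ws(3)]] ws(2) assms by (simp only: arity_sig length_map)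
  moreover have "ocomp P \<rho> (sig ws) \<in> carrier (ops P (length (concat (map snd ws))))"
    if "\<rho> \<in> carrier (ops P (length fs))" for \<rho>
    using ocomp_closed[OF ws(3)] ws(2) that by (simp only: arity_sig length_map)
  ultimately show "sgl (word_opr P (\<mu> \<oplus>\<^bsub>ops P (length fs)\<^esub> \<nu>) ws) +
      (sgl (word_opr P \<mu> ws) + sgl (word_opr P \<nu> ws)) \<in> R"
    using R_op_add[OF _ _ ws(4)] assms by (simp only: word_opr_def)
qed (auto intro: R_add)

text \<open>Outer equivariance of the operad moves \<open>\<pi>\<close> outside the composite as a
  block permutation. The symmetry relation lets the latter act on the concatenated arguments, where
  it permutes the words as \<open>\<pi>\<close> does.\<close>

lemma wop_sym:
  assumes "\<mu> \<in> carrier (ops P (length fs))" "\<pi> permutes {..<length fs}" "set fs \<subseteq> W"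
  shows "eqm R (wop P (osym P (length fs) \<mu> \<pi>) fs) (wop P \<mu> (permute_list \<pi> fs))"
  unfolding eqm_def wop_def mext_permute[OF assms(2)] mext_add_fun[symmetric]
proof (rule mext_mem)
  fix ws assume "choice ws fs"
  note ws = choice_words[OF this assms(3)]
  let ?xss = "map snd ws"
  let ?\<tau> = "one_line (concat (permute_list \<pi> (blocks (map length ?xss))))"
  have fst_sig: "map fst (sig ws) = map length ?xss" by auto
  have \<pi>: "\<pi> permutes {..<length ?xss}" "\<pi> permutes {..<length ws}" using assms(2) ws(2) by simp_all
  have "ocomp P (osym P (length fs) \<mu> \<pi>) (sig ws) =
      osym P (length (concat ?xss)) (ocomp P \<mu> (permute_list \<pi> (sig ws))) ?\<tau>"
    using comp_sym_outer[OF ws(3), of \<mu> \<pi>] assms(1,2) ws(2)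
    unfolding arity_sig fst_sig by (simp add: length_concat comp_def)
  also have "permute_list \<pi> (sig ws) = sig (permute_list \<pi> ws)"
    using \<pi> by (simp add: permute_list_map)
  finally have 1: "word_opr P (osym P (length fs) \<mu> \<pi>) ws =
      (osym P (length (concat ?xss)) (ocomp P \<mu> (sig (permute_list \<pi> ws))) ?\<tau>, concat ?xss)"
    by (simp add: word_opr_def)
  have 2: "word_opr P \<mu> (permute_list \<pi> ws) =
      (ocomp P \<mu> (sig (permute_list \<pi> ws)), permute_list ?\<tau> (concat ?xss))"
    unfolding permute_list_outer_block[OF \<pi>(1)] using \<pi> by (simp add: word_opr_def permute_list_map)
  have "word_opr P \<mu> (permute_list \<pi> ws) \<in> words P V"
    using \<pi> ws assms(1) by (intro word_opr_closed) simp_all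
  then have "ocomp P \<mu> (sig (permute_list \<pi> ws)) \<in> carrier (ops P (length (concat ?xss)))"
    unfolding 2 by (simp add: words_def)
  from R_sym[OF this ws(4) outer_block_permutes[OF \<pi>(1)]]
  show "sgl (word_opr P (osym P (length fs) \<mu> \<pi>) ws) + sgl (word_opr P \<mu> (permute_list \<pi> ws)) \<in> R"
    unfolding 1 2 .
qed (auto intro: R_add)

text \<open>Composition is linear in its last operation, the arguments of the last word are part of
  the concatenated list, and inner equivariance extends a permutation of them to the whole list. So
  each kind of relation is carried to relations of the same kind.\<close>

lemma wop_R_last:
  assumes "r \<in> R" "\<mu> \<in> carrier (ops P (Suc (length fs)))" "set fs \<subseteq> W"
  shows "wop P \<mu> (fs @ [r]) \<in> R"
  using assms(1)
proof (induction r rule: R_induct)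
  case zero
  show ?case by (simp add: wop_def mext_append)
next
  case (add r s)
  then show ?case using mext_add[of "\<lambda>ws. sgl (word_opr P \<mu> ws)" fs r s "[]"] by (simp add: wop_def R_add)
next
  case (op_add \<nu> \<nu>' xs)
  show ?case unfolding wop_def mext_append
  proof (rule mext_mem)
    fix ws assume "choice ws fs"
    note ws = choice_words[OF this assms(3)]
    have lin: "linear_map (ops P (length xs)) (ops P (length (concat (map snd ws) @ xs)))
        (\<lambda>\<nu>. ocomp P \<mu> (sig ws @ [(length xs, \<nu>)]))"
      using comp_multilinear[OF ws(3), of "[]" \<mu> "length xs"] assms(2) ws(2)
      unfolding arity_sig by (simp add: inputs_def del: length_concat)
    have "set (concat (map snd ws) @ xs) \<subseteq> carrier V" using ws(4) op_add by simp
    from R_op_add[OF linear_mapD(1)[OF lin op_add(1)] linear_mapD(1)[OF lin op_add(2)] this]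
    show "mext (\<lambda>vs. sgl (word_opr P \<mu> (ws @ vs)))
        [wd (\<nu> \<oplus>\<^bsub>ops P (length xs)\<^esub> \<nu>') xs + (wd \<nu> xs + wd \<nu>' xs)] \<in> R"
      using linear_mapD(2)[OF lin op_add(1,2)] by (simp add: pbind_add word_opr_def)
  qed (auto intro: R_add)
next
  case (arg_add \<nu> xs ys x y)
  show ?case unfolding wop_def mext_append
  proof (rule mext_mem)
    fix ws assume "choice ws fs"
    note ws = choice_words[OF this assms(3)]
    let ?\<nu> = "ocomp P \<mu> (sig ws @ [(length xs + 1 + length ys, \<nu>)])"
    have "word_opr P \<mu> (ws @ [(\<nu>, xs @ x # ys)]) \<in> words P V"
      using ws assms(2) arg_add by (intro word_opr_closed) (auto simp: words_def)
    then have "?\<nu> \<in> carrier (ops P (length (concat (map snd ws) @ xs) + 1 + length ys))"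
      by (simp add: words_def word_opr_def add.assoc)
    from R_arg_add[OF this _ arg_add(3-5)] ws(4) arg_add(2)
    show "mext (\<lambda>vs. sgl (word_opr P \<mu> (ws @ vs)))
        [wd \<nu> (xs @ (x \<oplus> y) # ys) + (wd \<nu> (xs @ x # ys) + wd \<nu> (xs @ y # ys))] \<in> R"
      by (simp add: pbind_add word_opr_def)
  qed (auto intro: R_add)
next
  case (sym \<nu> xs \<pi>)
  show ?case unfolding wop_def mext_append
  proof (rule mext_mem)
    fix ws assume "choice ws fs"
    note ws = choice_words[OF this assms(3)]
    \<comment> \<open>Inner equivariance is applied with the identity permutation on every word
      except the last.\<close>
    let ?ws = "ws @ [(\<nu>, xs)]" and ?\<tau>s = "map (\<lambda>w. id) ws @ [\<pi>]"
    let ?xss = "map snd ?ws"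
    let ?\<tau> = "one_line (concat (map2 permute_list ?\<tau>s (blocks (map length ?xss))))"
    have fst_sig: "map fst (sig ?ws) = map length ?xss" by auto
    have inp: "sig ?ws \<in> inputs P" using ws sym by (auto simp: inputs_def)
    have len: "\<mu> \<in> carrier (ops P (length (sig ?ws)))" using assms(2) ws(2) by simp
    have \<tau>s: "list_all2 (\<lambda>xs \<tau>. \<tau> permutes {..<length xs}) ?xss ?\<tau>s"
      using sym by (auto simp: list_all2_append list_all2_map1 list_all2_map2 list.rel_refl permutes_id
        intro!: list_all2_refl list.rel_refl)
    have \<tau>s': "list_all2 (\<lambda>(k, \<nu>) \<tau>. \<tau> permutes {..<k}) (sig ?ws) ?\<tau>s"
      using sym by (auto simp: list_all2_append list_all2_map1 list_all2_map2 permutes_id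
        intro!: list_all2_refl list.rel_refl)
    have "map2 (\<lambda>(k, \<nu>) \<tau>. (k, osym P k \<nu> \<tau>)) (sig us) (map (\<lambda>w. id) us) = sig us"
      if "set us \<subseteq> words P V" for us
      using that by (induction us) (auto simp: sym_id words_def)
    then have "map2 (\<lambda>(k, \<nu>) \<tau>. (k, osym P k \<nu> \<tau>)) (sig ?ws) ?\<tau>s =
        sig (ws @ [(osym P (length xs) \<nu> \<pi>, xs)])"
      using ws(1) by simp
    with comp_sym_inner[OF inp len \<tau>s'] have 1: "word_opr P \<mu> (ws @ [(osym P (length xs) \<nu> \<pi>, xs)]) =
        (osym P (length (concat ?xss)) (ocomp P \<mu> (sig ?ws)) ?\<tau>, concat ?xss)"
      unfolding arity_sig fst_sig by (simp add: word_opr_def length_concat comp_def)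
    have "map2 permute_list (map (\<lambda>w. id) us) (map snd us) = map snd us" for us :: "('p, 'a) word list"
      by (induction us) auto
    then have 2: "word_opr P \<mu> (ws @ [(\<nu>, permute_list \<pi> xs)]) =
        (ocomp P \<mu> (sig ?ws), permute_list ?\<tau> (concat ?xss))"
      unfolding permute_list_inner_block[OF \<tau>s] by (simp add: word_opr_def)
    have "ocomp P \<mu> (sig ?ws) \<in> carrier (ops P (length (concat ?xss)))"
      using ocomp_closed[OF inp len] unfolding arity_sig .
    from R_sym[OF this _ inner_block_permutes[OF \<tau>s]] ws(4) sym(2)
    have "sgl (word_opr P \<mu> (ws @ [(osym P (length xs) \<nu> \<pi>, xs)])) +
        sgl (word_opr P \<mu> (ws @ [(\<nu>, permute_list \<pi> xs)])) \<in> R"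
      unfolding 1 2 by simp
    then show "mext (\<lambda>vs. sgl (word_opr P \<mu> (ws @ vs)))
        [wd (osym P (length xs) \<nu> \<pi>) xs + wd \<nu> (permute_list \<pi> xs)] \<in> R"
      by (simp add: pbind_add)
  qed (auto intro: R_add)
qed

text \<open>The inverse images, in the space of formal sums, of the ideals of the free algebra. As
  in \<open>palg_ideal\<close>, the closure condition concerns the last argument.\<close>

definition op_ideal :: "(('p, 'a) word \<Rightarrow>\<^sub>0 bit) set \<Rightarrow> bool"
  where "op_ideal J \<longleftrightarrow> R \<subseteq> J \<and> J \<subseteq> W \<and> (\<forall>f\<in>J. \<forall>g\<in>J. f + g \<in> J) \<and>
    (\<forall>fs f. \<forall>\<mu>\<in>carrier (ops P (Suc (length fs))). set fs \<subseteq> W \<longrightarrow> f \<in> J \<longrightarrow> wop P \<mu> (fs @ [f]) \<in> J)"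

lemma op_ideal_R: "op_ideal R"
  using R_subset R_add wop_R_last by (auto simp: op_ideal_def)

context
  fixes J assumes J: "op_ideal J"
begin

lemma J_add: "\<lbrakk>f \<in> J; g \<in> J\<rbrakk> \<Longrightarrow> f + g \<in> J" and J_W: "f \<in> J \<Longrightarrow> f \<in> W" and J_R: "f \<in> R \<Longrightarrow> f \<in> J"
  using J by (auto simp: op_ideal_def)

lemma eqm_refl [simp]: "eqm J f f"
  by (simp add: eqm_def J_R)

lemma eqm_trans: "\<lbrakk>eqm J f g; eqm J g h\<rbrakk> \<Longrightarrow> eqm J f h"
  using J_add[of "f + g" "g + h"] by (simp add: eqm_def add.assoc)

lemma eqm_add: "\<lbrakk>eqm J f g; eqm J f' g'\<rbrakk> \<Longrightarrow> eqm J (f + f') (g + g')"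
  using J_add[of "f + g" "f' + g'"] by (simp add: eqm_def algebra_simps)

lemma eqm_mem: "\<lbrakk>eqm J f g; g \<in> J\<rbrakk> \<Longrightarrow> f \<in> J"
  using J_add[of "f + g" g] by (simp add: eqm_def add.assoc)

lemma eqm_R: "eqm R f g \<Longrightarrow> eqm J f g"
  by (simp add: eqm_def J_R)

lemma eqm_sum: "(\<And>i. i \<in> I \<Longrightarrow> eqm J (f i) (g i)) \<Longrightarrow> eqm J (\<Sum>i\<in>I. f i) (\<Sum>i\<in>I. g i)"
  by (induction I rule: infinite_finite_induct) (auto intro: eqm_add)

text \<open>A permutation, absorbed by the operation, brings the distinguished argument to the last
  place; the two values differ by a relation, hence by an element of \<open>J\<close>.\<close>

lemma wop_mem:
  assumes "f \<in> J" "\<mu> \<in> carrier (ops P (Suc (length fs + length gs)))" "set fs \<subseteq> W" "set gs \<subseteq> W"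
  shows "wop P \<mu> (fs @ f # gs) \<in> J"
proof -
  have "mset (fs @ f # gs) = mset ((fs @ gs) @ [f])" by simp
  then obtain \<pi> where \<pi>: "\<pi> permutes {..<length ((fs @ gs) @ [f])}"
    "permute_list \<pi> ((fs @ gs) @ [f]) = fs @ f # gs"
    by (rule mset_eq_permutation)
  have "wop P (osym P (Suc (length fs + length gs)) \<mu> \<pi>) ((fs @ gs) @ [f]) \<in> J"
  proof -
    have "wop P \<nu> ((fs @ gs) @ [f]) \<in> J" if "\<nu> \<in> carrier (ops P (Suc (length (fs @ gs))))" for \<nu>
      using J assms(1,3,4) that unfolding op_ideal_def by (metis le_sup_iff set_append)
    then show ?thesis using osym_closed[OF assms(2), of \<pi>] \<pi>(1) by simp
  qed
  moreover have "eqm R (wop P (osym P (length ((fs @ gs) @ [f])) \<mu> \<pi>) ((fs @ gs) @ [f])) (wop P \<mu> (fs @ f # gs))"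
    unfolding \<pi>(2)[symmetric] using assms J_W \<pi>(1) by (intro wop_sym) auto
  ultimately show ?thesis
    using eqm_mem[OF eqm_R[OF eqm_sym]] by simp
qed

lemma eqm_wop:
  assumes "list_all2 (eqm J) fs gs" "set fs \<subseteq> W" "set gs \<subseteq> W" "\<mu> \<in> carrier (ops P (length fs))"
  shows "eqm J (wop P \<mu> fs) (wop P \<mu> gs)"
proof -
  \<comment> \<open>The arguments are replaced one at a time; \<open>hs\<close> collects those
    already replaced.\<close>
  have "eqm J (wop P \<mu> (hs @ fs)) (wop P \<mu> (hs @ gs))"
    if "set hs \<subseteq> W" "\<mu> \<in> carrier (ops P (length (hs @ fs)))" for hs
    using assms(1-3) that
  proof (induction fs gs arbitrary: hs rule: list_all2_induct)
    case (Cons f fs g gs)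
    have "wop P \<mu> (hs @ (f + g) # fs) \<in> J"
      using Cons.prems Cons.hyps by (intro wop_mem) (auto simp: eqm_def)
    then have "eqm J (wop P \<mu> (hs @ f # fs)) (wop P \<mu> (hs @ g # fs))"
      by (simp add: wop_def mext_add eqm_def)
    also have "eqm J (wop P \<mu> (hs @ g # fs)) (wop P \<mu> (hs @ g # gs))"
      using Cons.IH[of "hs @ [g]"] Cons.prems by simp
    finally (eqm_trans) show ?case .
  qed simp
  from this[of "[]"] show ?thesis using assms(4) by simp
qed

end

lemmas R_refl [simp] = eqm_refl[OF op_ideal_R]
lemmas R_trans [trans] = eqm_trans[OF op_ideal_R]
lemmas R_eqm_add = eqm_add[OF op_ideal_R]
lemmas R_eqm_sum = eqm_sum[OF op_ideal_R]
lemmas R_eqm_wop = eqm_wop[OF op_ideal_R]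
lemmas R_eqm_mem = eqm_mem[OF op_ideal_R]

end


section \<open>The free algebra as a quotient\<close>

context operad_space
begin

definition cl :: "(('p, 'a) word \<Rightarrow>\<^sub>0 bit) \<Rightarrow> (('p, 'a) word \<Rightarrow>\<^sub>0 bit) set"
  where "cl f = R +>\<^bsub>word_alg P V\<^esub> f"

abbreviation S :: "('p, (('p, 'a) word \<Rightarrow>\<^sub>0 bit) set) palg"
  where "S \<equiv> free_palg P V"

lemma cl_eq_iff: "\<lbrakk>f \<in> W; g \<in> W\<rbrakk> \<Longrightarrow> cl f = cl g \<longleftrightarrow> eqm R f g"
  unfolding cl_def eqm_def using word_alg.coset_eq_iff[OF R_submodule] by simp

lemma S_carrier: "carrier S = cl ` W"
  unfolding free_palg_def palg_quot_simps cl_def A_RCOSETS_def' by auto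

lemma S_zero: "zero S = cl 0"
  unfolding free_palg_def palg_quot_simps cl_def using word_alg.coset_zero[OF R_submodule] by simp

lemma S_add: "\<lbrakk>f \<in> W; g \<in> W\<rbrakk> \<Longrightarrow> cl f \<oplus>\<^bsub>S\<^esub> cl g = cl (f + g)"
  unfolding free_palg_def palg_quot_simps cl_def using word_alg.coset_add[OF R_submodule] by simp

lemma S_hpart: "hpart S d = cl ` {f. Poly_Mapping.keys f \<subseteq> homog_words P V d}"
  unfolding free_palg_def palg_quot_simps cl_def by simp

lemma S_module: "module F2 S"
  unfolding free_palg_def by (rule word_alg.quot_module[OF R_submodule]) (simp_all add: palg_quot_simps)

lemma S_opr:
  assumes "\<mu> \<in> carrier (ops P (length fs))" "set fs \<subseteq> W"
  shows "opr S \<mu> (map cl fs) = cl (wop P \<mu> fs)"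
proof -
  have "opr S \<mu> (map (\<lambda>f. R +>\<^bsub>word_alg P V\<^esub> f) fs) = R +>\<^bsub>word_alg P V\<^esub> opr (word_alg P V) \<mu> fs"
    unfolding free_palg_def
  proof (rule palg_quot_opr[OF word_alg_module R_submodule])
    fix gs assume "set gs \<subseteq> carrier (word_alg P V)" "length gs = length fs"
    then show "opr (word_alg P V) \<mu> gs \<in> carrier (word_alg P V)"
      using assms wop_closed[of \<mu> gs V] by simp
  next
    fix gs assume "set gs \<subseteq> carrier (word_alg P V)"
      "list_all2 (\<lambda>f g. f \<oplus>\<^bsub>word_alg P V\<^esub> g \<in> R) fs gs"
    then show "opr (word_alg P V) \<mu> fs \<oplus>\<^bsub>word_alg P V\<^esub> opr (word_alg P V) \<mu> gs \<in> R"
      using R_eqm_wop[of fs gs \<mu>] assms by (simp add: eqm_def[abs_def])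
  qed (use assms in simp)
  then show ?thesis by (simp add: cl_def[abs_def])
qed

lemma S_list:
  assumes "set Ts \<subseteq> carrier S"
  obtains fs where "set fs \<subseteq> W" "Ts = map cl fs"
proof -
  have "Ts \<in> lists (cl ` W)" using assms unfolding S_carrier by auto
  then show ?thesis using that unfolding lists_image by (auto simp: lists_eq_set)
qed

lemma cl_in_S: "f \<in> W \<Longrightarrow> cl f \<in> carrier S"
  by (auto simp: S_carrier)

lemma cl_sum:
  assumes "\<And>i. i \<in> I \<Longrightarrow> f i \<in> W"
  shows "(\<Sum>i\<in>I. f i) \<in> W" "(\<Oplus>\<^bsub>S\<^esub>i\<in>I. cl (f i)) = cl (\<Sum>i\<in>I. f i)"
proof -
  interpret S: f2_space S by (simp add: f2_space_def S_module)
  have "(\<Sum>i\<in>I. f i) \<in> W \<and> (\<Oplus>\<^bsub>S\<^esub>i\<in>I. cl (f i)) = cl (\<Sum>i\<in>I. f i)"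
    using assms
  proof (induction I rule: infinite_finite_induct)
    case (insert i I)
    then have "f i + (\<Sum>i\<in>I. f i) \<in> W"
      using wcarrier_add[of "f i" P V] by blast
    then show ?case using insert by (simp add: S.finsum_insert S_add Pi_def cl_in_S)
  qed (simp_all add: S_zero)
  then show "(\<Sum>i\<in>I. f i) \<in> W" "(\<Oplus>\<^bsub>S\<^esub>i\<in>I. cl (f i)) = cl (\<Sum>i\<in>I. f i)" by blast+
qed

end


section \<open>Algebra maps induced by maps of generators\<close>

text \<open>The algebra map that extends a map of generators, at the level of formal sums.
  Generators may go to arbitrary sums of words, as they must for \<open>F\<close> below, whose
  values involve iterates of \<open>\<star>\<close>.\<close>

definition ext :: "'p operad \<Rightarrow> ('a \<Rightarrow> ('p, 'b) word \<Rightarrow>\<^sub>0 bit) \<Rightarrow>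
    (('p, 'a) word \<Rightarrow>\<^sub>0 bit) \<Rightarrow> ('p, 'b) word \<Rightarrow>\<^sub>0 bit"
  where "ext P F f = pbind f (\<lambda>(\<mu>, xs). wop P \<mu> (map F xs))"

lemma ext_add: "ext P F (f + g) = ext P F f + ext P F g"
  by (simp add: ext_def pbind_add)

lemma ext_zero [simp]: "ext P F 0 = 0"
  by (simp add: ext_def)

lemma ext_sum: "ext P F (\<Sum>i\<in>I. f i) = (\<Sum>i\<in>I. ext P F (f i))"
  by (simp add: ext_def pbind_sum)

lemma ext_word [simp]: "ext P F (wd \<mu> xs) = wop P \<mu> (map F xs)"
  by (simp add: ext_def)

lemma (in symmetric_operad) ext_eta:
  assumes "f \<in> wcarrier P V"
  shows "ext P (eta P) f = f"
proof -
  have "ext P (eta P) f = pbind f sgl"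
    unfolding ext_def using assms word_eq_wop[of _ _ V] by (intro pbind_cong) fastforce
  then show ?thesis by simp
qed

text \<open>The uniqueness half of freeness. Every comparison of composite algebra maps rests on it:
  \<open>EF_Z\<close>, \<open>EG_EF\<close> and \<open>EF_EG\<close>.\<close>

lemma (in operad_space) eqm_ext:
  assumes J: "op_ideal J" and f: "f \<in> wcarrier P U"
    and "\<And>x. x \<in> carrier U \<Longrightarrow> F x \<in> W" "\<And>x. x \<in> carrier U \<Longrightarrow> G x \<in> W"
    and "\<And>x. x \<in> carrier U \<Longrightarrow> eqm J (F x) (G x)"
  shows "eqm J (ext P F f) (ext P G f)"
  unfolding ext_def pbind_def
proof (rule eqm_sum[OF J])
  fix w assume "w \<in> Poly_Mapping.keys f"
  then obtain \<mu> xs where w: "w = (\<mu>, xs)" "\<mu> \<in> carrier (ops P (length xs))" "set xs \<subseteq> carrier U"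
    using f by (auto simp: words_def)
  have "eqm J (wop P \<mu> (map F xs)) (wop P \<mu> (map G xs))"
  proof (rule eqm_wop[OF J])
    show "list_all2 (eqm J) (map F xs) (map G xs)"
      unfolding list_all2_map1 list_all2_map2 using assms(5) w(3) by (intro list.rel_refl_strong) blast
    show "set (map F xs) \<subseteq> W" "set (map G xs) \<subseteq> W"
      unfolding set_map using assms(3,4) w(3) by blast+
  qed (use w(2) in simp)
  then show "eqm J (case w of (\<mu>, xs) \<Rightarrow> wop P \<mu> (map F xs)) (case w of (\<mu>, xs) \<Rightarrow> wop P \<mu> (map G xs))"
    by (simp add: w(1))
qed

text \<open>Additivity is asked for modulo relations, since for formal sums of words it already
  fails for \<open>eta P\<close>.\<close>

locale generator_map = V: operad_space P V + V': operad_space P V'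
  for P :: "'p operad" and V :: "('a, 'c) gvs_scheme" and V' :: "('b, 'd) gvs_scheme" +
  fixes F :: "'a \<Rightarrow> ('p, 'b) word \<Rightarrow>\<^sub>0 bit"
  assumes F_closed: "x \<in> carrier V \<Longrightarrow> F x \<in> V'.W"
    and F_add: "\<lbrakk>x \<in> carrier V; y \<in> carrier V\<rbrakk> \<Longrightarrow> eqm V'.R (F (x \<oplus>\<^bsub>V\<^esub> y)) (F x + F y)"
begin

abbreviation "E \<equiv> ext P F"

lemma map_F: "set xs \<subseteq> carrier V \<Longrightarrow> set (map F xs) \<subseteq> V'.W"
  unfolding set_map by (rule image_subsetI) (rule F_closed, erule (1) subsetD)

lemma E_closed:
  assumes "f \<in> V.W"
  shows "E f \<in> V'.W"
  unfolding ext_def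
proof (rule pbind_mem)
  fix w assume "w \<in> Poly_Mapping.keys f"
  then have w: "w \<in> words P V" using assms by auto
  obtain \<mu> xs where [simp]: "w = (\<mu>, xs)" by (cases w)
  have "wop P \<mu> (map F xs) \<in> V'.W"
    by (rule V.wop_closed) (use w map_F in \<open>simp_all add: words_def\<close>)
  then show "(case w of (\<mu>, xs) \<Rightarrow> wop P \<mu> (map F xs)) \<in> V'.W" by simp
qed (auto dest!: subsetD[OF keys_add])

lemma E_eta: "x \<in> carrier V \<Longrightarrow> E (eta P x) = F x"
  using V.wop_unit[OF F_closed] by simp

text \<open>Operadic associativity gives an equality of formal sums; the relations enter only in
  \<open>E_R\<close>.\<close>

lemma E_wop:
  assumes "\<mu> \<in> carrier (ops P (length fs))" "set fs \<subseteq> V.W"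
  shows "E (wop P \<mu> fs) = wop P \<mu> (map E fs)"
proof -
  let ?e = "\<lambda>(\<nu>, xs). wop P \<nu> (map F xs)"
  have "ext P F (wop P \<mu> fs) = mext (\<lambda>ws. ?e (word_opr P \<mu> ws)) fs"
    by (simp add: ext_def wop_def[of P \<mu> fs] pbind_mext)
  also have "\<dots> = mext (\<lambda>ws. wop P \<mu> (map ?e ws)) fs"
  proof (rule mext_cong)
    fix ws assume "choice ws fs"
    note ws = V.choice_words[OF this assms(2)]
    let ?zs = "map (\<lambda>(\<nu>, xs). (\<nu>, map F xs)) ws"
    have "wop P \<mu> (map (\<lambda>(\<nu>, fs). wop P \<nu> fs) ?zs) = wop P (ocomp P \<mu> (sig ?zs)) (concat (map snd ?zs))"
    proof (rule V.wop_assoc[where V = V'])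
      fix \<nu> gs assume "(\<nu>, gs) \<in> set ?zs"
      then obtain xs where "(\<nu>, xs) \<in> set ws" "gs = map F xs" by auto
      then show "\<nu> \<in> carrier (ops P (length gs)) \<and> set gs \<subseteq> V'.W"
        using ws(1) map_F[of xs] by (auto simp only: words_def length_map)
    qed (use assms(1) ws(2) in simp)
    moreover have "map (\<lambda>(\<nu>, fs). wop P \<nu> fs) ?zs = map ?e ws" "sig ?zs = sig ws"
      "concat (map snd ?zs) = map F (concat (map snd ws))"
      by (auto simp: map_concat comp_def case_prod_unfold)
    ultimately show "?e (word_opr P \<mu> ws) = wop P \<mu> (map ?e ws)"
      unfolding word_opr_def prod.case by metis
  qed
  also have "\<dots> = wop P \<mu> (map E fs)"
    unfolding ext_def[abs_def] wop_def[of P \<mu>] mext_pbind ..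
  finally show ?thesis .
qed

lemma E_ext:
  assumes "f \<in> wcarrier P U" "\<And>x. x \<in> carrier U \<Longrightarrow> G x \<in> V.W"
  shows "E (ext P G f) = ext P (\<lambda>x. E (G x)) f"
proof -
  have "E (wop P \<mu> (map G xs)) = wop P \<mu> (map (\<lambda>x. E (G x)) xs)" if "(\<mu>, xs) \<in> Poly_Mapping.keys f" for \<mu> xs
  proof -
    have w: "\<mu> \<in> carrier (ops P (length xs))" "set xs \<subseteq> carrier U"
      using that assms(1) by (auto simp: words_def)
    have "set (map G xs) \<subseteq> V.W" unfolding set_map using assms(2) w(2) by blast
    then show ?thesis using E_wop[of \<mu> "map G xs"] w(1) by (simp add: comp_def)
  qed
  then show ?thesis
    unfolding ext_def[of P G] ext_def[of P "\<lambda>x. E (G x)"] pbind_def ext_sum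
    by (intro sum.cong refl) (simp only: split_beta prod.collapse)
qed

lemma E_R: "r \<in> V.R \<Longrightarrow> E r \<in> V'.R"
proof (induction r rule: V.R_induct)
  case (op_add \<mu> \<nu> xs)
  then show ?case
    using V'.wop_op_add[of \<mu> "map F xs" \<nu>] map_F[of xs] by (simp add: ext_add eqm_def)
next
  case (arg_add \<mu> xs ys x y)
  have "eqm V'.R (wop P \<mu> (map F xs @ F (x \<oplus>\<^bsub>V\<^esub> y) # map F ys))
      (wop P \<mu> (map F xs @ (F x + F y) # map F ys))"
    using arg_add F_add map_F[of xs] map_F[of ys] F_closed wcarrier_add[of "F x" P V' "F y"]
    by (intro V'.R_eqm_wop) (auto intro!: list_all2_appendI list.rel_refl)
  then show ?case by (simp add: ext_add eqm_def wop_def mext_add)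
next
  case (sym \<mu> xs \<pi>)
  then show ?case
    using V'.wop_sym[of \<mu> "map F xs" \<pi>] map_F[of xs] by (simp add: ext_add eqm_def permute_list_map)
qed (auto simp: ext_add intro: V'.R_add)

lemma E_eqm: "eqm V.R f g \<Longrightarrow> eqm V'.R (E f) (E g)"
  using E_R[of "f + g"] by (simp add: eqm_def ext_add)

end


section \<open>Families of operations satisfying the Cartan formula\<close>

abbreviation comps :: "nat \<Rightarrow> nat \<Rightarrow> nat list set"
  where "comps n i \<equiv> {js. length js = n \<and> sum_list js = i}"

lemma finite_comps: "finite (comps n i)"
proof (rule finite_subset)
  show "comps n i \<subseteq> {js. set js \<subseteq> {..i} \<and> length js = n}"
    using member_le_sum_list by auto
qed (simp add: finite_lists_length_eq)

lemma comps_0: "comps 0 i = (if i = 0 then {[]} else {})"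
  by auto

lemma sum_comps_append:
  "(\<Sum>js\<in>comps (m + n) i. G js) = (\<Sum>j\<le>i. \<Sum>us\<in>comps m j. \<Sum>vs\<in>comps n (i - j). G (us @ vs))"
proof -
  have "(\<Sum>j\<le>i. \<Sum>us\<in>comps m j. \<Sum>vs\<in>comps n (i - j). G (us @ vs)) =
      (\<Sum>(j, us, vs)\<in>Sigma {..i} (\<lambda>j. comps m j \<times> comps n (i - j)). G (us @ vs))"
    by (simp add: sum.Sigma finite_comps sum.cartesian_product case_prod_unfold)
  also have "\<dots> = (\<Sum>js\<in>comps (m + n) i. G js)"
  proof (rule sum.reindex_bij_witness[where j = "\<lambda>(j, us, vs). us @ vs"
        and i = "\<lambda>js. (sum_list (take m js), take m js, drop m js)"])
    fix js :: "nat list" assume js: "js \<in> comps (m + n) i"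
    have "sum_list (take m js) + sum_list (drop m js) = sum_list js"
      by (metis append_take_drop_id sum_list_append)
    then show "(sum_list (take m js), take m js, drop m js) \<in> Sigma {..i} (\<lambda>j. comps m j \<times> comps n (i - j))"
      using js by auto
  qed auto
  finally show ?thesis by simp
qed

lemma sum_comps_1: "(\<Sum>js\<in>comps 1 i. G js) = G [i]"
proof -
  have "comps 1 i = {[i]}" by (auto simp: length_Suc_conv)
  then show ?thesis by simp
qed

lemma sum_comps_Suc: "(\<Sum>js\<in>comps (Suc n) i. G js) = (\<Sum>j\<le>i. \<Sum>js\<in>comps n (i - j). G (j # js))"
  using sum_comps_append[of G 1 n i] unfolding sum_comps_1 by simp

text \<open>To distribute \<open>i\<close> over all slots is to distribute it over the blocks of
  slots and then inside each block. This is the combinatorial content of the compatibility between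
  the Cartan formula and operadic composition.\<close>

lemma sum_comps_concat:
  "(\<Sum>js\<in>comps (sum_list ns) i. G js) =
    (\<Sum>is\<in>comps (length ns) i. \<Sum>jss\<in>listset (map2 comps ns is). G (concat jss))"
proof (induction ns arbitrary: G i)
  case Nil
  then show ?case by (simp add: comps_0)
next
  case (Cons n ns)
  have "(\<Sum>js\<in>comps (sum_list (n # ns)) i. G js) =
      (\<Sum>j\<le>i. \<Sum>us\<in>comps n j. \<Sum>is\<in>comps (length ns) (i - j).
        \<Sum>jss\<in>listset (map2 comps ns is). G (us @ concat jss))"
    by (simp add: sum_comps_append Cons.IH)
  also have "\<dots> = (\<Sum>j\<le>i. \<Sum>is\<in>comps (length ns) (i - j). \<Sum>us\<in>comps n j.
        \<Sum>jss\<in>listset (map2 comps ns is). G (us @ concat jss))"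
    by (intro sum.cong refl sum.swap)
  also have "\<dots> = (\<Sum>is\<in>comps (length (n # ns)) i. \<Sum>jss\<in>listset (map2 comps (n # ns) is). G (concat jss))"
    by (simp add: sum_comps_Suc sum_set_Cons)
  finally show ?case .
qed

text \<open>The family \<open>T\<close> is arbitrary because the homogeneous components of a word
  satisfy the same formula as its Steenrod squares; see \<open>hproj\<close>.\<close>

definition wcart :: "(nat \<Rightarrow> 'a \<Rightarrow> 'a) \<Rightarrow> nat \<Rightarrow> (('p, 'a) word \<Rightarrow>\<^sub>0 bit) \<Rightarrow> ('p, 'a) word \<Rightarrow>\<^sub>0 bit"
  where "wcart T i f = pbind f (\<lambda>(\<mu>, xs). \<Sum>js\<in>comps (length xs) i. sgl (\<mu>, map2 T js xs))"

lemma word_Sq_eq: "word_Sq M i f = wcart (Sq M) i f"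
proof -
  have "(case w of (\<mu>, xs) \<Rightarrow> \<Sum>js\<in>comps (length xs) i.
        Poly_Mapping.single (\<mu>, map2 (Sq M) js xs) (Poly_Mapping.lookup f (\<mu>, xs))) =
      (case w of (\<mu>, xs) \<Rightarrow> \<Sum>js\<in>comps (length xs) i. sgl (\<mu>, map2 (Sq M) js xs))"
    if "w \<in> Poly_Mapping.keys f" for w
    using lookup_bit[OF that] by (cases w) simp
  then show ?thesis unfolding word_Sq_def wcart_def pbind_def by (rule sum.cong[OF refl])
qed

lemma wcart_add: "wcart T i (f + g) = wcart T i f + wcart T i g"
  by (simp add: wcart_def pbind_add)

lemma wcart_sum: "wcart T i (\<Sum>k\<in>I. f k) = (\<Sum>k\<in>I. wcart T i (f k))"
  by (simp add: wcart_def pbind_sum)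

lemma wcart_zero [simp]: "wcart T i 0 = 0"
  by (simp add: wcart_def)

lemma wcart_word: "wcart T i (wd \<mu> xs) = (\<Sum>js\<in>comps (length xs) i. wd \<mu> (map2 T js xs))"
  by (simp add: wcart_def)

lemma mext_map2_pbind:
  assumes "length is = length fs"
  shows "mext G (map2 (\<lambda>i f. pbind f (H i)) is fs) = mext (\<lambda>vs. mext G (map2 H is vs)) fs"
  using assms by (induction "is" fs arbitrary: G rule: list_induct2) (simp_all add: pbind_pbind pbind_mext_swap)

lemma mext_map2_sum:
  assumes "length As = length hs"
  shows "mext G (map2 (\<lambda>A h. \<Sum>a\<in>A. sgl (h a)) As hs) = (\<Sum>as\<in>listset As. G (map2 (\<lambda>h a. h a) hs as))"
  using assms
  by (induction As hs arbitrary: G rule: list_induct2) (simp_all add: pbind_sum sum_set_Cons)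

lemma map2_concat:
  "list_all2 (\<lambda>xs ys. length xs = length ys) xss yss \<Longrightarrow>
    map2 f (concat xss) (concat yss) = concat (map2 (map2 f) xss yss)"
  by (induction rule: list_all2_induct) simp_all

text \<open>The Cartan formula for an operation on arbitrary formal sums: for words it is
  \<open>sum_comps_concat\<close>, applied to the blocks of arguments that the composite word
  inherits from its factors.\<close>

lemma wcart_wop:
  "wcart T i (wop P \<mu> fs) =
    (\<Sum>is\<in>comps (length fs) i. wop P \<mu> (map2 (wcart T) is fs))"
proof -
  define H where "H i = (\<lambda>(\<mu> :: 'a, xs). \<Sum>js\<in>comps (length xs) i. sgl (\<mu>, map2 T js xs))" for i
  define G where "G ws = sgl (word_opr P \<mu> ws)" for ws :: "('a, 'b) word list"
  have H: "H i (word_opr P \<mu> ws) = (\<Sum>is\<in>comps (length ws) i. mext G (map2 H is ws))" for ws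
  proof -
    let ?\<mu> = "ocomp P \<mu> (sig ws)" and ?xss = "map snd ws"
    have "H i (word_opr P \<mu> ws) =
        (\<Sum>js\<in>comps (sum_list (map length ?xss)) i. sgl (?\<mu>, map2 T js (concat ?xss)))"
      by (simp add: H_def word_opr_def length_concat comp_def)
    also have "\<dots> = (\<Sum>is\<in>comps (length ws) i. \<Sum>jss\<in>listset (map2 comps (map length ?xss) is).
        sgl (?\<mu>, map2 T (concat jss) (concat ?xss)))"
      unfolding sum_comps_concat by simp
    also have "\<dots> = (\<Sum>is\<in>comps (length ws) i. mext G (map2 H is ws))"
    proof (rule sum.cong[OF refl])
      fix "is" assume "is \<in> comps (length ws) i"
      then have len: "length is = length ws" by simp
      \<comment> \<open>Each argument is rewritten as a sum of single words indexed by compositions,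
        the form that \<open>mext_map2_sum\<close> expands.\<close>
      have "mext G (map2 H is ws) =
          mext G (map2 (\<lambda>A h. \<Sum>a\<in>A. sgl (h a)) (map2 comps (map length ?xss) is)
            (map (\<lambda>w js. (fst w, map2 T js (snd w))) ws))"
        using len by (auto simp: H_def case_prod_unfold intro!: arg_cong[where f = "mext G"] nth_equalityI)
      also have "\<dots> = (\<Sum>jss\<in>listset (map2 comps (map length ?xss) is).
          G (map2 (\<lambda>h a. h a) (map (\<lambda>w js. (fst w, map2 T js (snd w))) ws) jss))"
        using len by (subst mext_map2_sum) simp_all
      also have "\<dots> = (\<Sum>jss\<in>listset (map2 comps (map length ?xss) is).
          sgl (?\<mu>, map2 T (concat jss) (concat ?xss)))"
      proof (rule sum.cong[OF refl])
        fix jss assume "jss \<in> listset (map2 comps (map length ?xss) is)"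
        then have jss: "list_all2 (\<lambda>xs ys. length xs = length ys) jss ?xss" "length jss = length ws"
          using len by (auto simp: listset_iff list_all2_conv_all_nth)
        let ?ws = "map2 (\<lambda>h a. h a) (map (\<lambda>w js. (fst w, map2 T js (snd w))) ws) jss"
        have "sig ?ws = sig ws"
          using jss by (auto simp: case_prod_unfold list_all2_conv_all_nth intro!: nth_equalityI)
        moreover have "map snd ?ws = map2 (map2 T) jss ?xss"
          using jss by (auto intro!: nth_equalityI)
        ultimately show "G ?ws = sgl (?\<mu>, map2 T (concat jss) (concat ?xss))"
          by (simp add: G_def word_opr_def map2_concat[OF jss(1)])
      qed
      finally show "(\<Sum>jss\<in>listset (map2 comps (map length ?xss) is). sgl (?\<mu>, map2 T (concat jss) (concat ?xss))) =
          mext G (map2 H is ws)" by simp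
    qed
    finally show ?thesis .
  qed
  have "wcart T i (wop P \<mu> fs) = mext (\<lambda>ws. H i (word_opr P \<mu> ws)) fs"
    by (simp add: wcart_def wop_def pbind_mext H_def)
  also have "\<dots> = mext (\<lambda>ws. \<Sum>is\<in>comps (length fs) i. mext G (map2 H is ws)) fs"
    by (rule mext_cong) (auto simp: H dest: list_all2_lengthD)
  also have "\<dots> = (\<Sum>is\<in>comps (length fs) i. mext G (map2 (\<lambda>i f. pbind f (H i)) is fs))"
    unfolding mext_sum_fun by (rule sum.cong) (auto simp: mext_map2_pbind)
  also have "(\<lambda>i f. pbind f (H i)) = wcart T"
    by (intro ext) (simp add: wcart_def H_def)
  finally show ?thesis by (simp add: wop_def G_def[abs_def])
qed

context operad_space
begin

lemma R_sum: "(\<And>i. i \<in> I \<Longrightarrow> f i \<in> R) \<Longrightarrow> (\<Sum>i\<in>I. f i) \<in> R"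
  by (induction I rule: infinite_finite_induct) (auto intro: R_add)

context
  fixes T :: "nat \<Rightarrow> 'a \<Rightarrow> 'a"
  assumes T_closed: "\<And>i x. x \<in> carrier V \<Longrightarrow> T i x \<in> carrier V"
    and T_add: "\<And>i x y. \<lbrakk>x \<in> carrier V; y \<in> carrier V\<rbrakk> \<Longrightarrow> T i (x \<oplus> y) = T i x \<oplus> T i y"
begin

lemma map2_T_closed: "set xs \<subseteq> carrier V \<Longrightarrow> set (map2 T js xs) \<subseteq> carrier V"
  using T_closed by (auto dest!: set_zip_rightD)

lemma wcart_closed:
  assumes "f \<in> W"
  shows "wcart T i f \<in> W"
  unfolding wcart_def
proof (rule pbind_mem)
  fix w assume "w \<in> Poly_Mapping.keys f"
  then have w: "w \<in> words P V" using assms by auto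
  obtain \<mu> xs where [simp]: "w = (\<mu>, xs)" by (cases w)
  have "sgl (\<mu>, map2 T js xs) \<in> W" if "js \<in> comps (length xs) i" for js
    using w that map2_T_closed[of xs js] by (simp add: words_def)
  then show "(case w of (\<mu>, xs) \<Rightarrow> \<Sum>js\<in>comps (length xs) i. sgl (\<mu>, map2 T js xs)) \<in> W"
    using cl_sum(1)[of "comps (length xs) i" "\<lambda>js. sgl (\<mu>, map2 T js xs)"] by simp
qed (auto dest!: subsetD[OF keys_add])

text \<open>Each composition carries a relation to one of the same kind, with the exception of
  symmetry, where the compositions have to be permuted along with the arguments.\<close>

lemma wcart_R: "r \<in> R \<Longrightarrow> wcart T i r \<in> R"
proof (induction r rule: R_induct)
  case (op_add \<mu> \<nu> xs)
  show ?case unfolding wcart_add wcart_word sum.distrib[symmetric]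
  proof (rule R_sum)
    fix js assume "js \<in> comps (length xs) i"
    then show "wd (\<mu> \<oplus>\<^bsub>ops P (length xs)\<^esub> \<nu>) (map2 T js xs) + (wd \<mu> (map2 T js xs) + wd \<nu> (map2 T js xs)) \<in> R"
      using op_add R_op_add[of \<mu> "map2 T js xs" \<nu>] map2_T_closed[of xs js] by simp
  qed
next
  case (arg_add \<mu> xs ys x y)
  have len: "length (xs @ z # ys) = length xs + Suc (length ys)" for z by simp
  show ?case unfolding wcart_add wcart_word len sum.distrib[symmetric]
  proof (rule R_sum)
    fix js assume js: "js \<in> comps (length xs + Suc (length ys)) i"
    define us j vs where "us = take (length xs) js" "j = js ! length xs" "vs = drop (Suc (length xs)) js"
    then have split: "js = us @ j # vs" "length us = length xs" "length vs = length ys"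
      using js by (auto simp: id_take_nth_drop)
    show "wd \<mu> (map2 T js (xs @ (x \<oplus> y) # ys)) +
        (wd \<mu> (map2 T js (xs @ x # ys)) + wd \<mu> (map2 T js (xs @ y # ys))) \<in> R"
      using R_arg_add[of \<mu> "map2 T us xs" "map2 T vs ys" "T j x" "T j y"] split arg_add
        map2_T_closed[of xs us] map2_T_closed[of ys vs] T_closed
      by (simp add: T_add)
  qed
next
  case (sym \<mu> xs \<pi>)
  \<comment> \<open>This bijection reindexes the Cartan sum of the permuted word, so that it matches
    the other sum term by term.\<close>
  have bij: "bij_betw (permute_list \<pi>) (comps (length xs) i) (comps (length xs) i)"
  proof (rule bij_betw_byWitness[where f' = "permute_list (inv_into UNIV \<pi>)"])
    have *: "\<rho> permutes {..<length js} \<Longrightarrow> sum_list (permute_list \<rho> js) = sum_list js" for \<rho> and js :: "nat list"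
      by (metis mset_permute_list sum_mset_sum_list)
    show "permute_list \<pi> ` comps (length xs) i \<subseteq> comps (length xs) i"
      "permute_list (inv_into UNIV \<pi>) ` comps (length xs) i \<subseteq> comps (length xs) i"
      using sym * permutes_inv[OF sym(3)] by auto
  qed (use sym(3) in \<open>auto simp: permute_list_inv\<close>)
  have "wcart T i (wd \<mu> (permute_list \<pi> xs)) =
      (\<Sum>js\<in>comps (length xs) i. wd \<mu> (map2 T (permute_list \<pi> js) (permute_list \<pi> xs)))"
    unfolding wcart_word length_permute_list by (rule sum.reindex_bij_betw[OF bij, symmetric])
  also have "\<dots> = (\<Sum>js\<in>comps (length xs) i. wd \<mu> (permute_list \<pi> (map2 T js xs)))"
  proof (rule sum.cong[OF refl])
    fix js assume "js \<in> comps (length xs) i"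
    then have "map2 T (permute_list \<pi> js) (permute_list \<pi> xs) = permute_list \<pi> (map2 T js xs)"
      using sym(3) by (simp add: permute_list_map flip: permute_list_zip)
    then show "wd \<mu> (map2 T (permute_list \<pi> js) (permute_list \<pi> xs)) = wd \<mu> (permute_list \<pi> (map2 T js xs))"
      by simp
  qed
  finally have *: "wcart T i (wd \<mu> (permute_list \<pi> xs)) =
      (\<Sum>js\<in>comps (length xs) i. wd \<mu> (permute_list \<pi> (map2 T js xs)))" .
  show ?case unfolding wcart_add * unfolding wcart_word sum.distrib[symmetric]
  proof (rule R_sum)
    fix js assume "js \<in> comps (length xs) i"
    then show "wd (osym P (length xs) \<mu> \<pi>) (map2 T js xs) + wd \<mu> (permute_list \<pi> (map2 T js xs)) \<in> R"
      using sym R_sym[of \<mu> "map2 T js xs" \<pi>] map2_T_closed[of xs js] by simp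
  qed
qed (auto simp: wcart_add intro: R_add)

lemma wcart_eqm: "eqm R f g \<Longrightarrow> eqm R (wcart T i f) (wcart T i g)"
  using wcart_R[of "f + g"] by (simp add: eqm_def wcart_add)

end

end


section \<open>The grading of the free algebra\<close>

locale graded_operad_space = operad_space P V + graded_space V
  for P :: "'p operad" and V :: "('a, 'c) gvs_scheme" (structure)
begin

abbreviation hlist :: "'a list \<Rightarrow> nat list \<Rightarrow> bool"
  where "hlist \<equiv> list_all2 (\<lambda>x e. x \<in> hpart V e)"

lemma hlist_carrier: "hlist xs ds \<Longrightarrow> set xs \<subseteq> carrier V"
  by (induction rule: list_all2_induct) (auto simp: hpart_carrier)

lemma homog_words_subset: "homog_words P V d \<subseteq> words P V"
  using hlist_carrier by (fastforce simp: homog_words_def words_def)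

text \<open>By multilinearity the words with homogeneous arguments span modulo relations. The inner
  claim splits the arguments from left to right, \<open>us\<close> being those that are homogeneous
  already.\<close>

lemma homog_induct [consumes 1, case_names rel add word]:
  assumes "f \<in> W"
    and rel: "\<And>r. r \<in> R \<Longrightarrow> Q r"
    and add: "\<And>f g. \<lbrakk>f \<in> W; g \<in> W; Q f; Q g\<rbrakk> \<Longrightarrow> Q (f + g)"
    and word: "\<And>\<mu> xs ds. \<lbrakk>\<mu> \<in> carrier (ops P (length xs)); hlist xs ds\<rbrakk> \<Longrightarrow> Q (wd \<mu> xs)"
  shows "Q f"
proof -
  have *: "Q (wd \<mu> (us @ xs))"
    if "hlist us ds" "set xs \<subseteq> carrier V" "\<mu> \<in> carrier (ops P (length (us @ xs)))" for \<mu> us ds xs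
    using that
  proof (induction xs arbitrary: us ds)
    case Nil
    then show ?case using word[of \<mu> us ds] by simp
  next
    case (Cons x xs)
    have us: "set us \<subseteq> carrier V" using Cons.prems(1) by (rule hlist_carrier)
    have "x \<in> carrier V" using Cons.prems by simp
    then show ?case
    proof (induction x rule: graded_induct)
      case zero
      show ?case using Cons.prems us by (intro rel R_zero_arg) auto
    next
      case (homog d x)
      then have "hlist (us @ [x]) (ds @ [d])" using Cons.prems(1) by (auto intro: list_all2_appendI)
      then show ?case using Cons.IH[of "us @ [x]" "ds @ [d]"] Cons.prems by simp
    next
      case (add x y)
      have W: "wd \<mu> (us @ z # xs) \<in> W" if "z \<in> carrier V" for z
        using that us Cons.prems by (auto simp: words_def)
      have r: "wd \<mu> (us @ (x \<oplus> y) # xs) + (wd \<mu> (us @ x # xs) + wd \<mu> (us @ y # xs)) \<in> R" (is "?r \<in> R")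
        using Cons.prems us add(1,2) by (intro R_arg_add) auto
      have s: "wd \<mu> (us @ x # xs) + wd \<mu> (us @ y # xs) \<in> W"
        using wcarrier_add[OF W W] add(1,2) by blast
      have "Q (wd \<mu> (us @ x # xs) + wd \<mu> (us @ y # xs))"
        using assms(3)[OF W W] add by blast
      \<comment> \<open>In characteristic 2, adding the two words to the additivity relation
        \<open>?r\<close> gives back the word with argument \<open>x \<oplus> y\<close>.\<close>
      then have "Q (?r + (wd \<mu> (us @ x # xs) + wd \<mu> (us @ y # xs)))"
        using assms(3)[OF _ s rel[OF r]] R_subset r by blast
      then show ?case by (simp add: add.assoc)
    qed
  qed
  show ?thesis
  proof -
    have "f \<in> W \<and> Q f"
    proof (induction rule: poly_bit_induct[where g = f])
      case zero
      then show ?case using rel[OF R_zero] by simp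
    next
      case (sgl g w)
      obtain \<mu> xs where w: "w = (\<mu>, xs)" by (cases w)
      have "w \<in> words P V" using sgl(1) assms(1) by auto
      then have "sgl w \<in> W" "Q (sgl w)" using *[of "[]" "[]" xs \<mu>] by (simp_all add: w words_def)
      then show ?case using sgl(2) assms(3)[of "sgl w" g] wcarrier_add[of "sgl w" P V g] by blast
    qed
    then show ?thesis ..
  qed
qed

text \<open>A composition other than \<open>ds\<close> yields a word with a zero argument, which is
  a relation. This serves both the projections to a degree and the top Steenrod square.\<close>

lemma wcart_homog:
  assumes "\<mu> \<in> carrier (ops P (length xs))" "hlist xs ds"
    and "\<And>i x. x \<in> carrier V \<Longrightarrow> T i x \<in> carrier V"
    and "\<And>js. \<lbrakk>js \<in> comps (length xs) i; js \<noteq> ds\<rbrakk> \<Longrightarrow> \<exists>k<length xs. T (js ! k) (xs ! k) = \<zero>"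
  shows "eqm R (wcart T i (wd \<mu> xs)) (if sum_list ds = i then wd \<mu> (map2 T ds xs) else 0)"
proof -
  have "eqm R (wd \<mu> (map2 T js xs)) (if js = ds then wd \<mu> (map2 T ds xs) else 0)"
    if js: "js \<in> comps (length xs) i" for js
  proof (cases "js = ds")
    case False
    obtain k where "k < length xs" "T (js ! k) (xs ! k) = \<zero>" using assms(4)[OF js False] by blast
    then have "\<zero> \<in> set (map2 T js xs)" using js by (force simp: in_set_conv_nth)
    then have "wd \<mu> (map2 T js xs) \<in> R"
      using assms(1,3) js hlist_carrier[OF assms(2)] by (intro R_zero_arg) (auto dest!: set_zip_rightD)
    then show ?thesis using False by (simp add: eqm_def)
  qed simp
  then have "eqm R (wcart T i (wd \<mu> xs))
      (\<Sum>js\<in>comps (length xs) i. if js = ds then wd \<mu> (map2 T ds xs) else 0)"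
    unfolding wcart_word by (rule R_eqm_sum)
  moreover have "length ds = length xs" using assms(2) by (simp add: list_all2_lengthD)
  ultimately show ?thesis by (simp add: sum.delta' sum.delta finite_comps)
qed

text \<open>The projection to one degree as an instance of the Cartan formula. As taking components
  is additive, \<open>wcart_R\<close> shows at once that it passes to the free algebra.\<close>

abbreviation hproj :: "nat \<Rightarrow> (('p, 'a) word \<Rightarrow>\<^sub>0 bit) \<Rightarrow> ('p, 'a) word \<Rightarrow>\<^sub>0 bit"
  where "hproj \<equiv> wcart (\<lambda>j x. hcomp V x j)"

lemma hproj_homog:
  assumes "Poly_Mapping.keys f \<subseteq> homog_words P V d"
  shows "eqm R (hproj e f) (if e = d then f else 0)"
proof (induction rule: poly_bit_induct[where g = f and P = "\<lambda>f. eqm R (hproj e f) (if e = d then f else 0)"])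
  case (sgl g w)
  obtain \<mu> xs ds where w: "w = (\<mu>, xs)" "\<mu> \<in> carrier (ops P (length xs))" "hlist xs ds" "sum_list ds = d"
    using sgl(1) assms by (auto simp: homog_words_def)
  have xs: "k < length xs \<Longrightarrow> xs ! k \<in> hpart V (ds ! k)" "length ds = length xs" for k
    using w(3) by (auto simp: list_all2_conv_all_nth)
  have hc: "k < length xs \<Longrightarrow> hcomp V (xs ! k) j = (if j = ds ! k then xs ! k else \<zero>)" for k j
    using hcomp_hpart[OF xs(1)] by simp
  have "eqm R (hproj e (wd \<mu> xs)) (if sum_list ds = e then wd \<mu> (map2 (\<lambda>j x. hcomp V x j) ds xs) else 0)"
  proof (rule wcart_homog[OF w(2,3)])
    fix js assume js: "js \<in> comps (length xs) e" "js \<noteq> ds"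
    then have "\<exists>k<length xs. js ! k \<noteq> ds ! k" using xs(2) by (auto simp: list_eq_iff_nth_eq)
    then show "\<exists>k<length xs. hcomp V (xs ! k) (js ! k) = \<zero>" using hc by auto
  qed simp
  moreover have "map2 (\<lambda>j x. hcomp V x j) ds xs = xs"
    using xs(2) hc by (auto intro!: nth_equalityI)
  ultimately have "eqm R (hproj e (sgl w)) (if e = d then sgl w else 0)"
    using w by auto
  from R_eqm_add[OF this sgl(2)] show ?case by (simp add: wcart_add split: if_splits)
qed simp

lemma homog_decomposition:
  assumes "f \<in> W"
  shows "\<exists>D g. finite D \<and> (\<forall>d. Poly_Mapping.keys (g d) \<subseteq> homog_words P V d) \<and>
    (\<forall>d. d \<notin> D \<longrightarrow> g d = 0) \<and> eqm R f (\<Sum>d\<in>D. g d)"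
  using assms
proof (induction rule: homog_induct)
  case (rel r)
  then show ?case by (intro exI[of _ "{}"] exI[of _ "\<lambda>d. 0"]) (simp add: eqm_def)
next
  case (add f f')
  then obtain D g D' g' where
    g: "finite D" "\<forall>d. Poly_Mapping.keys (g d) \<subseteq> homog_words P V d" "\<forall>d. d \<notin> D \<longrightarrow> g d = 0" "eqm R f (\<Sum>d\<in>D. g d)" and
    g': "finite D'" "\<forall>d. Poly_Mapping.keys (g' d) \<subseteq> homog_words P V d" "\<forall>d. d \<notin> D' \<longrightarrow> g' d = 0" "eqm R f' (\<Sum>d\<in>D'. g' d)"
    by blast
  have "(\<Sum>d\<in>D. g d) = (\<Sum>d\<in>D \<union> D'. g d)" "(\<Sum>d\<in>D'. g' d) = (\<Sum>d\<in>D \<union> D'. g' d)"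
    using g g' by (auto intro!: sum.mono_neutral_left)
  then have "eqm R (f + f') (\<Sum>d\<in>D \<union> D'. g d + g' d)"
    using R_eqm_add[OF g(4) g'(4)] by (simp add: sum.distrib)
  then show ?case
    using g g' by (intro exI[of _ "D \<union> D'"] exI[of _ "\<lambda>d. g d + g' d"]) (simp add: keys_add_subset)
next
  case (word \<mu> xs ds)
  then have "(\<mu>, xs) \<in> homog_words P V (sum_list ds)" by (auto simp: homog_words_def)
  then show ?case
    by (intro exI[of _ "{sum_list ds}"] exI[of _ "\<lambda>d. if d = sum_list ds then wd \<mu> xs else 0"]) auto
qed

lemma S_hpart_carrier: "hpart S d \<subseteq> carrier S"
  using homog_words_subset unfolding S_hpart S_carrier by blast

text \<open>Applying \<open>hproj e\<close> to a decomposition kills every summand of a degree other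
  than \<open>e\<close>, so the components can be computed from \<open>f\<close> alone.\<close>

lemma S_decomp_unique:
  assumes f: "f \<in> W" and h: "homog_decomp S (cl f) h"
  shows "h e = cl (hproj e f)"
proof -
  let ?D = "{d. h d \<noteq> \<zero>\<^bsub>S\<^esub>}"
  have "\<forall>d. \<exists>g. Poly_Mapping.keys g \<subseteq> homog_words P V d \<and> h d = cl g"
    using h unfolding homog_decomp_def S_hpart by blast
  then obtain g where g: "\<And>d. Poly_Mapping.keys (g d) \<subseteq> homog_words P V d" "\<And>d. h d = cl (g d)"
    by metis
  have gW: "g d \<in> W" for d using g(1) homog_words_subset by blast
  have D: "finite ?D" using h by (simp add: homog_decomp_def)
  have "cl f = (\<Oplus>\<^bsub>S\<^esub>d\<in>?D. h d)" using h by (simp add: homog_decomp_def)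
  also have "\<dots> = cl (\<Sum>d\<in>?D. g d)" unfolding g(2) by (rule cl_sum(2)[OF gW])
  finally have "eqm R f (\<Sum>d\<in>?D. g d)" by (rule iffD1[OF cl_eq_iff[OF f cl_sum(1)[OF gW]]])
  then have "eqm R (hproj e f) (\<Sum>d\<in>?D. hproj e (g d))"
    unfolding wcart_sum[symmetric] by (intro wcart_eqm) (simp_all add: hcomp_add)
  also have "eqm R (\<Sum>d\<in>?D. hproj e (g d)) (\<Sum>d\<in>?D. if e = d then g d else 0)"
    by (rule R_eqm_sum) (rule hproj_homog[OF g(1)])
  also have "(\<Sum>d\<in>?D. if e = d then g d else 0) = (if e \<in> ?D then g e else 0)"
    using D by (simp add: sum.delta')
  finally have "cl (hproj e f) = cl (if e \<in> ?D then g e else 0)"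
    using gW wcart_closed[OF _ _ f, of "\<lambda>j x. hcomp V x j" e]
    by (subst cl_eq_iff) (simp_all add: hcomp_add)
  also have "\<dots> = h e" using g(2)[of e] by (auto simp: S_zero)
  finally show ?thesis ..
qed

lemma S_graded: "graded_space S"
proof (intro graded_space.intro graded_space_axioms.intro S_module)
  interpret S: f2_space S by (simp add: f2_space_def S_module)
  show "submodule (hpart S d) F2 S" for d
  proof (rule S.f2_submoduleI)
    show "hpart S d \<subseteq> carrier S" by (rule S_hpart_carrier)
    show "\<zero>\<^bsub>S\<^esub> \<in> hpart S d" unfolding S_zero S_hpart by auto
    fix T U assume "T \<in> hpart S d" "U \<in> hpart S d"
    then obtain f g where fg: "Poly_Mapping.keys f \<subseteq> homog_words P V d" "Poly_Mapping.keys g \<subseteq> homog_words P V d"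
      "T = cl f" "U = cl g" unfolding S_hpart by blast
    then have "T \<oplus>\<^bsub>S\<^esub> U = cl (f + g)"
      using homog_words_subset[of d] by (auto intro!: S_add)
    then show "T \<oplus>\<^bsub>S\<^esub> U \<in> hpart S d"
      using keys_add_subset[OF fg(1,2)] unfolding S_hpart by blast
  qed
  fix T assume "T \<in> carrier S"
  then obtain f where f: "f \<in> W" "T = cl f" unfolding S_carrier by blast
  obtain D g where D: "finite D" and g: "\<forall>d. Poly_Mapping.keys (g d) \<subseteq> homog_words P V d"
    "\<forall>d. d \<notin> D \<longrightarrow> g d = 0" "eqm R f (\<Sum>d\<in>D. g d)"
    using homog_decomposition[OF f(1)] by blast
  have gW: "g d \<in> W" for d using g(1) homog_words_subset by blast
  have "homog_decomp S T (\<lambda>d. cl (g d))"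
  proof (rule homog_decompI[OF S_module D])
    show "T = (\<Oplus>\<^bsub>S\<^esub>d\<in>D. cl (g d))"
      unfolding f(2) cl_sum(2)[OF gW] cl_eq_iff[OF f(1) cl_sum(1)[OF gW]] by (rule g(3))
    show "cl (g d) \<in> hpart S d" for d using g(1) unfolding S_hpart by blast
    show "cl (g d) = \<zero>\<^bsub>S\<^esub>" if "d \<notin> D" for d using g(2) that by (simp add: S_zero)
  qed (rule S_hpart_carrier)
  moreover have "h = h'" if "homog_decomp S T h" "homog_decomp S T h'" for h h'
    using S_decomp_unique[OF f(1)] that unfolding f(2) by (intro ext) metis
  ultimately show "\<exists>!h. homog_decomp S T h" by blast
qed

end


section \<open>Steenrod operations on the free algebra\<close>

context unstable_module
begin

abbreviation Q0 where "Q0 \<equiv> Sq0 M (Sq M)"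

lemma Sq_closed: "x \<in> carrier M \<Longrightarrow> Sq M i x \<in> carrier M"
  and Sq_add: "\<lbrakk>x \<in> carrier M; y \<in> carrier M\<rbrakk> \<Longrightarrow> Sq M i (x \<oplus> y) = Sq M i x \<oplus> Sq M i y"
  using linear_mapD[OF Sq_linear] by blast+

lemma Q0_closed: "x \<in> carrier M \<Longrightarrow> Q0 x \<in> carrier M"
  and Q0_add: "\<lbrakk>x \<in> carrier M; y \<in> carrier M\<rbrakk> \<Longrightarrow> Q0 (x \<oplus> y) = Q0 x \<oplus> Q0 y"
  and Q0_hpart: "x \<in> hpart M d \<Longrightarrow> Q0 x = Sq M d x"
  by (auto intro!: Sq0_closed Sq0_add Sq0_hpart Sq_closed Sq_add dest: hpart_carrier)

lemma Q0_zero [simp]: "Q0 \<zero> = \<zero>"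
  using Q0_add[of \<zero> \<zero>] Q0_closed[of \<zero>] by simp

lemma Sq_zero_arg [simp]: "Sq M i \<zero> = \<zero>"
  using Sq_add[of \<zero> \<zero> i] Sq_closed[of \<zero> i] by simp

text \<open>In the Adem relation for \<open>Sq\<^sup>i Sq\<^sup>d x\<close> with \<open>x\<close> of degree \<open>d\<close>, instability kills all summands but the
  one with \<open>2 c = i\<close>.\<close>

lemma Sq_Q0_hpart:
  assumes x: "x \<in> hpart M d"
  shows "Sq M i (Q0 x) = (if even i then Q0 (Sq M (i div 2) x) else \<zero>)"
proof -
  have xc: "x \<in> carrier M" using x by (rule hpart_carrier)
  have Q: "Q0 (Sq M c x) = Sq M (d + c) (Sq M c x)" for c
    by (rule Q0_hpart[OF Sq_degree[OF x]])
  \<comment> \<open>The Adem relation covers only \<open>0 < i < 2 * d\<close>. For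
    \<open>i = 2 * d\<close> both sides are \<open>Q0 (Q0 x)\<close>, and beyond that both vanish by
    instability.\<close>
  consider "i = 0" | "0 < i" "i < 2 * d" | "i = 2 * d" "0 < i" | "i > 2 * d" by linarith
  then show ?thesis
  proof cases
    case 1
    then show ?thesis using xc by (simp add: Sq_zero Q0_closed)
  next
    case 2
    have "Sq M i (Q0 x) = (\<Oplus>c\<in>{0..i div 2}.
          (of_nat ((d - c - 1) choose (i - 2 * c)) :: bit) \<odot> Sq M (i + d - c) (Sq M c x))"
      unfolding Q0_hpart[OF x] by (rule Adem[OF 2 xc])
    also have "\<dots> = (\<Oplus>c\<in>{0..i div 2}. if i div 2 = c then (if even i then Q0 (Sq M c x) else \<zero>) else \<zero>)"
    proof (rule finsum_cong')
      fix c assume c: "c \<in> {0..i div 2}"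
      show "(of_nat ((d - c - 1) choose (i - 2 * c)) :: bit) \<odot> Sq M (i + d - c) (Sq M c x) =
          (if i div 2 = c then (if even i then Q0 (Sq M c x) else \<zero>) else \<zero>)"
      proof (cases "2 * c = i")
        case True
        then have "i + d - c = d + c" by simp
        then show ?thesis using True xc Q[of c] by (auto simp: smult_bit Sq_closed)
      next
        case False
        then have "Sq M (i + d - c) (Sq M c x) = \<zero>"
          using c by (intro unstable[OF Sq_degree[OF x]]) auto
        moreover have "\<not> (i div 2 = c \<and> even i)" using False by auto
        ultimately show ?thesis by auto
      qed
    qed (auto simp: Q0_closed Sq_closed xc)
    also have "\<dots> = (if even i then Q0 (Sq M (i div 2) x) else \<zero>)"
      by (subst finsum_singleton) (auto simp: Q0_closed Sq_closed xc)
    finally show ?thesis .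
  next
    case 3
    then show ?thesis using Q[of d] by (simp add: Q0_hpart[OF x] mult_2)
  next
    case 4
    then have "Sq M i (Q0 x) = \<zero>"
      unfolding Q0_hpart[OF x] by (intro unstable[OF Sq_degree[OF x]]) simp
    moreover have "Sq M (i div 2) x = \<zero>" if "even i"
      using that 4 by (intro unstable[OF x]) auto
    ultimately show ?thesis by auto
  qed
qed

lemma Sq_Q0:
  assumes "x \<in> carrier M"
  shows "Sq M i (Q0 x) = (if even i then Q0 (Sq M (i div 2) x) else \<zero>)"
  using assms
  by (induction rule: graded_induct) (auto simp: Sq_Q0_hpart Q0_add Sq_add Q0_closed Sq_closed)

end

locale unstable_operad_space = graded_operad_space P M + unstable_module M
  for P :: "'p operad" and M :: "'a umod" (structure)
begin

lemma word_Sq_closed: "f \<in> W \<Longrightarrow> word_Sq M i f \<in> W"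
  and word_Sq_R: "r \<in> R \<Longrightarrow> word_Sq M i r \<in> R"
  unfolding word_Sq_eq
  by (rule wcart_closed wcart_R; simp add: Sq_closed Sq_add)+

lemma word_Sq_add: "word_Sq M i (f + g) = word_Sq M i f + word_Sq M i g"
  unfolding word_Sq_eq by (rule wcart_add)

lemma free_Sq_cl:
  assumes "f \<in> W"
  shows "free_Sq P M i (cl f) = cl (word_Sq M i f)"
  unfolding free_Sq_def quot_map_def cl_def
proof (rule word_alg.coset_union[OF R_submodule])
  show "f \<in> carrier (word_alg P M)" using assms by simp
  show "word_Sq M i g \<in> carrier (word_alg P M)" if "g \<in> carrier (word_alg P M)" for g
    using word_Sq_closed[of g i] that by simp
  show "word_Sq M i f \<oplus>\<^bsub>word_alg P M\<^esub> word_Sq M i g \<in> R" if "f \<oplus>\<^bsub>word_alg P M\<^esub> g \<in> R" for g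
    using word_Sq_R[of "f + g" i] that by (simp add: word_Sq_add)
qed

text \<open>\<open>Sq_0\<close> of the free algebra at the level of formal sums, as is shown in
  \<open>Sq0_S\<close>. In this form it is visibly an algebra map.\<close>

definition Z :: "(('p, 'a) word \<Rightarrow>\<^sub>0 bit) \<Rightarrow> ('p, 'a) word \<Rightarrow>\<^sub>0 bit"
  where "Z = ext P (\<lambda>x. eta P (Q0 x))"

lemma eta_add: "\<lbrakk>x \<in> carrier M; y \<in> carrier M\<rbrakk> \<Longrightarrow> eqm R (eta P (x \<oplus> y)) (eta P x + eta P y)"
  using R_arg_add[of "ounit P" "[]" "[]" x y] unit_closed by (simp add: eqm_def)

sublocale Z: generator_map P M M "\<lambda>x. eta P (Q0 x)"
proof unfold_locales
  show "eta P (Q0 x) \<in> W" if "x \<in> carrier M" for x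
    by (rule eta_in_wcarrier[OF Q0_closed[OF that]])
  show "eqm R (eta P (Q0 (x \<oplus> y))) (eta P (Q0 x) + eta P (Q0 y))"
    if "x \<in> carrier M" "y \<in> carrier M" for x y
    unfolding Q0_add[OF that] by (rule eta_add[OF Q0_closed[OF that(1)] Q0_closed[OF that(2)]])
qed

lemma Z_word:
  assumes "(\<mu>, xs) \<in> words P M"
  shows "Z (wd \<mu> xs) = wd \<mu> (map Q0 xs)"
proof -
  have "(\<mu>, map Q0 xs) \<in> words P M" using assms Q0_closed by (auto simp: words_def)
  from word_eq_wop[OF this] show ?thesis by (simp add: Z_def comp_def)
qed

text \<open>If no argument were killed, instability would give \<open>js ! k \<le> ds ! k\<close>
  for all \<open>k\<close>, and the equality of the sums would force \<open>js = ds\<close>.\<close>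

lemma Sq_top_degrees:
  assumes "hlist xs ds" "js \<in> comps (length xs) (sum_list ds)" "js \<noteq> ds"
  shows "\<exists>k<length xs. Sq M (js ! k) (xs ! k) = \<zero>"
proof (rule ccontr)
  assume none: "\<not> ?thesis"
  have xs: "k < length xs \<Longrightarrow> xs ! k \<in> hpart M (ds ! k)" "length ds = length xs" for k
    using assms(1) by (auto simp: list_all2_conv_all_nth)
  have le: "js ! k \<le> ds ! k" if "k < length xs" for k
    using none that unstable[OF xs(1)[OF that], of "js ! k"] by (meson not_le)
  have sums: "sum_list js = (\<Sum>k<length xs. js ! k)" "sum_list ds = (\<Sum>k<length xs. ds ! k)"
    using assms(2) xs(2) by (auto simp: sum_list_sum_nth atLeast0LessThan)
  have "\<not> (\<exists>k<length xs. js ! k < ds ! k)"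
    using sum_strict_mono_ex1[of "{..<length xs}" "(!) js" "(!) ds"] le sums assms(2) by auto
  then have "js = ds" using le xs(2) assms(2) by (auto intro!: nth_equalityI) (metis le_neq_implies_less)
  then show False using assms(3) by simp
qed

text \<open>Both sides are additive and vanish on relations, so words with homogeneous arguments
  suffice. There the Cartan formula in the total degree retains only the term with the top square on
  each argument.\<close>

lemma Sq0_S:
  assumes "f \<in> W"
  shows "Sq0 S (free_Sq P M) (cl f) = cl (Z f)"
proof -
  interpret S: graded_space S by (rule S_graded)
  have hpart_cl: "\<exists>f\<in>W. T = cl f" if "T \<in> hpart S d" for T d
    using that S_hpart_carrier unfolding S_carrier by blast
  have closed: "free_Sq P M d T \<in> carrier S" if "T \<in> hpart S d" for d T
    using hpart_cl[OF that] free_Sq_cl word_Sq_closed cl_in_S by fastforce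
  have add: "free_Sq P M d (T \<oplus>\<^bsub>S\<^esub> U) = free_Sq P M d T \<oplus>\<^bsub>S\<^esub> free_Sq P M d U"
    if T: "T \<in> hpart S d" and U: "U \<in> hpart S d" for d T U
  proof -
    obtain f g where fg: "f \<in> W" "g \<in> W" "T = cl f" "U = cl g"
      using hpart_cl[OF T] hpart_cl[OF U] by blast
    then show ?thesis
      using free_Sq_cl[OF wcarrier_add[OF fg(1,2)]] word_Sq_closed S_add
      by (simp add: free_Sq_cl word_Sq_add)
  qed
  have Sq0_S_add: "Sq0 S (free_Sq P M) (T \<oplus>\<^bsub>S\<^esub> U) = Sq0 S (free_Sq P M) T \<oplus>\<^bsub>S\<^esub> Sq0 S (free_Sq P M) U"
    if "T \<in> carrier S" "U \<in> carrier S" for T U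
    by (rule S.Sq0_add[OF closed add that])
  have Sq0_S_hpart: "Sq0 S (free_Sq P M) T = free_Sq P M d T" if "T \<in> hpart S d" for T d
    by (rule S.Sq0_hpart[OF closed add that])
  have Sq0_S_closed: "Sq0 S (free_Sq P M) T \<in> carrier S" if "T \<in> carrier S" for T
    by (rule S.Sq0_closed[OF closed add that])
  show ?thesis using assms
  proof (induction rule: homog_induct)
    case (rel r)
    have "Sq0 S (free_Sq P M) (cl 0) = \<zero>\<^bsub>S\<^esub>"
      using Sq0_S_add[of "cl 0" "cl 0"] Sq0_S_closed[of "cl 0"] cl_in_S[of 0] S_add[of 0 0] by simp
    moreover have "cl r = cl 0" using rel R_subset by (subst cl_eq_iff) (auto simp: eqm_def)
    moreover have "cl (Z r) = cl 0"
      using rel Z.E_R Z.E_closed R_subset unfolding Z_def by (subst cl_eq_iff) (auto simp: eqm_def)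
    ultimately show ?case by (simp add: S_zero)
  next
    case (add f g)
    then have "Sq0 S (free_Sq P M) (cl (f + g)) = cl (Z f) \<oplus>\<^bsub>S\<^esub> cl (Z g)"
      using Sq0_S_add[OF cl_in_S cl_in_S] S_add by simp
    also have "\<dots> = cl (Z (f + g))"
      using add Z.E_closed unfolding Z_def by (simp add: S_add ext_add)
    finally show ?case .
  next
    case (word \<mu> xs ds)
    let ?d = "sum_list ds"
    have w: "(\<mu>, xs) \<in> homog_words P M ?d" "(\<mu>, xs) \<in> words P M"
      using word hlist_carrier[OF word(2)] by (auto simp: homog_words_def words_def)
    have ds: "map2 (Sq M) ds xs = map Q0 xs"
      using word(2) Q0_hpart by (auto simp: list_all2_conv_all_nth intro!: nth_equalityI)
    have "cl (wd \<mu> xs) \<in> hpart S ?d" using w unfolding S_hpart by auto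
    then have "Sq0 S (free_Sq P M) (cl (wd \<mu> xs)) = cl (word_Sq M ?d (wd \<mu> xs))"
      using w by (simp add: Sq0_S_hpart free_Sq_cl)
    also have "\<dots> = cl (wd \<mu> (map2 (Sq M) ds xs))"
    proof (subst cl_eq_iff)
      show "word_Sq M ?d (wd \<mu> xs) \<in> W" using w by (intro word_Sq_closed) simp
      show "wd \<mu> (map2 (Sq M) ds xs) \<in> W"
        unfolding ds using w(2) Q0_closed by (auto simp: words_def)
      show "eqm R (word_Sq M ?d (wd \<mu> xs)) (wd \<mu> (map2 (Sq M) ds xs))"
        using wcart_homog[OF word(1,2), of "Sq M" ?d] Sq_top_degrees[OF word(2)]
        unfolding word_Sq_eq by (simp add: Sq_closed)
    qed
    also have "wd \<mu> (map2 (Sq M) ds xs) = Z (wd \<mu> xs)" using w(2) by (simp add: ds Z_word)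
    finally show ?case .
  qed
qed

text \<open>By \<open>Sq_Q0\<close> a composition with an odd entry produces a zero argument, and
  the compositions with even entries are the doubles of those of \<open>i div 2\<close>; for odd
  \<open>i\<close> there are none.\<close>

lemma word_Sq_Z:
  assumes "f \<in> W"
  shows "eqm R (word_Sq M i (Z f)) (if even i then Z (word_Sq M (i div 2) f) else 0)"
proof (induction rule: poly_bit_induct[where g = f
      and P = "\<lambda>f. eqm R (word_Sq M i (Z f)) (if even i then Z (word_Sq M (i div 2) f) else 0)"])
  case zero
  then show ?case by (simp add: Z_def word_Sq_eq)
next
  case (sgl g w)
  have w: "w \<in> words P M" using sgl(1) assms by auto
  obtain \<mu> xs where w_eq [simp]: "w = (\<mu>, xs)" by (cases w)
  have \<mu>: "\<mu> \<in> carrier (ops P (length xs))" and xs: "set xs \<subseteq> carrier M"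
    using w by (simp_all add: words_def)
  let ?n = "length xs"
  let ?A = "{js \<in> comps ?n i. \<forall>j\<in>set js. even j}"
  have "word_Sq M i (Z (wd \<mu> xs)) = (\<Sum>js\<in>comps ?n i. wd \<mu> (map2 (Sq M) js (map Q0 xs)))"
    using w by (simp add: Z_word word_Sq_eq wcart_word)
  also have "\<dots> = (\<Sum>js\<in>?A. wd \<mu> (map2 (Sq M) js (map Q0 xs))) +
      (\<Sum>js\<in>comps ?n i - ?A. wd \<mu> (map2 (Sq M) js (map Q0 xs)))" (is "_ = ?even + ?odd")
    by (subst add.commute, rule sum.subset_diff) (auto simp: finite_comps)
  finally have split: "word_Sq M i (Z (wd \<mu> xs)) = ?even + ?odd" .
  have "wd \<mu> (map2 (Sq M) js (map Q0 xs)) \<in> R" if js: "js \<in> comps ?n i - ?A" for js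
  proof -
    obtain k where k: "k < ?n" "odd (js ! k)" using js by (auto simp: in_set_conv_nth)
    then have "Sq M (js ! k) (Q0 (xs ! k)) = \<zero>"
      using xs nth_mem[of k xs] by (subst Sq_Q0) auto
    then have "\<zero> \<in> set (map2 (Sq M) js (map Q0 xs))"
      using k js by (force simp: in_set_conv_nth)
    moreover have "set (map2 (Sq M) js (map Q0 xs)) \<subseteq> carrier M"
      using xs Q0_closed by (intro map2_T_closed[of "Sq M"]) (auto simp: Sq_closed Sq_add)
    ultimately show ?thesis using \<mu> js by (intro R_zero_arg) auto
  qed
  then have odd: "eqm R ?odd 0"
    using R_sum[of "comps ?n i - ?A"] by (simp add: eqm_def)
  have even: "?even = (if even i then Z (word_Sq M (i div 2) (wd \<mu> xs)) else 0)"
  proof (cases "even i")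
    case True
    have "?even = (\<Sum>ks\<in>comps ?n (i div 2). wd \<mu> (map Q0 (map2 (Sq M) ks xs)))"
    proof (rule sum.reindex_bij_witness[where i = "map ((*) 2)" and j = "map (\<lambda>j. j div 2)"])
      fix js assume js: "js \<in> ?A"
      show eq: "map ((*) 2) (map (\<lambda>j. j div 2) js) = js"
        using js by (auto intro!: map_idI)
      have "2 * sum_list (map (\<lambda>j. j div 2) js) = sum_list js"
        by (subst (2) eq[symmetric]) (simp add: sum_list_const_mult comp_def)
      then show "map (\<lambda>j. j div 2) js \<in> comps ?n (i div 2)" using js by auto
      have "map2 (Sq M) js (map Q0 xs) = map Q0 (map2 (Sq M) (map (\<lambda>j. j div 2) js) xs)"
        using js by (auto simp: Sq_Q0[OF subsetD[OF xs nth_mem]] intro!: nth_equalityI)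
      then show "wd \<mu> (map Q0 (map2 (Sq M) (map (\<lambda>j. j div 2) js) xs)) = wd \<mu> (map2 (Sq M) js (map Q0 xs))"
        by simp
    next
      fix ks assume ks: "ks \<in> comps ?n (i div 2)"
      show "map (\<lambda>j. j div 2) (map ((*) 2) ks) = ks" by (auto intro!: map_idI)
      show "map ((*) 2) ks \<in> ?A" using ks True by (auto simp: sum_list_const_mult)
    qed
    also have "\<dots> = (\<Sum>ks\<in>comps ?n (i div 2). Z (wd \<mu> (map2 (Sq M) ks xs)))"
    proof (rule sum.cong[OF refl])
      fix ks assume "ks \<in> comps ?n (i div 2)"
      then have "(\<mu>, map2 (Sq M) ks xs) \<in> words P M"
        using \<mu> map2_T_closed[of "Sq M" xs ks] xs by (auto simp: words_def Sq_closed Sq_add)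
      then show "wd \<mu> (map Q0 (map2 (Sq M) ks xs)) = Z (wd \<mu> (map2 (Sq M) ks xs))"
        by (simp add: Z_word)
    qed
    also have "\<dots> = Z (word_Sq M (i div 2) (wd \<mu> xs))"
      by (simp add: Z_def ext_sum word_Sq_eq wcart_word)
    finally show ?thesis using True by simp
  next
    case False
    have empty: "?A = {}"
    proof -
      have "even (sum_list js)" if "\<forall>j\<in>set js. even j" for js :: "nat list"
        using that by (induction js) auto
      then show ?thesis using False by blast
    qed
    show ?thesis unfolding empty using False by simp
  qed
  have "eqm R (word_Sq M i (Z (wd \<mu> xs))) ?even"
    unfolding split using R_eqm_add[OF R_refl odd, of ?even] by simp
  then have "eqm R (word_Sq M i (Z (sgl w))) (if even i then Z (word_Sq M (i div 2) (sgl w)) else 0)"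
    unfolding even w_eq .
  from R_eqm_add[OF this sgl(2)] show ?case
    by (simp add: Z_def ext_add word_Sq_add split: if_splits)
qed

end


section \<open>The Frobenius map of a central operation\<close>

lemma nth_concat_pairs: "j < 2 * length xs \<Longrightarrow> concat (map (\<lambda>x. [x, x]) xs) ! j = xs ! (j div 2)"
proof (induction xs arbitrary: j)
  case (Cons x xs)
  consider "j = 0" | "j = 1" | k where "j = Suc (Suc k)"
    by (metis One_nat_def not0_implies_Suc)
  then show ?case using Cons by cases auto
qed simp

lemma unshuffle_permutes: "unshuffle n permutes {..<2 * n}"
proof (rule bij_imp_permutes)
  show "bij_betw (unshuffle n) {..<2 * n} {..<2 * n}"
    by (rule bij_betw_byWitness[where f' = "\<lambda>k. if k < n then 2 * k else 2 * (k - n) + 1"])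
      (auto simp: unshuffle_def elim!: oddE)
qed (simp add: unshuffle_def)

text \<open>Under the convention chosen for permutations, the unshuffle of two copies of a list puts
  equal entries side by side, ready to be fed to copies of \<open>\<star>\<close>.\<close>

lemma permute_list_unshuffle:
  "permute_list (unshuffle (length xs)) (xs @ xs) = concat (map (\<lambda>x. [x, x]) xs)"
proof (rule nth_equalityI)
  have len: "length (concat (map (\<lambda>x. [x, x]) xs)) = 2 * length xs" by (induction xs) auto
  then show "length (permute_list (unshuffle (length xs)) (xs @ xs)) = length (concat (map (\<lambda>x. [x, x]) xs))"
    by simp
  fix j assume "j < length (permute_list (unshuffle (length xs)) (xs @ xs))"
  then have j: "j < 2 * length xs" by simp
  then have "permute_list (unshuffle (length xs)) (xs @ xs) ! j = (xs @ xs) ! unshuffle (length xs) j"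
    using unshuffle_permutes[of "length xs"] by (subst permute_list_nth) (auto simp: mult_2)
  also have "\<dots> = xs ! (j div 2)" using j by (auto simp: unshuffle_def nth_append)
  finally show "permute_list (unshuffle (length xs)) (xs @ xs) ! j = concat (map (\<lambda>x. [x, x]) xs) ! j"
    using nth_concat_pairs[OF j] by simp
qed

locale star_operad_space = operad_space P V
  for P :: "'p operad" and V :: "('a, 'c) gvs_scheme" (structure) +
  fixes star :: 'p
  assumes star_invariant: "star \<in> invariant_ops P 2"
    and star_central: "central_op P star"
begin

lemma star_ops: "star \<in> carrier (ops P 2)"
  using star_invariant by (simp add: invariant_ops_def)

definition frob :: "(('p, 'a) word \<Rightarrow>\<^sub>0 bit) \<Rightarrow> ('p, 'a) word \<Rightarrow>\<^sub>0 bit"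
  where "frob f = wop P star [f, f]"

lemma wop_star_closed: "\<lbrakk>f \<in> W; g \<in> W\<rbrakk> \<Longrightarrow> wop P star [f, g] \<in> W"
  by (rule wop_closed) (simp_all add: star_ops numeral_2_eq_2[symmetric])

lemma frob_closed: "f \<in> W \<Longrightarrow> frob f \<in> W"
  unfolding frob_def by (rule wop_star_closed)

lemma wop_star_commute:
  assumes "f \<in> W" "g \<in> W"
  shows "eqm R (wop P star [f, g]) (wop P star [g, f])"
proof -
  have t: "transpose 0 1 permutes {..<2::nat}" by (rule permutes_swap_id) auto
  then have "osym P 2 star (transpose 0 1) = star"
    using star_invariant by (simp add: invariant_ops_def)
  moreover have "permute_list (transpose 0 1) [f, g] = [g, f]"
    by (simp add: permute_list_def)
  ultimately show ?thesis
    using wop_sym[of star "[f, g]" "transpose 0 1"] t star_ops assms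
    by (simp add: numeral_2_eq_2)
qed

lemma frob_zero [simp]: "frob 0 = 0"
  by (simp add: frob_def wop_def)

text \<open>The two mixed terms agree modulo relations by the symmetry of \<open>\<star>\<close>, so
  their sum is a relation.\<close>

lemma frob_add:
  assumes "f \<in> W" "g \<in> W"
  shows "eqm R (frob (f + g)) (frob f + frob g)"
proof -
  have "frob (f + g) = frob f + frob g + (wop P star [f, g] + wop P star [g, f])"
    by (simp add: frob_def wop_def pbind_add pbind_add_fun algebra_simps)
  then show ?thesis
    using wop_star_commute[OF assms] by (simp add: eqm_def algebra_simps)
qed

lemma frob_eqm:
  assumes "op_ideal J" "eqm J f g" "f \<in> W" "g \<in> W"
  shows "eqm J (frob f) (frob g)"
  unfolding frob_def
  by (rule eqm_wop[OF assms(1)]) (simp_all add: assms(2-)[simplified] star_ops numeral_2_eq_2[symmetric])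

lemma frob_R: "r \<in> R \<Longrightarrow> frob r \<in> R"
  using frob_eqm[OF op_ideal_R, of r 0] R_subset by (auto simp: eqm_def)

lemma frob_sum:
  assumes "\<And>i. i \<in> I \<Longrightarrow> f i \<in> W"
  shows "eqm R (frob (\<Sum>i\<in>I. f i)) (\<Sum>i\<in>I. frob (f i))"
  using assms
proof (induction I rule: infinite_finite_induct)
  case (insert i I)
  have "(\<Sum>i\<in>I. f i) \<in> W" using insert by (intro cl_sum(1)) blast
  then have "eqm R (frob (f i + (\<Sum>i\<in>I. f i))) (frob (f i) + frob (\<Sum>i\<in>I. f i))"
    using insert by (intro frob_add) blast+
  also have "eqm R (frob (f i) + frob (\<Sum>i\<in>I. f i)) (frob (f i) + (\<Sum>i\<in>I. frob (f i)))"
    using insert by (intro R_eqm_add R_refl) blast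
  finally show ?case using insert by simp
qed simp_all

text \<open>This is where centrality enters: it turns \<open>\<star>(\<mu>, \<mu>)\<close> into
  \<open>\<mu>(\<star>, ..., \<star>)\<close> with unshuffled inputs, and the unshuffle of
  \<open>fs @ fs\<close> pairs each argument with itself. Together with \<open>frob_add\<close> it
  makes \<open>frob\<close> an algebra endomorphism modulo relations.\<close>

lemma frob_wop:
  assumes \<mu>: "\<mu> \<in> carrier (ops P (length fs))" and fs: "set fs \<subseteq> W"
  shows "eqm R (frob (wop P \<mu> fs)) (wop P \<mu> (map frob fs))"
proof -
  let ?n = "length fs"
  let ?\<nu> = "ocomp P \<mu> (replicate ?n (2, star))"
  have "frob (wop P \<mu> fs) = wop P (ocomp P star [(?n, \<mu>), (?n, \<mu>)]) (fs @ fs)"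
    using wop_assoc[of star "[(\<mu>, fs), (\<mu>, fs)]" V] star_ops \<mu> fs
    by (auto simp: frob_def numeral_2_eq_2)
  also have "ocomp P star [(?n, \<mu>), (?n, \<mu>)] = osym P (length (fs @ fs)) ?\<nu> (unshuffle ?n)"
    using star_central \<mu> by (simp add: central_op_def mult_2)
  also have "eqm R (wop P (osym P (length (fs @ fs)) ?\<nu> (unshuffle ?n)) (fs @ fs))
      (wop P ?\<nu> (permute_list (unshuffle ?n) (fs @ fs)))"
  proof (rule wop_sym)
    have "arity (replicate k (2, star)) = k + k" for k by (induction k) auto
    then show "?\<nu> \<in> carrier (ops P (length (fs @ fs)))"
      using ocomp_closed[of "replicate ?n (2, star)" \<mu>] \<mu> star_ops by (auto simp: inputs_def)
    show "unshuffle ?n permutes {..<length (fs @ fs)}"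
      using unshuffle_permutes[of ?n] by (simp add: mult_2)
    show "set (fs @ fs) \<subseteq> W" using fs by simp
  qed
  also have "wop P ?\<nu> (permute_list (unshuffle ?n) (fs @ fs)) = wop P \<mu> (map frob fs)"
  proof -
    have zs: "sig (map (\<lambda>f. (star, [f, f])) fs) = replicate ?n (2, star)"
      by (simp add: comp_def map_replicate_const numeral_2_eq_2)
    have "wop P \<mu> (map (\<lambda>(\<nu>, gs). wop P \<nu> gs) (map (\<lambda>f. (star, [f, f])) fs)) =
        wop P (ocomp P \<mu> (sig (map (\<lambda>f. (star, [f, f])) fs))) (concat (map snd (map (\<lambda>f. (star, [f, f])) fs)))"
    proof (rule wop_assoc)
      fix \<nu> gs assume "(\<nu>, gs) \<in> set (map (\<lambda>f. (star, [f, f])) fs)"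
      then obtain f where "f \<in> set fs" "\<nu> = star" "gs = [f, f]" by auto
      then show "\<nu> \<in> carrier (ops P (length gs)) \<and> set gs \<subseteq> W"
        using fs star_ops by (auto simp: numeral_2_eq_2)
    qed (use \<mu> in simp)
    then show ?thesis
      unfolding zs permute_list_unshuffle by (simp add: comp_def frob_def[abs_def])
  qed
  finally show ?thesis .
qed

lemma frob_ext:
  assumes f: "f \<in> wcarrier P U" and F: "\<And>x. x \<in> carrier U \<Longrightarrow> F x \<in> W"
  shows "eqm R (frob (ext P F f)) (ext P (\<lambda>x. frob (F x)) f)"
proof -
  have w: "wop P \<mu> (map F xs) \<in> W \<and> eqm R (frob (wop P \<mu> (map F xs))) (wop P \<mu> (map (\<lambda>x. frob (F x)) xs))"
    if "(\<mu>, xs) \<in> Poly_Mapping.keys f" for \<mu> xs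
  proof -
    have \<mu>: "\<mu> \<in> carrier (ops P (length (map F xs)))" "set xs \<subseteq> carrier U"
      using that f by (auto simp: words_def)
    have "set (map F xs) \<subseteq> W" unfolding set_map using F \<mu>(2) by blast
    from wop_closed[OF \<mu>(1) this] frob_wop[OF \<mu>(1) this] show ?thesis by (simp add: comp_def)
  qed
  have "eqm R (frob (ext P F f)) (\<Sum>w\<in>Poly_Mapping.keys f. frob (case w of (\<mu>, xs) \<Rightarrow> wop P \<mu> (map F xs)))"
    unfolding ext_def pbind_def using w by (intro frob_sum) (simp only: split_beta prod.collapse)
  also have "eqm R \<dots> (ext P (\<lambda>x. frob (F x)) f)"
    unfolding ext_def pbind_def using w by (intro R_eqm_sum) (simp only: split_beta prod.collapse)
  finally show ?thesis .
qed

end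


section \<open>Steenrod operations and the Frobenius map\<close>

text \<open>The terms at \<open>j\<close> and \<open>i - j\<close> cancel in characteristic 2; what
  is left is the fixed point of the reflection, if there is one.\<close>

lemma (in operad_space) symmetric_sum:
  fixes i :: nat
  assumes "\<And>j. j \<le> i \<Longrightarrow> eqm R (H j) (H (i - j))"
  shows "eqm R (\<Sum>j\<le>i. H j) (if even i then H (i div 2) else 0)"
proof -
  let ?A = "{j. 2 * j < i}" and ?B = "{j. j \<le> i \<and> i < 2 * j}" and ?C = "{j. 2 * j = i}"
  have fin: "finite ?A" "finite ?B" "finite ?C"
    by (rule finite_subset[of _ "{..i}"]; auto)+
  have "{..i} = (?A \<union> ?B) \<union> ?C" by auto
  then have "(\<Sum>j\<le>i. H j) = (\<Sum>j\<in>?A \<union> ?B. H j) + (\<Sum>j\<in>?C. H j)"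
    using fin by (simp only:) (rule sum.union_disjoint; auto)
  also have "(\<Sum>j\<in>?A \<union> ?B. H j) = (\<Sum>j\<in>?A. H j) + (\<Sum>j\<in>?B. H j)"
    using fin by (intro sum.union_disjoint) auto
  also have "(\<Sum>j\<in>?B. H j) = (\<Sum>j\<in>?A. H (i - j))"
    by (rule sum.reindex_bij_witness[where i = "\<lambda>j. i - j" and j = "\<lambda>j. i - j"]) auto
  also have "(\<Sum>j\<in>?A. H j) + (\<Sum>j\<in>?A. H (i - j)) = (\<Sum>j\<in>?A. H j + H (i - j))"
    by (simp add: sum.distrib)
  also have "(\<Sum>j\<in>?C. H j) = (if even i then H (i div 2) else 0)"
  proof (cases "even i")
    case True
    then have "?C = {i div 2}" by auto
    then show ?thesis using True by simp
  next
    case False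
    then have C: "?C = {}" by auto
    show ?thesis unfolding C using False by simp
  qed
  finally have eq: "(\<Sum>j\<le>i. H j) = (\<Sum>j\<in>?A. H j + H (i - j)) + (if even i then H (i div 2) else 0)" .
  have "eqm R (\<Sum>j\<in>?A. H j + H (i - j)) (\<Sum>j\<in>?A. 0)"
    using assms by (intro R_eqm_sum) (auto simp: eqm_def)
  from R_eqm_add[OF this R_refl, of "if even i then H (i div 2) else 0"]
  show ?thesis unfolding eq by simp
qed

locale unstable_star_space = unstable_operad_space P M + star_operad_space P M star
  for P :: "'p operad" and M :: "'a umod" (structure) and star :: 'p
begin

text \<open>The Cartan terms of \<open>\<star>(f, f)\<close> for \<open>(j, i - j)\<close> and
  \<open>(i - j, j)\<close> agree modulo relations because \<open>\<star>\<close> is symmetric, so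
  only the diagonal term survives.\<close>

lemma word_Sq_frob:
  assumes "f \<in> W"
  shows "eqm R (word_Sq M i (frob f)) (if even i then frob (word_Sq M (i div 2) f) else 0)"
proof -
  define H where "H j = wop P star [word_Sq M j f, word_Sq M (i - j) f]" for j
  have "word_Sq M i (frob f) = (\<Sum>is\<in>comps (Suc 1) i. wop P star (map2 (word_Sq M) is [f, f]))"
    unfolding frob_def word_Sq_eq[abs_def] wcart_wop by simp
  also have "\<dots> = (\<Sum>j\<le>i. H j)"
    unfolding sum_comps_Suc sum_comps_1 by (simp add: H_def)
  finally have "word_Sq M i (frob f) = (\<Sum>j\<le>i. H j)" .
  moreover have "eqm R (\<Sum>j\<le>i. H j) (if even i then H (i div 2) else 0)"
    using wop_star_commute[OF word_Sq_closed word_Sq_closed] assms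
    by (intro symmetric_sum) (simp add: H_def)
  moreover have "even i \<Longrightarrow> i - i div 2 = i div 2" by auto
  ultimately show ?thesis by (cases "even i") (simp_all add: H_def frob_def)
qed

lemma word_Sq_gen:
  assumes "f \<in> W"
  shows "eqm R (word_Sq M i (Z f + frob f))
    (if even i then Z (word_Sq M (i div 2) f) + frob (word_Sq M (i div 2) f) else 0)"
  using R_eqm_add[OF word_Sq_Z[OF assms] word_Sq_frob[OF assms], of i i]
  by (simp add: word_Sq_add split: if_splits)

end


section \<open>A graded retraction of the top Steenrod square\<close>

text \<open>By Zorn's lemma there is a maximal submodule of \<open>B\<close> that meets
  \<open>D\<close> trivially. An \<open>x\<close> in \<open>B\<close> outside its sum with
  \<open>D\<close> could be adjoined to it, against maximality.\<close>

lemma (in f2_space) exists_complement: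
  assumes B: "submodule B F2 V" and D: "submodule D F2 V" "D \<subseteq> B"
  shows "\<exists>C. submodule C F2 V \<and> C \<inter> D = {\<zero>} \<and> (\<forall>x\<in>B. \<exists>d\<in>D. x \<oplus> d \<in> C)"
proof -
  let ?A = "{C. submodule C F2 V \<and> C \<subseteq> B \<and> C \<inter> D = {\<zero>}}"
  have "{\<zero>} \<in> ?A"
    using submoduleD[OF B] submoduleD[OF D(1)] by (auto intro!: f2_submoduleI)
  then have "?A \<noteq> {}" by blast
  then have "\<exists>C\<in>?A. \<forall>N\<in>?A. C \<subseteq> N \<longrightarrow> N = C"
  proof (rule subset_Zorn_nonempty)
    fix Ch assume Ch: "Ch \<noteq> {}" "subset.chain ?A Ch"
    have sub: "N \<in> ?A" if "N \<in> Ch" for N using Ch(2) that by (auto simp: subset_chain_def)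
    have "submodule (\<Union>Ch) F2 V"
    proof (rule f2_submoduleI)
      show "\<Union>Ch \<subseteq> carrier V" using sub submoduleD(1) by blast
      show "\<zero> \<in> \<Union>Ch" using Ch(1) sub submoduleD(2) by blast
      fix x y assume "x \<in> \<Union>Ch" "y \<in> \<Union>Ch"
      then obtain N Y where "N \<in> Ch" "Y \<in> Ch" "x \<in> N" "y \<in> Y" by blast
      moreover have "N \<subseteq> Y \<or> Y \<subseteq> N" using Ch(2) calculation by (auto simp: subset_chain_def)
      ultimately obtain U where "U \<in> Ch" "x \<in> U" "y \<in> U" by blast
      then show "x \<oplus> y \<in> \<Union>Ch" using sub submoduleD(3) by blast
    qed
    then show "\<Union>Ch \<in> ?A" using sub Ch(1) by blast
  qed
  then obtain C where C: "submodule C F2 V" "C \<subseteq> B" "C \<inter> D = {\<zero>}"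
    and max: "\<forall>N\<in>?A. C \<subseteq> N \<longrightarrow> N = C"
    by auto
  have "\<exists>d\<in>D. x \<oplus> d \<in> C" if x: "x \<in> B" for x
  proof (rule ccontr)
    assume none: "\<not> (\<exists>d\<in>D. x \<oplus> d \<in> C)"
    note Cd = submoduleD[OF C(1)] and Bd = submoduleD[OF B] and Dd = submoduleD[OF D(1)]
    have xc: "x \<in> carrier V" using x Bd(1) by blast
    \<comment> \<open>Over the field with two elements the span of \<open>C\<close> and
      \<open>x\<close> consists of \<open>C\<close> and its translate by \<open>x\<close>.\<close>
    let ?C = "C \<union> (\<lambda>c. c \<oplus> x) ` C"
    have "submodule ?C F2 V"
    proof (rule f2_submoduleI)
      show "?C \<subseteq> carrier V" using Cd(1) xc by auto
      show "\<zero> \<in> ?C" using Cd(2) by blast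
      fix y z assume "y \<in> ?C" "z \<in> ?C"
      moreover have "c \<oplus> x \<oplus> d = (c \<oplus> d) \<oplus> x" "c \<oplus> (d \<oplus> x) = (c \<oplus> d) \<oplus> x" "c \<oplus> x \<oplus> (d \<oplus> x) = c \<oplus> d"
        if "c \<in> carrier V" "d \<in> carrier V" for c d
        using that xc by (simp_all add: a_ac)
      ultimately show "y \<oplus> z \<in> ?C" using Cd(1,3) by (elim UnE imageE) auto
    qed
    moreover have "?C \<subseteq> B" using C(2) Bd(3) x by blast
    moreover have "?C \<inter> D = {\<zero>}"
    proof -
      have "c \<oplus> x \<notin> D" if "c \<in> C" for c
      proof
        assume "c \<oplus> x \<in> D"
        moreover have "x \<oplus> (c \<oplus> x) = c" using that Cd(1) xc by (simp add: a_lcomm)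
        ultimately show False using none that by metis
      qed
      then show ?thesis using C(3) by blast
    qed
    ultimately have "?C = C" by (intro max[rule_format]) auto
    moreover have "\<zero> \<oplus> x \<in> ?C" using Cd(2) by blast
    ultimately have "x \<oplus> \<zero> \<in> C" using xc by simp
    then show False using none Dd(2) by blast
  qed
  then show ?thesis using C by blast
qed

text \<open>In each degree \<open>2 * e\<close> a complement of the image of
  \<open>hpart M e\<close> under \<open>Q0\<close> is chosen; \<open>\<delta>\<close> projects to
  this image along the complement and then inverts \<open>Q0\<close>. Choosing degree by degree
  makes \<open>\<delta>\<close> homogeneous, halving degrees.\<close>

lemma (in unstable_module) exists_retraction:
  assumes "reduced M"
  shows "\<exists>\<delta>. (\<forall>x\<in>carrier M. \<delta> x \<in> carrier M) \<and>
    (\<forall>x\<in>carrier M. \<forall>y\<in>carrier M. \<delta> (x \<oplus> y) = \<delta> x \<oplus> \<delta> y) \<and>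
    (\<forall>x\<in>carrier M. \<delta> (Q0 x) = x) \<and>
    (\<forall>d. \<forall>x\<in>hpart M d. if even d then \<delta> x \<in> hpart M (d div 2) else \<delta> x = \<zero>)"
proof -
  have inj: "x = y" if "Q0 x = Q0 y" "x \<in> carrier M" "y \<in> carrier M" for x y
    using assms that by (auto simp: reduced_def inj_on_def)
  have Q0_double: "Q0 x \<in> hpart M (2 * e)" if "x \<in> hpart M e" for x e
    using Sq_degree[OF that, of e] Q0_hpart[OF that] by (simp add: mult_2)
  have "\<exists>C. submodule C F2 M \<and> C \<inter> Q0 ` hpart M e = {\<zero>} \<and>
      (\<forall>x\<in>hpart M (2 * e). \<exists>d\<in>Q0 ` hpart M e. x \<oplus> d \<in> C)" for e
  proof (rule exists_complement[OF hpart_submodule])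
    show "submodule (Q0 ` hpart M e) F2 M"
    proof (rule f2_submoduleI)
      show "Q0 ` hpart M e \<subseteq> carrier M" using Q0_closed hpart_carrier by blast
      show "\<zero> \<in> Q0 ` hpart M e" using hpart_zero[of e] Q0_zero by (metis imageI)
      fix x y assume "x \<in> Q0 ` hpart M e" "y \<in> Q0 ` hpart M e"
      then obtain u v where uv: "u \<in> hpart M e" "v \<in> hpart M e" "x = Q0 u" "y = Q0 v" by blast
      then have "x \<oplus> y = Q0 (u \<oplus> v)" using hpart_carrier by (simp add: Q0_add)
      then show "x \<oplus> y \<in> Q0 ` hpart M e" using uv hpart_add by blast
    qed
    show "Q0 ` hpart M e \<subseteq> hpart M (2 * e)" using Q0_double by blast
  qed
  then obtain C where C: "\<And>e. submodule (C e) F2 M" "\<And>e. C e \<inter> Q0 ` hpart M e = {\<zero>}"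
    "\<And>e x. x \<in> hpart M (2 * e) \<Longrightarrow> \<exists>d\<in>Q0 ` hpart M e. x \<oplus> d \<in> C e"
    by metis
  have uniq: "y = z"
    if "x \<in> carrier M" "y \<in> hpart M e" "z \<in> hpart M e" "x \<oplus> Q0 y \<in> C e" "x \<oplus> Q0 z \<in> C e" for e x y z
  proof -
    have yz: "y \<in> carrier M" "z \<in> carrier M" "y \<oplus> z \<in> hpart M e" using that hpart_carrier hpart_add by auto
    have "(x \<oplus> Q0 y) \<oplus> (x \<oplus> Q0 z) \<in> C e" using that submoduleD[OF C(1)] by blast
    moreover have "(x \<oplus> Q0 y) \<oplus> (x \<oplus> Q0 z) = Q0 (y \<oplus> z)"
      using yz that(1) by (simp add: Q0_add Q0_closed a_ac)
    ultimately have "Q0 (y \<oplus> z) \<in> C e \<inter> Q0 ` hpart M e" using yz(3) by auto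
    then have "Q0 (y \<oplus> z) = Q0 \<zero>" using C(2)[of e] by auto
    then have "y \<oplus> z = \<zero>" using inj yz by auto
    then show ?thesis using yz by (simp add: add_eq_zero_iff)
  qed
  \<comment> \<open>\<open>Q0 (\<rho> e x)\<close> is the component of \<open>x\<close> in the image
    of \<open>Q0\<close>. Since the complement meets this image trivially and \<open>Q0\<close> is
    injective, there is only one such element.\<close>
  define \<rho> where "\<rho> e x = (THE y. y \<in> hpart M e \<and> x \<oplus> Q0 y \<in> C e)" for e x
  have \<rho>_eq: "\<rho> e x = y" if "x \<in> carrier M" "y \<in> hpart M e" "x \<oplus> Q0 y \<in> C e" for e x y
    unfolding \<rho>_def using that uniq by blast
  have \<rho>: "\<rho> e x \<in> hpart M e \<and> x \<oplus> Q0 (\<rho> e x) \<in> C e" if x: "x \<in> hpart M (2 * e)" for e x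
  proof -
    obtain y where "y \<in> hpart M e" "x \<oplus> Q0 y \<in> C e" using C(3)[OF x] by blast
    then show ?thesis using \<rho>_eq[OF hpart_carrier[OF x]] by metis
  qed
  define s where "s d x = (if even d then \<rho> (d div 2) x else \<zero>)" for d x
  have s_hpart: "if even d then s d x \<in> hpart M (d div 2) else s d x = \<zero>" if "x \<in> hpart M d" for d x
    using \<rho>[of x "d div 2"] that by (auto simp: s_def)
  have s_closed: "s d x \<in> carrier M" if "x \<in> hpart M d" for d x
    using s_hpart[OF that] hpart_carrier by (auto split: if_splits)
  have s_add: "s d (x \<oplus> y) = s d x \<oplus> s d y" if xy: "x \<in> hpart M d" "y \<in> hpart M d" for d x y
  proof (cases "even d")
    case True
    then obtain e where d: "d = 2 * e" by blast
    have r: "\<rho> e x \<in> hpart M e" "x \<oplus> Q0 (\<rho> e x) \<in> C e" "\<rho> e y \<in> hpart M e" "y \<oplus> Q0 (\<rho> e y) \<in> C e"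
      using \<rho> xy by (auto simp: d)
    have c: "x \<in> carrier M" "y \<in> carrier M" "\<rho> e x \<in> carrier M" "\<rho> e y \<in> carrier M"
      using xy r hpart_carrier by auto
    have "(x \<oplus> Q0 (\<rho> e x)) \<oplus> (y \<oplus> Q0 (\<rho> e y)) = (x \<oplus> y) \<oplus> Q0 (\<rho> e x \<oplus> \<rho> e y)"
      using c by (simp add: Q0_add Q0_closed a_ac)
    then have "(x \<oplus> y) \<oplus> Q0 (\<rho> e x \<oplus> \<rho> e y) \<in> C e"
      using submoduleD(3)[OF C(1) r(2,4)] by simp
    then have "\<rho> e (x \<oplus> y) = \<rho> e x \<oplus> \<rho> e y"
      using c by (intro \<rho>_eq hpart_add r) auto
    then show ?thesis by (simp add: s_def d)
  qed (simp add: s_def)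
  \<comment> \<open>\<open>Sq0\<close> serves here only to glue maps given in each degree into one
    additive map.\<close>
  define \<delta> where "\<delta> = Sq0 M s"
  have \<delta>_closed: "\<delta> x \<in> carrier M" if "x \<in> carrier M" for x
    unfolding \<delta>_def by (rule Sq0_closed[OF s_closed s_add that])
  have \<delta>_add: "\<delta> (x \<oplus> y) = \<delta> x \<oplus> \<delta> y" if "x \<in> carrier M" "y \<in> carrier M" for x y
    unfolding \<delta>_def by (rule Sq0_add[OF s_closed s_add that])
  have \<delta>_hpart: "\<delta> x = s d x" if "x \<in> hpart M d" for x d
    unfolding \<delta>_def by (rule Sq0_hpart[OF s_closed s_add that])
  have "\<delta> (Q0 x) = x" if "x \<in> carrier M" for x
    using that
  proof (induction x rule: graded_induct)
    case zero
    show ?case using \<delta>_add[of \<zero> \<zero>] \<delta>_closed[of \<zero>] by simp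
  next
    case (homog e x)
    have "\<rho> e (Q0 x) = x"
      using homog submoduleD(2)[OF C(1)] hpart_carrier[OF homog]
      by (intro \<rho>_eq) (auto simp: Q0_closed)
    then show ?case using \<delta>_hpart[OF Q0_double[OF homog]] by (simp add: s_def)
  next
    case (add x y)
    then show ?case by (simp add: Q0_add Q0_closed \<delta>_add)
  qed
  moreover have "if even d then \<delta> x \<in> hpart M (d div 2) else \<delta> x = \<zero>" if "x \<in> hpart M d" for d x
    using s_hpart[OF that] by (simp add: \<delta>_hpart[OF that])
  ultimately show ?thesis using \<delta>_closed \<delta>_add by blast
qed


section \<open>The free unstable algebra on a reduced connected module\<close>

lemma (in symmetric_operad) wop_homog:
  assumes "\<mu> \<in> carrier (ops P (length fs))"
    and fs: "list_all2 (\<lambda>f d. Poly_Mapping.keys f \<subseteq> homog_words P V d) fs ds"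
  shows "Poly_Mapping.keys (wop P \<mu> fs) \<subseteq> homog_words P V (sum_list ds)"
proof -
  have "wop P \<mu> fs \<in> {f. Poly_Mapping.keys f \<subseteq> homog_words P V (sum_list ds)}"
    unfolding wop_def
  proof (rule mext_mem)
    fix ws assume ws: "choice ws fs"
    have "list_all2 (\<lambda>w d. w \<in> homog_words P V d) ws ds"
      using list_all2_trans[OF _ ws fs, of "\<lambda>w d. w \<in> homog_words P V d"] by blast
    then have "(\<forall>(\<nu>, xs)\<in>set ws. \<nu> \<in> carrier (ops P (length xs))) \<and>
        (\<exists>es. list_all2 (\<lambda>x e. x \<in> hpart V e) (concat (map snd ws)) es \<and> sum_list es = sum_list ds)"
    proof (induction rule: list_all2_induct)
      case (Cons w ws d ds)
      obtain \<nu> xs es where w: "w = (\<nu>, xs)" "\<nu> \<in> carrier (ops P (length xs))"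
        "list_all2 (\<lambda>x e. x \<in> hpart V e) xs es" "sum_list es = d"
        using Cons(1) by (auto simp: homog_words_def)
      obtain es' where "list_all2 (\<lambda>x e. x \<in> hpart V e) (concat (map snd ws)) es'" "sum_list es' = sum_list ds"
        using Cons.IH by blast
      then have "list_all2 (\<lambda>x e. x \<in> hpart V e) (concat (map snd (w # ws))) (es @ es')"
        "sum_list (es @ es') = sum_list (d # ds)"
        using w by (auto intro: list_all2_appendI)
      then show ?case using Cons.IH w(1,2) by (intro conjI exI[of _ "es @ es'"]) auto
    qed simp
    moreover from this have "sig ws \<in> inputs P" by (intro inputs_sig) auto
    then have "ocomp P \<mu> (sig ws) \<in> carrier (ops P (length (concat (map snd ws))))"
      using ocomp_closed[of "sig ws" \<mu>] assms(1) list_all2_lengthD[OF ws]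
      unfolding arity_sig by simp
    ultimately show "sgl (word_opr P \<mu> ws) \<in> {f. Poly_Mapping.keys f \<subseteq> homog_words P V (sum_list ds)}"
      by (auto simp: word_opr_def homog_words_def)
  qed (auto intro: keys_add_subset[THEN subsetD])
  then show ?thesis by simp
qed

lemma (in symmetric_operad) eta_homog:
  "x \<in> hpart V d \<Longrightarrow> Poly_Mapping.keys (eta P x) \<subseteq> homog_words P V d"
  using unit_closed by (auto simp: homog_words_def intro!: exI[of _ "[d]"])

lemma keys_sum_subset:
  "(\<And>i. i \<in> I \<Longrightarrow> Poly_Mapping.keys (f i) \<subseteq> A) \<Longrightarrow> Poly_Mapping.keys (\<Sum>i\<in>I. f i :: 'w \<Rightarrow>\<^sub>0 bit) \<subseteq> A"
proof (induction I rule: infinite_finite_induct)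
  case (insert i I)
  then show ?case by (simp add: keys_add_subset)
qed simp_all

lemma (in generator_map) E_homog:
  assumes F: "\<And>d x. x \<in> hpart V d \<Longrightarrow> Poly_Mapping.keys (F x) \<subseteq> homog_words P V' d"
    and f: "Poly_Mapping.keys f \<subseteq> homog_words P V d"
  shows "Poly_Mapping.keys (E f) \<subseteq> homog_words P V' d"
  unfolding ext_def pbind_def
proof (rule keys_sum_subset)
  fix w assume "w \<in> Poly_Mapping.keys f"
  then obtain \<mu> xs ds where w: "w = (\<mu>, xs)" "\<mu> \<in> carrier (ops P (length xs))"
    "list_all2 (\<lambda>x e. x \<in> hpart V e) xs ds" "sum_list ds = d"
    using f by (auto simp: homog_words_def)
  have "list_all2 (\<lambda>f d. Poly_Mapping.keys f \<subseteq> homog_words P V' d) (map F xs) ds"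
    unfolding list_all2_map1 using w(3) F by (rule list_all2_mono)
  from V.wop_homog[OF _ this, of \<mu>] w
  show "Poly_Mapping.keys (case w of (\<mu>, xs) \<Rightarrow> wop P \<mu> (map F xs)) \<subseteq> homog_words P V' d" by simp
qed

section \<open>The decomposition of the module by a retraction of the top square\<close>

locale retract_space = unstable_star_space P M star
  for P :: "'p operad" and M :: "'a umod" (structure) and star :: 'p +
  fixes \<delta> :: "'a \<Rightarrow> 'a"
  assumes connected: "connected_module M"
    and \<delta>_closed: "x \<in> carrier M \<Longrightarrow> \<delta> x \<in> carrier M"
    and \<delta>_add: "\<lbrakk>x \<in> carrier M; y \<in> carrier M\<rbrakk> \<Longrightarrow> \<delta> (x \<oplus> y) = \<delta> x \<oplus> \<delta> y"
    and \<delta>_Q0: "x \<in> carrier M \<Longrightarrow> \<delta> (Q0 x) = x"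
    and \<delta>_hpart: "x \<in> hpart M d \<Longrightarrow> if even d then \<delta> x \<in> hpart M (d div 2) else \<delta> x = \<zero>"
begin

lemma \<delta>_zero [simp]: "\<delta> \<zero> = \<zero>"
  using \<delta>_Q0[of \<zero>] by simp

text \<open>The projection to the kernel of \<open>\<delta>\<close> along the image of
  \<open>Q0\<close>.\<close>

definition decomp_part :: "'a \<Rightarrow> 'a"
  where "decomp_part x = x \<oplus> Q0 (\<delta> x)"

lemma decomp_part_closed: "x \<in> carrier M \<Longrightarrow> decomp_part x \<in> carrier M"
  by (simp add: decomp_part_def Q0_closed \<delta>_closed)

lemma decomp_part_add:
  "\<lbrakk>x \<in> carrier M; y \<in> carrier M\<rbrakk> \<Longrightarrow> decomp_part (x \<oplus> y) = decomp_part x \<oplus> decomp_part y"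
  by (simp add: decomp_part_def \<delta>_add Q0_add Q0_closed \<delta>_closed a_ac)

lemma decomp_part_Q0: "x \<in> carrier M \<Longrightarrow> decomp_part (Q0 x) = \<zero>"
  by (simp add: decomp_part_def \<delta>_Q0 Q0_closed)

lemma \<delta>_decomp_part: "x \<in> carrier M \<Longrightarrow> \<delta> (decomp_part x) = \<zero>"
  by (simp add: decomp_part_def \<delta>_add \<delta>_Q0 Q0_closed \<delta>_closed)

lemma decomp_part_hpart:
  assumes "x \<in> hpart M d"
  shows "decomp_part x \<in> hpart M d"
proof (cases "even d")
  case True
  then obtain e where d: "d = 2 * e" by blast
  then have "\<delta> x \<in> hpart M e" using \<delta>_hpart[OF assms] by simp
  then have "Q0 (\<delta> x) \<in> hpart M d" using Sq_degree[of "\<delta> x" e e] Q0_hpart by (simp add: d mult_2)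
  then show ?thesis using assms by (simp add: decomp_part_def hpart_add)
next
  case False
  then show ?thesis using \<delta>_hpart[OF assms] assms hpart_carrier[OF assms] by (simp add: decomp_part_def)
qed

lemma \<delta>_pow_closed: "x \<in> carrier M \<Longrightarrow> (\<delta> ^^ k) x \<in> carrier M"
  by (induction k) (auto simp: \<delta>_closed)

lemma \<delta>_pow_add: "\<lbrakk>x \<in> carrier M; y \<in> carrier M\<rbrakk> \<Longrightarrow> (\<delta> ^^ k) (x \<oplus> y) = (\<delta> ^^ k) x \<oplus> (\<delta> ^^ k) y"
  by (induction k) (auto simp: \<delta>_add \<delta>_pow_closed)

lemma \<delta>_pow_zero [simp]: "(\<delta> ^^ k) \<zero> = \<zero>"
  by (induction k) auto

lemma \<delta>_pow_hpart:
  assumes "x \<in> hpart M d" "(\<delta> ^^ k) x \<noteq> \<zero>"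
  shows "\<exists>e. 2 ^ k * e = d \<and> (\<delta> ^^ k) x \<in> hpart M e"
  using assms(2)
proof (induction k)
  case 0
  then show ?case using assms(1) by simp
next
  case (Suc k)
  then have "(\<delta> ^^ k) x \<noteq> \<zero>" by auto
  then obtain e where e: "2 ^ k * e = d" "(\<delta> ^^ k) x \<in> hpart M e" using Suc.IH by blast
  have "even e" using \<delta>_hpart[OF e(2)] Suc.prems by (auto split: if_splits)
  then show ?case using \<delta>_hpart[OF e(2)] e(1) by (intro exI[of _ "e div 2"]) (auto elim!: evenE)
qed

text \<open>If the \<open>k\<close>-th iterate at an element of degree \<open>d\<close> is nonzero,
  its degree \<open>e\<close> satisfies \<open>2 ^ k * e = d\<close>. Connectedness excludes
  \<open>e = 0\<close>, so \<open>2 ^ k \<le> d\<close>, which fails for \<open>k \<ge> d\<close>.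
  Sums are covered because two bounds have a common one.\<close>

lemma \<delta>_nilpotent:
  assumes "x \<in> carrier M"
  shows "\<exists>n. \<forall>k\<ge>n. (\<delta> ^^ k) x = \<zero>"
  using assms
proof (induction x rule: graded_induct)
  case (homog d x)
  have "(\<delta> ^^ k) x = \<zero>" if "k \<ge> d" for k
  proof (rule ccontr)
    assume nz: "(\<delta> ^^ k) x \<noteq> \<zero>"
    then obtain e where e: "2 ^ k * e = d" "(\<delta> ^^ k) x \<in> hpart M e"
      using \<delta>_pow_hpart[OF homog] by blast
    have "e \<noteq> 0" using connected nz e(2) unfolding connected_module_def by (metis singletonD)
    then have "2 ^ k \<le> d" using e(1) by auto
    moreover have "k < 2 ^ k" by (rule less_exp)
    ultimately show False using that by simp
  qed
  then show ?case by blast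
next
  case (add x y)
  then obtain m n where "\<forall>k\<ge>m. (\<delta> ^^ k) x = \<zero>" "\<forall>k\<ge>n. (\<delta> ^^ k) y = \<zero>" by blast
  then have "(\<delta> ^^ k) (x \<oplus> y) = \<zero>" if "k \<ge> max m n" for k
    using that \<delta>_pow_add[OF add(1,2), of k] by simp
  then show ?case by blast
qed simp

section \<open>The cokernel of the top square and the map from the module to the free algebra on
  it\<close>

abbreviation W0 :: "'a set"
  where "W0 \<equiv> Q0 ` carrier M"

abbreviation N :: "'a set umod"
  where "N \<equiv> suspension (loop_module M)"

abbreviation cos :: "'a \<Rightarrow> 'a set"
  where "cos x \<equiv> W0 +> x"

lemma W0_submodule: "submodule W0 F2 M"
proof (rule f2_submoduleI)
  show "W0 \<subseteq> carrier M" using Q0_closed by blast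
  show "\<zero> \<in> W0" using Q0_zero by (metis imageI zero_closed)
  fix x y assume "x \<in> W0" "y \<in> W0"
  then obtain u v where uv: "u \<in> carrier M" "v \<in> carrier M" "x = Q0 u" "y = Q0 v" by blast
  then have "x \<oplus> y = Q0 (u \<oplus> v)" by (simp add: Q0_add)
  then show "x \<oplus> y \<in> W0" using uv by blast
qed

lemma N_simps:
  "carrier N = a_rcosets W0" "zero N = W0" "add N = set_add M"
  "module.smult N = (\<lambda>c T. \<Union>x\<in>T. cos (c \<odot> x))"
  "hpart N d = (if d = 0 then {W0} else cos ` hpart M d)"
  by (simp_all add: suspension_def loop_module_def Let_def quot_gvs_def gvs.defs umod.defs)

text \<open>A suspension is zero in degree 0 by construction; by connectedness the cokernel is zero
  there too, so the two gradings agree in every degree.\<close>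

lemma N_hpart: "hpart N d = cos ` hpart M d"
proof (cases "d = 0")
  case True
  have "cos ` hpart M 0 = {W0}"
    using connected coset_zero[OF W0_submodule] by (simp add: connected_module_def)
  then show ?thesis using True by (simp add: N_simps)
qed (simp add: N_simps)

lemma N_module: "module F2 N"
  by (rule quot_module[OF W0_submodule]) (simp_all add: N_simps)

sublocale N: star_operad_space P N star
proof (intro star_operad_space.intro operad_space.intro star_operad_space_axioms.intro)
  show "symmetric_operad P" by (rule symmetric_operad_axioms)
  show "f2_space N" using N_module by (simp add: f2_space_def)
qed (rule star_invariant star_central)+

lemma N_carrier: "carrier N = cos ` carrier M"
  by (auto simp: N_simps A_RCOSETS_def')

lemma cos_closed: "x \<in> carrier M \<Longrightarrow> cos x \<in> carrier N"
  by (simp add: N_carrier)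

lemma cos_add: "\<lbrakk>x \<in> carrier M; y \<in> carrier M\<rbrakk> \<Longrightarrow> cos x \<oplus>\<^bsub>N\<^esub> cos y = cos (x \<oplus> y)"
  unfolding N_simps by (rule coset_add[OF W0_submodule])

lemma cos_Q0:
  assumes "x \<in> carrier M"
  shows "cos (Q0 x) = \<zero>\<^bsub>N\<^esub>"
proof -
  have "cos (Q0 x) = cos \<zero>"
    using assms by (subst coset_eq_iff[OF W0_submodule]) (auto simp: Q0_closed)
  then show ?thesis unfolding N_simps(2) coset_zero[OF W0_submodule] .
qed

lemma cos_zero: "cos \<zero> = \<zero>\<^bsub>N\<^esub>"
  using cos_Q0[of \<zero>] by simp

lemma cos_decomp_part: "x \<in> carrier M \<Longrightarrow> cos (decomp_part x) = cos x"
  unfolding decomp_part_def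
  by (subst coset_eq_iff[OF W0_submodule]) (auto simp: Q0_closed \<delta>_closed a_ac)

text \<open>The linear section of the projection \<open>cos\<close> with values in the kernel of
  \<open>\<delta>\<close>. It does not depend on the representative because
  \<open>decomp_part\<close> kills the image of \<open>Q0\<close>.\<close>

definition sec :: "'a set \<Rightarrow> 'a"
  where "sec T = decomp_part (SOME x. x \<in> T)"

lemma sec_cos:
  assumes "x \<in> carrier M"
  shows "sec (cos x) = decomp_part x"
proof -
  have "(SOME y. y \<in> cos x) \<in> cos x" using coset_self[OF W0_submodule assms] by (rule someI)
  then obtain z where z: "(SOME y. y \<in> cos x) \<in> carrier M" "z \<in> carrier M" "x \<oplus> (SOME y. y \<in> cos x) = Q0 z"
    using assms by (auto simp: coset_mem_iff[OF W0_submodule])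
  then have "decomp_part x \<oplus> decomp_part (SOME y. y \<in> cos x) = \<zero>"
    using assms decomp_part_Q0[of z] by (simp flip: decomp_part_add)
  then show ?thesis
    using assms z(1) decomp_part_closed by (simp add: sec_def add_eq_zero_iff)
qed

lemma N_cases:
  assumes "T \<in> carrier N"
  obtains x where "x \<in> carrier M" "T = cos x"
  using assms unfolding N_carrier by blast

lemma sec_closed: "T \<in> carrier N \<Longrightarrow> sec T \<in> carrier M"
  by (erule N_cases) (simp add: sec_cos decomp_part_closed)

lemma sec_add:
  assumes "T \<in> carrier N" "U \<in> carrier N"
  shows "sec (T \<oplus>\<^bsub>N\<^esub> U) = sec T \<oplus> sec U"
proof -
  obtain x y where "x \<in> carrier M" "T = cos x" "y \<in> carrier M" "U = cos y"
    using assms by (metis N_cases)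
  then show ?thesis by (simp add: cos_add sec_cos decomp_part_add)
qed

sublocale G: generator_map P N M "\<lambda>T. eta P (sec T)"
proof unfold_locales
  show "eta P (sec T) \<in> W" if "T \<in> carrier N" for T
    by (rule eta_in_wcarrier[OF sec_closed[OF that]])
  show "eqm R (eta P (sec (T \<oplus>\<^bsub>N\<^esub> U))) (eta P (sec T) + eta P (sec U))"
    if "T \<in> carrier N" "U \<in> carrier N" for T U
    unfolding sec_add[OF that] by (rule eta_add[OF sec_closed[OF that(1)] sec_closed[OF that(2)]])
qed

text \<open>Iterating the decomposition \<open>x = decomp_part x + Q0 (\<delta> x)\<close> expresses \<open>x\<close> through the elements
  \<open>decomp_part ((\<delta> ^^ k) x)\<close>, with \<open>Q0\<close> applied \<open>k\<close> times; on the free algebra \<open>Q0\<close> becomes \<open>frob\<close>.\<close>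

definition F :: "'a \<Rightarrow> ('p, 'a set) word \<Rightarrow>\<^sub>0 bit"
  where "F x = (\<Sum>k\<in>{k. (\<delta> ^^ k) x \<noteq> \<zero>}. (N.frob ^^ k) (eta P (cos ((\<delta> ^^ k) x))))"

lemma frob_pow_closed: "f \<in> N.W \<Longrightarrow> (N.frob ^^ k) f \<in> N.W"
  by (induction k) (simp_all only: funpow.simps comp_apply id_apply N.frob_closed)

lemma frob_pow_R: "f \<in> N.R \<Longrightarrow> (N.frob ^^ k) f \<in> N.R"
  by (induction k) (simp_all add: N.frob_R)

lemma eta_cos_closed: "x \<in> carrier M \<Longrightarrow> eta P (cos x) \<in> N.W"
  by (rule eta_in_wcarrier[OF cos_closed])

lemma N_eta_add: "\<lbrakk>T \<in> carrier N; U \<in> carrier N\<rbrakk> \<Longrightarrow> eqm N.R (eta P (T \<oplus>\<^bsub>N\<^esub> U)) (eta P T + eta P U)"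
  using N.R_arg_add[of "ounit P" "[]" "[]" T U] unit_closed by (simp add: eqm_def)

lemma F_term_closed: "x \<in> carrier M \<Longrightarrow> (N.frob ^^ k) (eta P (cos ((\<delta> ^^ k) x))) \<in> N.W"
  by (intro frob_pow_closed eta_cos_closed \<delta>_pow_closed)

lemma F_zero [simp]: "F \<zero> = 0"
  by (simp add: F_def)

text \<open>The index set in the definition of \<open>F\<close> varies with \<open>x\<close>.
  Summing over an initial segment instead lets the values at different elements be compared; the
  additional terms are iterates of \<open>frob\<close> at the zero coset, hence relations.\<close>

lemma F_eq:
  assumes x: "x \<in> carrier M" and n: "\<forall>k\<ge>n. (\<delta> ^^ k) x = \<zero>"
  shows "eqm N.R (F x) (\<Sum>k<n. (N.frob ^^ k) (eta P (cos ((\<delta> ^^ k) x))))" (is "eqm _ _ (\<Sum>k<n. ?t k)")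
proof -
  let ?K = "{k. (\<delta> ^^ k) x \<noteq> \<zero>}"
  have K: "?K \<subseteq> {..<n}" using n by (auto simp: not_le[symmetric])
  have "eqm N.R (\<Sum>k\<in>{..<n} - ?K. ?t k) (\<Sum>k\<in>{..<n} - ?K. 0)"
  proof (rule N.R_eqm_sum)
    fix k assume "k \<in> {..<n} - ?K"
    then have "eta P (cos ((\<delta> ^^ k) x)) \<in> N.R"
      using unit_closed by (intro N.R_zero_arg) (auto simp: cos_zero)
    then show "eqm N.R (?t k) 0" using frob_pow_R by (simp add: eqm_def)
  qed
  from N.R_eqm_add[OF this N.R_refl, of "F x"] show ?thesis
    unfolding F_def sum.subset_diff[OF K finite_lessThan, of ?t]
    by (auto intro: eqm_sym)
qed

lemma F_closed: "x \<in> carrier M \<Longrightarrow> F x \<in> N.W"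
  unfolding F_def by (rule N.cl_sum(1)) (rule F_term_closed)

lemma frob_pow_add:
  assumes "f \<in> N.W" "g \<in> N.W"
  shows "eqm N.R ((N.frob ^^ k) (f + g)) ((N.frob ^^ k) f + (N.frob ^^ k) g)"
proof (induction k)
  case (Suc k)
  let ?f = "(N.frob ^^ k) f" and ?g = "(N.frob ^^ k) g"
  have "eqm N.R (N.frob ((N.frob ^^ k) (f + g))) (N.frob (?f + ?g))"
    using Suc by (rule N.frob_eqm[OF N.op_ideal_R]) (intro frob_pow_closed wcarrier_add assms)+
  also have "eqm N.R (N.frob (?f + ?g)) (N.frob ?f + N.frob ?g)"
    by (intro N.frob_add frob_pow_closed assms)
  finally show ?case by simp
qed simp

lemma frob_pow_eqm:
  assumes "eqm N.R f g" "f \<in> N.W" "g \<in> N.W"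
  shows "eqm N.R ((N.frob ^^ k) f) ((N.frob ^^ k) g)"
proof (induction k)
  case (Suc k)
  then have "eqm N.R (N.frob ((N.frob ^^ k) f)) (N.frob ((N.frob ^^ k) g))"
    by (rule N.frob_eqm[OF N.op_ideal_R]) (intro frob_pow_closed assms)+
  then show ?case by simp
qed (simp add: assms)

text \<open>Up to a common bound the sums agree term by term, since \<open>\<delta>\<close> and
  \<open>cos\<close> are additive and \<open>frob\<close> is additive modulo relations.\<close>

lemma F_add:
  assumes x: "x \<in> carrier M" and y: "y \<in> carrier M"
  shows "eqm N.R (F (x \<oplus> y)) (F x + F y)"
proof -
  let ?t = "\<lambda>k x. (N.frob ^^ k) (eta P (cos ((\<delta> ^^ k) x)))"
  obtain m n where mn: "\<forall>k\<ge>m. (\<delta> ^^ k) x = \<zero>" "\<forall>k\<ge>n. (\<delta> ^^ k) y = \<zero>"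
    using \<delta>_nilpotent x y by meson
  define l where "l = max m n"
  have l: "\<forall>k\<ge>l. (\<delta> ^^ k) x = \<zero>" "\<forall>k\<ge>l. (\<delta> ^^ k) y = \<zero>" "\<forall>k\<ge>l. (\<delta> ^^ k) (x \<oplus> y) = \<zero>"
    using mn x y by (simp_all add: l_def \<delta>_pow_add)
  have "eqm N.R (?t k (x \<oplus> y)) (?t k x + ?t k y)" for k
  proof -
    have c: "(\<delta> ^^ k) x \<in> carrier M" "(\<delta> ^^ k) y \<in> carrier M" using x y \<delta>_pow_closed by blast+
    have "eqm N.R (eta P (cos ((\<delta> ^^ k) (x \<oplus> y)))) (eta P (cos ((\<delta> ^^ k) x)) + eta P (cos ((\<delta> ^^ k) y)))"
      using N_eta_add[OF cos_closed[OF c(1)] cos_closed[OF c(2)]] x y c by (simp add: \<delta>_pow_add cos_add)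
    then have "eqm N.R (?t k (x \<oplus> y)) ((N.frob ^^ k) (eta P (cos ((\<delta> ^^ k) x)) + eta P (cos ((\<delta> ^^ k) y))))"
      by (rule frob_pow_eqm) (intro wcarrier_add eta_cos_closed \<delta>_pow_closed a_closed x y)+
    also have "eqm N.R \<dots> (?t k x + ?t k y)"
      by (intro frob_pow_add eta_cos_closed c)
    finally show ?thesis .
  qed
  then have sums: "eqm N.R (\<Sum>k<l. ?t k (x \<oplus> y)) (\<Sum>k<l. ?t k x + ?t k y)"
    by (rule N.R_eqm_sum)
  have "eqm N.R (F (x \<oplus> y)) (\<Sum>k<l. ?t k (x \<oplus> y))"
    using x y l(3) by (intro F_eq) auto
  also note sums
  also have "eqm N.R (\<Sum>k<l. ?t k x + ?t k y) (F x + F y)"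
    unfolding sum.distrib by (intro eqm_sym[OF N.R_eqm_add] F_eq x y l)
  finally show ?thesis .
qed

text \<open>The term \<open>k = 0\<close> is split off, and one \<open>frob\<close> is pulled out of
  the others. The later facts on \<open>F\<close>, namely \<open>F_Q0\<close>, \<open>F_sec\<close>
  and \<open>EG_F\<close>, all come from this recursion.\<close>

lemma F_step:
  assumes x: "x \<in> carrier M"
  shows "eqm N.R (F x) (eta P (cos x) + N.frob (F (\<delta> x)))"
proof -
  let ?t = "\<lambda>k x. (N.frob ^^ k) (eta P (cos ((\<delta> ^^ k) x)))"
  obtain n where n: "\<forall>k\<ge>n. (\<delta> ^^ k) x = \<zero>" using \<delta>_nilpotent x by meson
  have n': "\<forall>k\<ge>n. (\<delta> ^^ k) (\<delta> x) = \<zero>"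
    using n by (metis comp_apply funpow_Suc_right le_SucI)
  \<comment> \<open>The bound is \<open>Suc n\<close>, so that removing the term
    \<open>k = 0\<close> leaves as many terms as the sum for \<open>\<delta> x\<close> has up to
    \<open>n\<close>.\<close>
  have "eqm N.R (F x) (\<Sum>k<Suc n. ?t k x)" using n x by (intro F_eq) auto
  also have "(\<Sum>k<Suc n. ?t k x) = eta P (cos x) + (\<Sum>k<n. N.frob (?t k (\<delta> x)))"
    unfolding sum.lessThan_Suc_shift by (simp add: funpow_swap1)
  also have "eqm N.R \<dots> (eta P (cos x) + N.frob (\<Sum>k<n. ?t k (\<delta> x)))"
    by (intro N.R_eqm_add N.R_refl eqm_sym[OF N.frob_sum] F_term_closed \<delta>_closed x)
  also have "eqm N.R \<dots> (eta P (cos x) + N.frob (F (\<delta> x)))"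
    by (intro N.R_eqm_add N.R_refl N.frob_eqm[OF N.op_ideal_R] eqm_sym[OF F_eq] n' F_closed
        N.cl_sum(1) F_term_closed \<delta>_closed x)
  finally show ?thesis .
qed

sublocale E: generator_map P M N F
  by unfold_locales (rule F_closed F_add; assumption)+

text \<open>In \<open>F_step\<close> for \<open>Q0 x\<close> the first summand belongs to the zero
  coset, and \<open>\<delta>\<close> undoes \<open>Q0\<close> in the second.\<close>

lemma F_Q0:
  assumes "x \<in> carrier M"
  shows "eqm N.R (F (Q0 x)) (N.frob (F x))"
proof -
  have "eta P (\<zero>\<^bsub>N\<^esub>) \<in> N.R" using unit_closed by (intro N.R_zero_arg) auto
  then have "eqm N.R (eta P (\<zero>\<^bsub>N\<^esub>) + N.frob (F x)) (0 + N.frob (F x))"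
    by (intro N.R_eqm_add N.R_refl) (simp add: eqm_def)
  then show ?thesis
    using F_step[OF Q0_closed[OF assms]] N.R_trans assms by (simp add: \<delta>_Q0 cos_Q0)
qed

text \<open>As \<open>\<delta>\<close> vanishes on the values of \<open>sec\<close>, only the first
  summand of \<open>F_step\<close> remains.\<close>

lemma F_sec:
  assumes "T \<in> carrier N"
  shows "eqm N.R (F (sec T)) (eta P T)"
proof -
  obtain x where x: "x \<in> carrier M" "T = cos x" using assms by (rule N_cases)
  show ?thesis
    using F_step[OF decomp_part_closed[OF x(1)]] x
    by (simp add: sec_cos cos_decomp_part \<delta>_decomp_part)
qed

lemma frob_pow_homog:
  assumes "Poly_Mapping.keys g \<subseteq> homog_words P N e"
  shows "Poly_Mapping.keys ((N.frob ^^ k) g) \<subseteq> homog_words P N (2 ^ k * e)"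
proof (induction k)
  case (Suc k)
  then have "Poly_Mapping.keys (wop P star [(N.frob ^^ k) g, (N.frob ^^ k) g])
      \<subseteq> homog_words P N (sum_list [2 ^ k * e, 2 ^ k * e])"
    using star_ops by (intro wop_homog) (simp_all add: numeral_2_eq_2)
  then show ?case by (simp add: N.frob_def[of "(N.frob ^^ k) g"] mult_2 add_mult_distrib)
qed (simp add: assms)

text \<open>Each \<open>\<delta>\<close> halves the degree and each \<open>frob\<close> doubles it,
  and both occur \<open>k\<close> times in the \<open>k\<close>-th summand.\<close>

lemma F_hpart:
  assumes "x \<in> hpart M d"
  shows "Poly_Mapping.keys (F x) \<subseteq> homog_words P N d"
  unfolding F_def
proof (rule keys_sum_subset)
  fix k assume "k \<in> {k. (\<delta> ^^ k) x \<noteq> \<zero>}"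
  then obtain e where e: "2 ^ k * e = d" "(\<delta> ^^ k) x \<in> hpart M e"
    using \<delta>_pow_hpart[OF assms] by blast
  then have "Poly_Mapping.keys (eta P (cos ((\<delta> ^^ k) x))) \<subseteq> homog_words P N e"
    using eta_homog[of "cos ((\<delta> ^^ k) x)" N e] by (simp add: N_hpart)
  then show "Poly_Mapping.keys ((N.frob ^^ k) (eta P (cos ((\<delta> ^^ k) x)))) \<subseteq> homog_words P N d"
    using frob_pow_homog[of _ e k] e(1) by simp
qed


section \<open>The induced algebra maps and the part of the kernel that is stable under
  squares\<close>

abbreviation EF :: "(('p, 'a) word \<Rightarrow>\<^sub>0 bit) \<Rightarrow> ('p, 'a set) word \<Rightarrow>\<^sub>0 bit"
  where "EF \<equiv> ext P F"

abbreviation EG :: "(('p, 'a set) word \<Rightarrow>\<^sub>0 bit) \<Rightarrow> ('p, 'a) word \<Rightarrow>\<^sub>0 bit"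
  where "EG \<equiv> ext P (\<lambda>T. eta P (sec T))"

lemma EF_frob:
  assumes "f \<in> W"
  shows "EF (frob f) = N.frob (EF f)"
  using E.E_wop[of star "[f, f]"] assms star_ops by (simp add: frob_def N.frob_def numeral_2_eq_2)

lemma EG_frob:
  assumes "f \<in> N.W"
  shows "EG (N.frob f) = frob (EG f)"
  using G.E_wop[of star "[f, f]"] assms star_ops by (simp add: frob_def N.frob_def numeral_2_eq_2)

text \<open>Modulo relations both sides extend the same map of generators: on the left this is
  \<open>F_Q0\<close>, on the right it is that \<open>frob\<close> commutes with operations.\<close>

lemma EF_Z:
  assumes f: "f \<in> W"
  shows "eqm N.R (EF (Z f)) (N.frob (EF f))"
proof -
  have "EF (Z f) = ext P (\<lambda>x. EF (eta P (Q0 x))) f"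
    unfolding Z_def by (rule E.E_ext[OF f]) (rule eta_in_wcarrier[OF Q0_closed])
  also have "eqm N.R \<dots> (ext P (\<lambda>x. N.frob (F x)) f)"
  proof (rule N.eqm_ext[OF N.op_ideal_R f])
    fix x assume x: "x \<in> carrier M"
    show "eqm N.R (EF (eta P (Q0 x))) (N.frob (F x))"
      unfolding E.E_eta[OF Q0_closed[OF x]] by (rule F_Q0[OF x])
  qed (intro E.E_closed eta_in_wcarrier N.frob_closed F_closed Q0_closed; assumption)+
  also have "eqm N.R \<dots> (N.frob (EF f))"
    by (rule eqm_sym[OF N.frob_ext[OF f F_closed]])
  finally show ?thesis .
qed

lemma EF_gen:
  assumes "f \<in> W"
  shows "EF (Z f + frob f) \<in> N.R"
  using EF_Z[OF assms] by (simp add: ext_add EF_frob[OF assms] eqm_def)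

text \<open>Monomials in the Steenrod squares; the head of the list acts first.\<close>

definition sqs :: "nat list \<Rightarrow> (('p, 'a) word \<Rightarrow>\<^sub>0 bit) \<Rightarrow> ('p, 'a) word \<Rightarrow>\<^sub>0 bit"
  where "sqs = fold (word_Sq M)"

lemma sqs_simps: "sqs [] f = f" "sqs (i # is) f = sqs is (word_Sq M i f)"
  by (simp_all add: sqs_def)

lemma sqs_add: "sqs is (f + g) = sqs is f + sqs is g"
  by (induction "is" arbitrary: f g) (simp_all add: sqs_simps word_Sq_add)

lemma sqs_zero [simp]: "sqs is 0 = 0"
  by (induction "is") (simp_all add: sqs_simps word_Sq_eq)

lemma sqs_sum: "sqs is (\<Sum>k\<in>A. f k) = (\<Sum>k\<in>A. sqs is (f k))"
  by (induction A rule: infinite_finite_induct) (simp_all add: sqs_add)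

lemma sqs_R: "r \<in> R \<Longrightarrow> sqs is r \<in> R"
  by (induction "is" arbitrary: r) (simp_all add: sqs_simps word_Sq_R)

text \<open>The largest subset of the kernel of \<open>EF\<close>, modulo relations, that is stable under the Steenrod operations.\<close>

definition stable_kernel :: "(('p, 'a) word \<Rightarrow>\<^sub>0 bit) set"
  where "stable_kernel = {f \<in> W. \<forall>is. EF (sqs is f) \<in> N.R}"

lemma stable_kernel_R: "r \<in> R \<Longrightarrow> r \<in> stable_kernel"
  using R_subset sqs_R E.E_R by (auto simp: stable_kernel_def)

lemma stable_kernel_add: "\<lbrakk>f \<in> stable_kernel; g \<in> stable_kernel\<rbrakk> \<Longrightarrow> f + g \<in> stable_kernel"
  unfolding stable_kernel_def using wcarrier_add[of f P M g] N.R_add by (simp add: sqs_add ext_add)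

lemma stable_kernel_Sq: "f \<in> stable_kernel \<Longrightarrow> word_Sq M i f \<in> stable_kernel"
  unfolding stable_kernel_def using word_Sq_closed[of f i] by (auto simp flip: sqs_simps(2))

text \<open>The Cartan formula moves a square into the arguments, and in every term the last
  argument is a square of \<open>f\<close>, which is again in the stable kernel. The induction on
  the list of squares therefore has to allow all arguments at once.\<close>

lemma stable_kernel_wop:
  assumes "f \<in> stable_kernel" "set fs \<subseteq> W" "\<mu> \<in> carrier (ops P (Suc (length fs)))"
  shows "wop P \<mu> (fs @ [f]) \<in> stable_kernel"
proof -
  have "EF (sqs is (wop P \<mu> (fs @ [f]))) \<in> N.R" for "is"
    using assms
  proof (induction "is" arbitrary: fs f)
    case Nil
    have fW: "f \<in> W" and "EF f \<in> N.R"
      using Nil.prems(1) sqs_simps(1) unfolding stable_kernel_def by (blast, metis (lifting) mem_Collect_eq)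
    have "EF (wop P \<mu> (fs @ [f])) = wop P \<mu> (map EF fs @ [EF f])"
      using Nil.prems fW by (subst E.E_wop) auto
    moreover have "set (map EF fs) \<subseteq> N.W"
      unfolding set_map by (rule image_subsetI) (intro E.E_closed subsetD[OF Nil.prems(2)])
    ultimately show ?case
      using N.wop_R_last[OF \<open>EF f \<in> N.R\<close>, of \<mu> "map EF fs"] Nil.prems(3) by (simp add: sqs_simps)
  next
    case (Cons i "is")
    have "EF (sqs is (wop P \<mu> (map2 (word_Sq M) js (fs @ [f])))) \<in> N.R" if js: "js \<in> comps (Suc (length fs)) i" for js
    proof -
      obtain ks k where ks: "js = ks @ [k]" "length ks = length fs"
        using js by (metis (mono_tags, lifting) length_Suc_conv_rev mem_Collect_eq)
      have "set (map2 (word_Sq M) ks fs) \<subseteq> W"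
      proof
        fix g assume "g \<in> set (map2 (word_Sq M) ks fs)"
        then obtain j f where "f \<in> set fs" "g = word_Sq M j f" by (auto dest: set_zip_rightD)
        then show "g \<in> W" using word_Sq_closed Cons.prems(2) by blast
      qed
      then show ?thesis
        using Cons.IH[OF stable_kernel_Sq[OF Cons.prems(1)], of "map2 (word_Sq M) ks fs" k] Cons.prems(3) ks
        by simp
    qed
    then have "(\<Sum>js\<in>comps (Suc (length fs)) i. EF (sqs is (wop P \<mu> (map2 (word_Sq M) js (fs @ [f]))))) \<in> N.R"
      using N.R_eqm_sum[of "comps (Suc (length fs)) i" _ "\<lambda>js. 0"] by (simp add: eqm_def)
    moreover have "word_Sq M i (wop P \<mu> (fs @ [f])) =
        (\<Sum>js\<in>comps (Suc (length fs)) i. wop P \<mu> (map2 (word_Sq M) js (fs @ [f])))"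
      unfolding word_Sq_eq[abs_def] wcart_wop by simp
    ultimately show ?case by (simp add: sqs_simps sqs_sum ext_sum)
  qed
  moreover have "wop P \<mu> (fs @ [f]) \<in> W"
    using assms by (intro wop_closed) (auto simp: stable_kernel_def)
  ultimately show ?thesis by (simp add: stable_kernel_def)
qed

text \<open>By \<open>word_Sq_gen\<close> a square turns such an element, modulo relations, into one
  of the same form or into 0. Iterating this leaves the case without squares, which is
  \<open>EF_gen\<close>.\<close>

lemma stable_kernel_gen:
  assumes "f \<in> W"
  shows "Z f + frob f \<in> stable_kernel"
proof -
  have "EF (sqs is (Z f + frob f)) \<in> N.R" for "is"
    using assms
  proof (induction "is" arbitrary: f)
    case Nil
    then show ?case by (simp add: sqs_simps EF_gen)
  next
    case (Cons i "is")
    let ?f = "word_Sq M (i div 2) f"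
    let ?g = "if even i then Z ?f + frob ?f else 0"
    have "eqm R (word_Sq M i (Z f + frob f)) ?g" using Cons.prems by (rule word_Sq_gen)
    then have "EF (sqs is (word_Sq M i (Z f + frob f) + ?g)) \<in> N.R"
      unfolding eqm_def by (intro E.E_R sqs_R)
    moreover have "EF (sqs is ?g) \<in> N.R"
      using Cons.IH[OF word_Sq_closed[OF Cons.prems]] by simp
    ultimately have "eqm N.R (EF (sqs is (word_Sq M i (Z f + frob f)))) (EF (sqs is ?g))"
      by (simp only: eqm_def sqs_add ext_add)
    then show ?case
      using \<open>EF (sqs is ?g) \<in> N.R\<close> N.R_eqm_mem by (simp only: sqs_simps)
  qed
  moreover have "Z f + frob f \<in> W"
    using wcarrier_add[OF Z.E_closed[OF assms] frob_closed[OF assms]] by (simp add: Z_def)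
  ultimately show ?thesis by (simp add: stable_kernel_def)
qed

section \<open>The ideal that defines K, in terms of formal sums\<close>

definition K_stable :: "(('p, 'a) word \<Rightarrow>\<^sub>0 bit) set set \<Rightarrow> bool"
  where "K_stable I \<longleftrightarrow> palg_ideal P S I \<and> (\<forall>i. \<forall>t\<in>I. free_Sq P M i t \<in> I) \<and>
    (\<forall>t\<in>carrier S. Sq0 S (free_Sq P M) t \<oplus>\<^bsub>S\<^esub> opr S star [t, t] \<in> I)"

lemma K_ideal_iff: "T \<in> K_ideal P star M \<longleftrightarrow> (\<forall>I. K_stable I \<longrightarrow> T \<in> I)"
  by (auto simp: K_ideal_def K_stable_def Let_def)

lemma gen_cl:
  assumes "f \<in> W"
  shows "Sq0 S (free_Sq P M) (cl f) \<oplus>\<^bsub>S\<^esub> opr S star [cl f, cl f] = cl (Z f + frob f)"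
proof -
  have "opr S star [cl f, cl f] = cl (frob f)"
    using S_opr[of star "[f, f]"] assms star_ops by (simp add: frob_def numeral_2_eq_2)
  moreover have "Z f \<in> W" using Z.E_closed[OF assms] by (simp add: Z_def)
  ultimately show ?thesis using S_add[OF _ frob_closed[OF assms]] by (simp add: Sq0_S[OF assms])
qed

lemma cl_eqI: "\<lbrakk>f \<in> W; g \<in> W; eqm R f g\<rbrakk> \<Longrightarrow> cl f = cl g"
  by (simp only: cl_eq_iff)

text \<open>This places the stable kernel among the ideals whose intersection is
  \<open>K_ideal\<close>, and so bounds the latter from above by the kernel of
  \<open>EF\<close>.\<close>

lemma K_stable_stable_kernel: "K_stable (cl ` stable_kernel)"
  unfolding K_stable_def palg_ideal_def
proof (intro conjI allI ballI impI)
  interpret S: f2_space S by (simp add: f2_space_def S_module)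
  have skW: "stable_kernel \<subseteq> W" by (auto simp: stable_kernel_def)
  show "submodule (cl ` stable_kernel) F2 S"
  proof (rule S.f2_submoduleI)
    show "cl ` stable_kernel \<subseteq> carrier S" using skW unfolding S_carrier by blast
    show "\<zero>\<^bsub>S\<^esub> \<in> cl ` stable_kernel" unfolding S_zero using stable_kernel_R[OF R_zero] by blast
    fix T U assume "T \<in> cl ` stable_kernel" "U \<in> cl ` stable_kernel"
    then obtain f g where fg: "f \<in> stable_kernel" "g \<in> stable_kernel" "T = cl f" "U = cl g" by blast
    then have "T \<oplus>\<^bsub>S\<^esub> U = cl (f + g)" using S_add skW by blast
    then show "T \<oplus>\<^bsub>S\<^esub> U \<in> cl ` stable_kernel" using stable_kernel_add[OF fg(1,2)] by blast
  qed
  show "opr S \<mu> (Ts @ [T]) \<in> cl ` stable_kernel"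
    if \<mu>: "\<mu> \<in> carrier (ops P (Suc (length Ts)))" and Ts: "set Ts \<subseteq> carrier S" and T: "T \<in> cl ` stable_kernel"
    for Ts T \<mu>
  proof -
    obtain fs where fs: "set fs \<subseteq> W" "Ts = map cl fs" using Ts by (rule S_list)
    obtain f where f: "f \<in> stable_kernel" "T = cl f" using T by blast
    have "opr S \<mu> (map cl (fs @ [f])) = cl (wop P \<mu> (fs @ [f]))"
      using fs f skW \<mu> by (intro S_opr) auto
    then show ?thesis using stable_kernel_wop[OF f(1) fs(1), of \<mu>] \<mu> fs(2) f(2) by simp
  qed
  show "free_Sq P M i T \<in> cl ` stable_kernel" if T: "T \<in> cl ` stable_kernel" for i T
  proof -
    obtain f where f: "f \<in> stable_kernel" "T = cl f" using T by blast
    then have "free_Sq P M i T = cl (word_Sq M i f)" using free_Sq_cl[of f i] skW by blast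
    then show ?thesis using stable_kernel_Sq[OF f(1)] by blast
  qed
  show "Sq0 S (free_Sq P M) T \<oplus>\<^bsub>S\<^esub> opr S star [T, T] \<in> cl ` stable_kernel" if T: "T \<in> carrier S" for T
  proof -
    obtain f where "f \<in> W" "T = cl f" using T unfolding S_carrier by blast
    then show ?thesis using gen_cl[of f] stable_kernel_gen[of f] by auto
  qed
qed

text \<open>The inverse image of the ideal in the space of formal sums. It is an
  \<open>op_ideal\<close>, so \<open>eqm K_words\<close> is a congruence for the operations and
  expresses equality in \<open>K\<close>.\<close>

definition K_words :: "(('p, 'a) word \<Rightarrow>\<^sub>0 bit) set"
  where "K_words = {f \<in> W. cl f \<in> K_ideal P star M}"

lemma K_words_kernel:
  assumes "f \<in> K_words"
  shows "EF f \<in> N.R"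
proof -
  have f: "f \<in> W" "cl f \<in> cl ` stable_kernel"
    using assms K_stable_stable_kernel by (auto simp: K_words_def K_ideal_iff)
  then obtain g where g: "g \<in> stable_kernel" "cl f = cl g" by blast
  then have "g \<in> W" "EF g \<in> N.R" using sqs_simps(1)[of g] by (auto simp: stable_kernel_def) metis
  moreover have "eqm R f g" using g(2) f(1) \<open>g \<in> W\<close> by (simp only: cl_eq_iff)
  ultimately show ?thesis using N.R_eqm_mem[OF E.E_eqm] by blast
qed

lemma K_stableD:
  assumes "K_stable I"
  shows "r \<in> R \<Longrightarrow> cl r \<in> I"
    "\<lbrakk>f \<in> W; g \<in> W; cl f \<in> I; cl g \<in> I\<rbrakk> \<Longrightarrow> cl (f + g) \<in> I"
    "\<lbrakk>\<mu> \<in> carrier (ops P (Suc (length fs))); set fs \<subseteq> W; f \<in> W; cl f \<in> I\<rbrakk> \<Longrightarrow> cl (wop P \<mu> (fs @ [f])) \<in> I"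
    "f \<in> W \<Longrightarrow> cl (Z f + frob f) \<in> I"
proof -
  interpret S: f2_space S by (simp add: f2_space_def S_module)
  have sub: "submodule I F2 S" using assms by (simp add: K_stable_def palg_ideal_def)
  show "cl r \<in> I" if "r \<in> R"
  proof -
    have "cl r = cl 0" using that R_subset by (intro cl_eqI) (auto simp: eqm_def)
    then show ?thesis using S.submoduleD(2)[OF sub] by (simp add: S_zero)
  qed
  show "cl (f + g) \<in> I" if "f \<in> W" "g \<in> W" "cl f \<in> I" "cl g \<in> I"
    using S.submoduleD(3)[OF sub that(3,4)] S_add[OF that(1,2)] by simp
  show "cl (wop P \<mu> (fs @ [f])) \<in> I"
    if h: "\<mu> \<in> carrier (ops P (Suc (length fs)))" "set fs \<subseteq> W" "f \<in> W" "cl f \<in> I"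
  proof -
    have "set (map cl fs) \<subseteq> carrier S" using h(2) unfolding S_carrier by auto
    then have "opr S \<mu> (map cl fs @ [cl f]) \<in> I"
      using assms h unfolding K_stable_def palg_ideal_def by (metis length_map)
    then show ?thesis using S_opr[of \<mu> "fs @ [f]"] h by simp
  qed
  show "cl (Z f + frob f) \<in> I" if "f \<in> W"
    using assms gen_cl[OF that] cl_in_S[OF that] unfolding K_stable_def by metis
qed

lemma K_words_ideal: "op_ideal K_words"
  unfolding op_ideal_def
proof (intro conjI allI ballI impI)
  show "R \<subseteq> K_words" using R_subset K_stableD(1) by (auto simp: K_words_def K_ideal_iff)
  show "K_words \<subseteq> W" by (auto simp: K_words_def)
  show "f + g \<in> K_words" if "f \<in> K_words" "g \<in> K_words" for f g
    using that K_stableD(2)[of _ f g] wcarrier_add[of f P M g] by (simp add: K_words_def K_ideal_iff)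
  show "wop P \<mu> (fs @ [f]) \<in> K_words"
    if "\<mu> \<in> carrier (ops P (Suc (length fs)))" "set fs \<subseteq> W" "f \<in> K_words" for fs f \<mu>
  proof -
    have "wop P \<mu> (fs @ [f]) \<in> W" using that by (intro wop_closed) (auto simp: K_words_def)
    then show ?thesis using that K_stableD(3)[of _ \<mu> fs f] by (simp add: K_words_def K_ideal_iff)
  qed
qed

lemma K_words_gen:
  assumes "f \<in> W"
  shows "eqm K_words (frob f) (Z f)"
proof -
  have "Z f + frob f \<in> W"
    using wcarrier_add[OF Z.E_closed[OF assms] frob_closed[OF assms]] by (simp add: Z_def)
  then show ?thesis
    using K_stableD(4)[OF _ assms] by (simp add: eqm_def K_words_def K_ideal_iff add.commute)
qed

text \<open>Induction on the bound in \<open>\<delta>_nilpotent\<close>. By \<open>F_step\<close>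
  the left side is \<open>decomp_part x\<close> plus \<open>frob\<close> of the value at
  \<open>\<delta> x\<close>; in \<open>K\<close> this \<open>frob\<close> may be traded for
  \<open>Z\<close>, that is for \<open>Q0\<close> on generators, and
  \<open>x = decomp_part x \<oplus> Q0 (\<delta> x)\<close> is reassembled.\<close>

lemma EG_F:
  assumes "x \<in> carrier M"
  shows "eqm K_words (EG (F x)) (eta P x)"
proof -
  note K_trans [trans] = eqm_trans[OF K_words_ideal] and from_R = eqm_R[OF K_words_ideal]
  obtain n where "\<forall>k\<ge>n. (\<delta> ^^ k) x = \<zero>" using \<delta>_nilpotent[OF assms] by blast
  then show ?thesis using assms
  proof (induction n arbitrary: x)
    case 0
    then have "x = \<zero>" by (metis funpow_0 le0)
    moreover have "eta P \<zero> \<in> R" using unit_closed by (intro R_zero_arg) auto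
    ultimately show ?case by (intro from_R) (simp add: eqm_def)
  next
    case (Suc n)
    note x = Suc.prems(2)
    have \<delta>x: "\<delta> x \<in> carrier M" using x by (rule \<delta>_closed)
    have IH: "eqm K_words (EG (F (\<delta> x))) (eta P (\<delta> x))"
      using Suc.prems(1) by (intro Suc.IH \<delta>x) (metis Suc_le_mono comp_apply funpow_Suc_right)
    have "eqm R (EG (F x)) (EG (eta P (cos x) + N.frob (F (\<delta> x))))"
      by (rule G.E_eqm[OF F_step[OF x]])
    also have "EG (eta P (cos x) + N.frob (F (\<delta> x))) = eta P (decomp_part x) + frob (EG (F (\<delta> x)))"
      using G.E_eta[OF cos_closed[OF x]] EG_frob[OF F_closed[OF \<delta>x]]
      unfolding ext_add by (simp only: sec_cos[OF x])
    finally have "eqm K_words (EG (F x)) (eta P (decomp_part x) + frob (EG (F (\<delta> x))))"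
      by (rule from_R)
    also have "eqm K_words \<dots> (eta P (decomp_part x) + frob (eta P (\<delta> x)))"
      by (intro eqm_add[OF K_words_ideal] eqm_refl[OF K_words_ideal] frob_eqm[OF K_words_ideal IH]
          G.E_closed F_closed eta_in_wcarrier \<delta>x)
    also have "eqm K_words \<dots> (eta P (decomp_part x) + Z (eta P (\<delta> x)))"
      by (intro eqm_add[OF K_words_ideal] eqm_refl[OF K_words_ideal] K_words_gen eta_in_wcarrier \<delta>x)
    also have "Z (eta P (\<delta> x)) = eta P (Q0 (\<delta> x))"
      unfolding Z_def by (rule Z.E_eta[OF \<delta>x])
    also have "eqm K_words (eta P (decomp_part x) + eta P (Q0 (\<delta> x))) (eta P (decomp_part x \<oplus> Q0 (\<delta> x)))"
      by (intro from_R eqm_sym[OF eta_add] decomp_part_closed Q0_closed x \<delta>x)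
    also have "decomp_part x \<oplus> Q0 (\<delta> x) = x"
      using x \<delta>x by (simp add: decomp_part_def Q0_closed a_assoc)
    finally show ?case .
  qed
qed

lemma EG_EF:
  assumes f: "f \<in> W"
  shows "eqm K_words (EG (EF f)) f"
proof -
  have "eqm K_words (ext P (\<lambda>x. EG (F x)) f) (ext P (eta P) f)"
    by (rule eqm_ext[OF K_words_ideal f]) (intro G.E_closed F_closed eta_in_wcarrier EG_F; assumption)+
  then show ?thesis using G.E_ext[OF f F_closed] ext_eta[OF f] by simp
qed

lemma EF_EG:
  assumes f: "f \<in> N.W"
  shows "eqm N.R (EF (EG f)) f"
proof -
  have eta: "eta P (sec T) \<in> W" if "T \<in> carrier N" for T
    by (rule eta_in_wcarrier[OF sec_closed[OF that]])
  have "eqm N.R (ext P (\<lambda>T. EF (eta P (sec T))) f) (ext P (eta P) f)"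
  proof (rule N.eqm_ext[OF N.op_ideal_R f])
    fix T assume T: "T \<in> carrier N"
    show "eqm N.R (EF (eta P (sec T))) (eta P T)"
      unfolding E.E_eta[OF sec_closed[OF T]] by (rule F_sec[OF T])
  qed (intro E.E_closed eta eta_in_wcarrier; assumption)+
  then show ?thesis using E.E_ext[OF f eta] ext_eta[OF f] by simp
qed

text \<open>If \<open>EF f\<close> is a relation, so is \<open>EG (EF f)\<close>, to which
  \<open>f\<close> is congruent modulo \<open>K_words\<close>. Hence the kernel of \<open>EF\<close>
  modulo relations is no larger than the ideal.\<close>

lemma K_words_eq: "K_words = {f \<in> W. EF f \<in> N.R}"
proof
  show "K_words \<subseteq> {f \<in> W. EF f \<in> N.R}"
  proof
    fix f assume "f \<in> K_words"
    then show "f \<in> {f \<in> W. EF f \<in> N.R}" using K_words_kernel[of f] by (simp add: K_words_def)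
  qed
  show "{f \<in> W. EF f \<in> N.R} \<subseteq> K_words"
  proof safe
    fix f assume f: "Poly_Mapping.keys f \<subseteq> words P M" "EF f \<in> N.R"
    have "EG (EF f) \<in> K_words" by (rule J_R[OF K_words_ideal G.E_R[OF f(2)]])
    moreover have "eqm K_words f (EG (EF f))" by (rule eqm_sym[OF EG_EF]) (simp add: f(1))
    ultimately show "f \<in> K_words" by (rule eqm_mem[OF K_words_ideal, rotated])
  qed
qed

section \<open>Passage to the quotient algebras\<close>

definition h :: "(('p, 'a) word \<Rightarrow>\<^sub>0 bit) set \<Rightarrow> (('p, 'a set) word \<Rightarrow>\<^sub>0 bit) set"
  where "h T = N.cl (EF (SOME f. f \<in> W \<and> cl f = T))"

lemma h_cl:
  assumes "f \<in> W"
  shows "h (cl f) = N.cl (EF f)"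
proof -
  define g where "g = (SOME g. g \<in> W \<and> cl g = cl f)"
  have "g \<in> W \<and> cl g = cl f" unfolding g_def by (rule someI[of _ f]) (simp only: assms simp_thms)
  then have "g \<in> W" "eqm R g f" using assms cl_eq_iff by blast+
  then show ?thesis
    unfolding h_def g_def[symmetric] using assms
    by (subst N.cl_eq_iff) (rule E.E_closed E.E_eqm; assumption)+
qed

lemma homog_W: "Poly_Mapping.keys f \<subseteq> homog_words P M d \<Longrightarrow> f \<in> W"
  using homog_words_subset by blast

lemma sec_hpart: "T \<in> hpart N d \<Longrightarrow> sec T \<in> hpart M d"
  unfolding N_hpart using sec_cos hpart_carrier decomp_part_hpart by auto

lemma N_homog_W:
  assumes "Poly_Mapping.keys f \<subseteq> homog_words P N d"
  shows "f \<in> N.W"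
proof -
  have sub: "hpart N e \<subseteq> carrier N" for e unfolding N_hpart N_carrier using hpart_carrier by blast
  have "set xs \<subseteq> carrier N" if "list_all2 (\<lambda>x e. x \<in> hpart N e) xs ds" for xs ds
    using that by (induction rule: list_all2_induct) (use sub in auto)
  then have "homog_words P N d \<subseteq> words P N" by (fastforce simp: homog_words_def words_def)
  then show ?thesis using assms by blast
qed

text \<open>The first isomorphism theorem for \<open>h\<close>, with kernel given by
  \<open>K_words_eq\<close>. Surjectivity comes from \<open>EG\<close>, and it holds degree by
  degree because \<open>sec\<close> preserves degrees.\<close>

lemma K_alg_iso: "\<exists>\<phi>. graded_palg_iso P (K_alg P star M) (free_palg P N) \<phi>"
  unfolding K_alg_def
proof (rule palg_quot_iso[where h = h])
  interpret S: f2_space S by (simp add: f2_space_def S_module)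
  show "module F2 S" by (rule S_module)
  show N_mod: "module F2 N.S" by (rule N.S_module)
  show "linear_map S N.S h"
    using N_mod
  proof (rule S.linear_mapI)
    fix T assume "T \<in> carrier S"
    then obtain f where "f \<in> W" "T = cl f" unfolding S_carrier by blast
    then show "h T \<in> carrier N.S" using N.cl_in_S[OF E.E_closed[of f]] h_cl[of f] by simp
    fix U assume "U \<in> carrier S"
    then obtain g where "g \<in> W" "U = cl g" unfolding S_carrier by blast
    with \<open>f \<in> W\<close> \<open>T = cl f\<close> show "h (T \<oplus>\<^bsub>S\<^esub> U) = h T \<oplus>\<^bsub>N.S\<^esub> h U"
      using S_add[of f g] h_cl[of f] h_cl[of g] h_cl[OF wcarrier_add[of f P M g]]
        N.S_add[OF E.E_closed E.E_closed, of f g] by (simp add: ext_add)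
  qed
  have EFG: "h (cl (EG g)) = N.cl g" if "g \<in> N.W" for g
  proof -
    have "h (cl (EG g)) = N.cl (EF (EG g))" by (rule h_cl[OF G.E_closed[OF that]])
    also have "\<dots> = N.cl g"
      using EF_EG[OF that] N.cl_eq_iff[OF E.E_closed[OF G.E_closed[OF that]] that] by blast
    finally show ?thesis .
  qed
  show "h ` carrier S = carrier N.S"
  proof
    show "h ` carrier S \<subseteq> carrier N.S"
    proof
      fix U assume "U \<in> h ` carrier S"
      then obtain f where "f \<in> W" "U = h (cl f)" unfolding S_carrier by blast
      then show "U \<in> carrier N.S" using N.cl_in_S[OF E.E_closed[of f]] h_cl[of f] by simp
    qed
    show "carrier N.S \<subseteq> h ` carrier S"
    proof
      fix U assume "U \<in> carrier N.S"
      then obtain g where g: "g \<in> N.W" "U = N.cl g" unfolding N.S_carrier by blast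
      have "U = h (cl (EG g))" using EFG[OF g(1)] g(2) by simp
      then show "U \<in> h ` carrier S" using cl_in_S[OF G.E_closed[OF g(1)]] by (rule image_eqI)
    qed
  qed
  show "hpart S d \<subseteq> carrier S" for d by (rule S_hpart_carrier)
  show "h ` hpart S d = hpart N.S d" for d
  proof
    show "h ` hpart S d \<subseteq> hpart N.S d"
    proof
      fix T assume "T \<in> h ` hpart S d"
      then obtain f where f: "Poly_Mapping.keys f \<subseteq> homog_words P M d" "T = h (cl f)"
        unfolding S_hpart by blast
      then have "T = N.cl (EF f)" using h_cl homog_W by metis
      then show "T \<in> hpart N.S d"
        using E.E_homog[OF F_hpart f(1)] unfolding N.S_hpart by blast
    qed
    show "hpart N.S d \<subseteq> h ` hpart S d"
    proof
      fix T assume "T \<in> hpart N.S d"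
      then obtain g where g: "Poly_Mapping.keys g \<subseteq> homog_words P N d" "T = N.cl g"
        unfolding N.S_hpart by blast
      have "Poly_Mapping.keys (EG g) \<subseteq> homog_words P M d"
        using eta_homog[OF sec_hpart] g(1) by (rule G.E_homog)
      then have "cl (EG g) \<in> hpart S d" unfolding S_hpart by blast
      then show "T \<in> h ` hpart S d" using EFG[OF N_homog_W[OF g(1)]] g(2) by (metis image_eqI)
    qed
  qed
  show "opr S \<mu> Ts \<in> carrier S \<and> h (opr S \<mu> Ts) = opr N.S \<mu> (map h Ts)"
    if \<mu>: "\<mu> \<in> carrier (ops P (length Ts))" and Ts: "set Ts \<subseteq> carrier S" for \<mu> Ts
  proof -
    obtain fs where fs: "set fs \<subseteq> W" "Ts = map cl fs" using Ts by (rule S_list)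
    have len: "\<mu> \<in> carrier (ops P (length fs))" using \<mu> fs(2) by simp
    have c: "wop P \<mu> fs \<in> W" using len fs(1) by (rule wop_closed)
    have "map h Ts = map N.cl (map EF fs)"
      unfolding fs(2) map_map using fs(1) by (intro map_cong refl) (simp only: comp_apply, rule h_cl, blast)
    moreover have "set (map EF fs) \<subseteq> N.W"
      unfolding set_map by (rule image_subsetI) (intro E.E_closed subsetD[OF fs(1)])
    ultimately have "opr N.S \<mu> (map h Ts) = N.cl (wop P \<mu> (map EF fs))"
      using N.S_opr[of \<mu> "map EF fs"] len by simp
    then show ?thesis
      unfolding fs(2) S_opr[OF len fs(1)] using h_cl[OF c] cl_in_S[OF c] E.E_wop[OF len fs(1)] fs(2) by simp
  qed
  show "K_ideal P star M = {T \<in> carrier S. h T = \<zero>\<^bsub>N.S\<^esub>}"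
  proof -
    have zero: "h (cl f) = \<zero>\<^bsub>N.S\<^esub> \<longleftrightarrow> cl f \<in> K_ideal P star M" if f: "f \<in> W" for f
    proof -
      have "h (cl f) = \<zero>\<^bsub>N.S\<^esub> \<longleftrightarrow> eqm N.R (EF f) 0"
        unfolding h_cl[OF f] N.S_zero using N.cl_eq_iff[OF E.E_closed[OF f], of 0] by simp
      also have "\<dots> \<longleftrightarrow> f \<in> K_words" using f by (simp add: K_words_eq eqm_def)
      finally show ?thesis using f by (simp add: K_words_def)
    qed
    moreover have "K_ideal P star M \<subseteq> carrier S"
    proof
      fix T assume "T \<in> K_ideal P star M"
      then have "T \<in> cl ` stable_kernel" using K_stable_stable_kernel by (simp add: K_ideal_iff)
      moreover have "stable_kernel \<subseteq> W" by (auto simp: stable_kernel_def)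
      ultimately show "T \<in> carrier S" unfolding S_carrier by blast
    qed
    ultimately show ?thesis unfolding S_carrier by blast
  qed
qed

end

theorem theorem1:
  fixes P :: "'p operad" and star :: 'p and M :: "'m umod"
  assumes "symmetric_operad P"
    and "star \<in> invariant_ops P 2"
    and "central_op P star"
    and "unstable_module M"
    and "connected_module M"
    and "reduced M"
  shows "\<exists>\<phi>. graded_palg_iso P (K_alg P star M)
    (free_palg P (suspension (loop_module M))) \<phi>"
proof -
  interpret P: symmetric_operad P by fact
  interpret M: unstable_module M by fact
  obtain \<delta> where \<delta>: "\<And>x. x \<in> carrier M \<Longrightarrow> \<delta> x \<in> carrier M"
    "\<And>x y. \<lbrakk>x \<in> carrier M; y \<in> carrier M\<rbrakk> \<Longrightarrow> \<delta> (x \<oplus>\<^bsub>M\<^esub> y) = \<delta> x \<oplus>\<^bsub>M\<^esub> \<delta> y"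
    "\<And>x. x \<in> carrier M \<Longrightarrow> \<delta> (Sq0 M (Sq M) x) = x"
    "\<And>d x. x \<in> hpart M d \<Longrightarrow> if even d then \<delta> x \<in> hpart M (d div 2) else \<delta> x = \<zero>\<^bsub>M\<^esub>"
    using M.exists_retraction[OF assms(6)] by blast
  have "operad_space P M"
    using assms(1) M.f2_space_axioms by (rule operad_space.intro)
  then have "unstable_star_space P M star"
    using assms M.graded_space_axioms
    by (intro unstable_star_space.intro unstable_operad_space.intro graded_operad_space.intro
        star_operad_space.intro star_operad_space_axioms.intro)
  then have "retract_space P M star \<delta>"
    using assms(5) \<delta> by (intro retract_space.intro retract_space_axioms.intro)
  then show ?thesis by (rule retract_space.K_alg_iso)
qed

end
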